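(* The connection $\Pi_\omega:\Omega^1_q(SU_N)\to\Omega^1_q(SU_N)$ for the quantum principal bundle $\mathbf{C}_q[SU_N]\hookleftarrow\mathbf{C}_q[\mathbf{C}P^{N-1}]$ (with fibre $\mathbf{C}_q[U_{N-1}]$) associated to the bicovariant splitting map $i:\Lambda^1_{U_{N-1}}\to\Lambda^1_{SU_N}$, $\overline{\det_{N-1}^{-1}-1}\mapsto e^0$, is strong and satisfies $$\Pi_\omega(e^0)=e^0,\qquad \Pi_\omega(e^+_i)=\Pi_\omega(e^-_i)=0\qquad(i=1,\dots,N-1).$$
   Context: Algebras are unital over $\mathbf{C}$; Sweedler notation is used. Fix $N\ge 2$, $q\in(0,1]$, $\nu=q-q^{-1}$, and an $N$-th root $q^{1/N}$ of $q$. Let $H(x)=1$ for $x>0$ and $H(x)=0$ for $x\le 0$, and $R^{ik}_{jl}=q^{\delta_{ik}}\delta_{il}\delta_{kj}+\nu H(k-i)\delta_{ij}\delta_{kl}$. Quantum groups. For $n\ge1$, $\mathbf{C}_q[M_n]$ is the bialgebra generated by $u^i_j$ ($1\le i,j\le n$) with relations $\sum_{w,x}R^{ac}_{wx}u^w_bu^x_d=\sum_{y,z}R^{yz}_{bd}u^a_yu^c_z$, $\Delta(u^i_j)=\sum_k u^i_k\otimes u^k_j$, $\varepsilon(u^i_j)=\delta_{ij}$. The element $\det_n=\sum_{\pi\in S_n}(-q)^{\ell(\pi)}u^1_{\pi(1)}\cdots u^n_{\pi(n)}$ is central and grouplike. $\mathbf{C}_q[U_n]$ is the Hopf algebra obtained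 by adjoining $\det_n^{-1}$, and $\mathbf{C}_q[SU_n]=\mathbf{C}_q[M_n]/\langle\det_n-1\rangle$. Put $G=\mathbf{C}_q[SU_N]$, $G^+=\ker\varepsilon$. $\alpha_N:G\to\mathbf{C}_q[U_{N-1}]$ is the Hopf algebra map with $\alpha_N(u^1_1)=\det_{N-1}^{-1}$, $\alpha_N(u^1_i)=\alpha_N(u^i_1)=0$ ($i\ne1$), $\alpha_N(u^i_j)=u^{i-1}_{j-1}$ ($i,j\ge2$), and $M=\mathbf{C}_q[\mathbf{C}P^{N-1}]$ is the algebra of coinvariants of $(\mathrm{id}\otimes\alpha_N)\Delta$ on $G$. Calculi. $G$ is coquasi-triangular with $r$ determined by $r(u^i_j\otimes u^k_l)=q^{-1/N}R^{ki}_{jl}$, $r(fg\otimes h)=r(f\otimes h_{(1)})r(g\otimes h_{(2)})$, $r(f\otimes gh)=r(f_{(1)}\otimes h)r(f_{(2)}\otimes g)$. Define $Q:G\to M_N(\mathbf{C})$ by $Q_{kl}(h)=\mathcal{Q}(h\otimes u^k_l)$, $\mathcal{Q}(h\otimes g)=r(g_{(1)}\otimes h_{(1)})r(h_{(2)}\otimes g_{(2)})$. Let $I_{SU_N}=(\ker Q\cap G^+)+\mathrm{span}\{u^i_1S(u^1_i):2\le i\le N\}+\mathrm{span}\{u^i_j:2\le i,j\le N,\ i\ne j\}$, a right ideal of $G^+$, and $\Lambda^1_{SU_N}=G^+/I_{SU_N}$ with classes $\overline{v}$. The calculus $\Omega^1_q(SU_N)$ is $G\otimes\Lambda^1_{SU_N}$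 with left multiplication on the first factor, $(g\otimes\overline{v})h=gh_{(1)}\otimes\overline{vh_{(2)}}$, $\mathrm{d}h=h_{(1)}\otimes\overline{h_{(2)}-\varepsilon(h_{(2)})1}$. Write $e^0=\overline{u^1_1-1}$, $e^+_i=\overline{u^{i+1}_1}$, $e^-_i=\overline{u^1_{i+1}}$ ($1\le i\le N-1$), also for the forms $1\otimes e^0$, $1\otimes e^\pm_i$. $\Omega^1_q(\mathbf{C}P^{N-1})=\mathrm{span}\{f\,\mathrm{d}g:f,g\in M\}$. On the fibre, $\Lambda^1_{U_{N-1}}=\mathbf{C}_q[U_{N-1}]^+/\alpha_N(I_{SU_N})$, which is spanned by $\overline{\det_{N-1}^{-1}-1}$. Connections. For a quantum principal $H$-bundle $P\hookleftarrow M$ with calculus $\Omega^1(P)$, a connection is a left $P$-module projection $\Pi:\Omega^1(P)\to\Omega^1(P)$ with $\ker\Pi=P\Omega^1(M)P$ and commuting with the right $H$-coaction: $\Delta_R\circ\Pi=(\Pi\otimes\mathrm{id})\circ\Delta_R$. It is strong if $(\mathrm{id}-\Pi)(\Omega^1(P))\subseteq P\Omega^1(M)$. Here $\overline{\mathrm{ver}}:G\otimes\Lambda^1_{SU_N}\to G\otimes\Lambda^1_{U_{N-1}}$ is $g\otimes\overline{v}\mapsto g\otimes\overline{\alpha_N(v)}$, the connection form of $i$ is $\omega(x)=1\otimes i(x)$, and $\Pi_\omega=m\circ(\mathrm{id}\otimes\omega)\circ\overline{\mathrm{ver}}$. *)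

theory Defs
  imports Complex_Main "HOL-Library.Poly_Mapping" "HOL-Combinatorics.Permutations"
begin

section \<open>Complex vector spaces and algebras\<close>

class complex_vector = ab_group_add +
  fixes scaleC :: "complex \<Rightarrow> 'a \<Rightarrow> 'a" (infixr \<open>*\<^sub>C\<close> 75)
  assumes scaleC_add_right: "a *\<^sub>C (x + y) = a *\<^sub>C x + a *\<^sub>C y"
    and scaleC_add_left: "(a + b) *\<^sub>C x = a *\<^sub>C x + b *\<^sub>C x"
    and scaleC_scaleC: "a *\<^sub>C b *\<^sub>C x = (a * b) *\<^sub>C x"
    and scaleC_one: "1 *\<^sub>C x = x"

class complex_algebra_1 = complex_vector + ring_1 +
  assumes mult_scaleC_left: "(a *\<^sub>C x) * y = a *\<^sub>C (x * y)"
    and mult_scaleC_right: "x * (a *\<^sub>C y) = a *\<^sub>C (x * y)"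

global_interpretation complex_vector:
  vector_space "scaleC :: complex \<Rightarrow> 'a \<Rightarrow> 'a::complex_vector"
  by unfold_locales (rule scaleC_add_right scaleC_add_left scaleC_scaleC scaleC_one)+

abbreviation cspan :: "'a::complex_vector set \<Rightarrow> 'a set" where
  "cspan \<equiv> complex_vector.span"

abbreviation clinear :: "('a::complex_vector \<Rightarrow> 'b::complex_vector) \<Rightarrow> bool" where
  "clinear \<equiv> Vector_Spaces.linear scaleC scaleC"

lemma clinearI:
  assumes "\<And>x y. f (x + y) = f x + f y" "\<And>c x. f (c *\<^sub>C x) = c *\<^sub>C f x"
  shows "clinear f"
  by (simp add: linear_iff_module_hom module_hom_def module_hom_axioms_def assms
      complex_vector.module_axioms)

lemma clinear_add: "clinear f \<Longrightarrow> f (x + y) = f x + f y"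
  and clinear_scale: "clinear f \<Longrightarrow> f (c *\<^sub>C x) = c *\<^sub>C f x"
  by (auto simp: linear_iff_module_hom module_hom_def module_hom_axioms_def)

lemma clinear_diff: "clinear f \<Longrightarrow> f (x - y) = f x - f y"
  by (metis add_diff_cancel_right' clinear_add diff_add_cancel)

definition cbilinear :: "('a::complex_vector \<Rightarrow> 'b::complex_vector \<Rightarrow> 'c::complex_vector) \<Rightarrow> bool" where
  "cbilinear B \<longleftrightarrow> (\<forall>x. clinear (B x)) \<and> (\<forall>y. clinear (\<lambda>x. B x y))"

instantiation complex :: complex_algebra_1
begin

definition scaleC_complex :: "complex \<Rightarrow> complex \<Rightarrow> complex" where
  "scaleC_complex = (*)"

instance
  by standard (auto simp: scaleC_complex_def algebra_simps)

end

instantiation poly_mapping :: (type, complex_vector) complex_vector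
begin

definition scaleC_poly_mapping :: "complex \<Rightarrow> ('a \<Rightarrow>\<^sub>0 'b) \<Rightarrow> 'a \<Rightarrow>\<^sub>0 'b" where
  "scaleC_poly_mapping c p = Poly_Mapping.map (scaleC c) p"

lemma lookup_scaleC [simp]: "Poly_Mapping.lookup (c *\<^sub>C p) x = c *\<^sub>C Poly_Mapping.lookup p x"
  by (simp add: scaleC_poly_mapping_def Poly_Mapping.map.rep_eq when_def)

instance
  by standard (auto intro!: poly_mapping_eqI
      simp: lookup_add scaleC_add_right scaleC_add_left scaleC_scaleC scaleC_one)

end

lemma poly_mapping_add_induct [case_names zero single add]:
  assumes "P 0" "\<And>k c. P (Poly_Mapping.single k c)" "\<And>p q. P p \<Longrightarrow> P q \<Longrightarrow> P (p + q)"
  shows "P (p :: 'a \<Rightarrow>\<^sub>0 'b::monoid_add)"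
proof (induction p rule: update_induct)
  case (update f a b)
  have "Poly_Mapping.update a b f = f + Poly_Mapping.single a b"
    using update(1) by (intro poly_mapping_eqI)
      (auto simp: lookup_add lookup_update lookup_single when_def in_keys_iff)
  then show ?case using assms update by metis
qed (rule assms)

lemma scaleC_single: "c *\<^sub>C Poly_Mapping.single k a = Poly_Mapping.single k (c *\<^sub>C a)"
  by (rule poly_mapping_eqI) (simp add: lookup_single when_def)

lemma poly_mapping_eq_of_singles:
  fixes f g :: "('a \<Rightarrow>\<^sub>0 'b::monoid_add) \<Rightarrow> 'c::group_add"
  assumes "\<And>p q. f (p + q) = f p + f q" "\<And>p q. g (p + q) = g p + g q"
    and "\<And>k c. f (Poly_Mapping.single k c) = g (Poly_Mapping.single k c)"
  shows "f p = g p"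
proof (induction p rule: poly_mapping_add_induct)
  case zero
  show ?case using assms(1)[of 0 0] assms(2)[of 0 0] by (metis add.right_neutral add_left_imp_eq)
next
  case (add p q)
  then show ?case by (simp only: assms(1,2))
qed (rule assms(3))

instance poly_mapping :: (monoid_add, complex_algebra_1) complex_algebra_1
proof
  fix a :: complex and x y :: "'a \<Rightarrow>\<^sub>0 'b"
  have *: "(a *\<^sub>C Poly_Mapping.single k c) * y = a *\<^sub>C (Poly_Mapping.single k c * y)" for k c
    by (rule poly_mapping_eq_of_singles[where f = "\<lambda>y. (a *\<^sub>C Poly_Mapping.single k c) * y"
          and g = "\<lambda>y. a *\<^sub>C (Poly_Mapping.single k c * y)" and p = y])
      (simp_all only: distrib_left scaleC_add_right scaleC_single mult_single mult_scaleC_left)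
  show "(a *\<^sub>C x) * y = a *\<^sub>C (x * y)"
    by (rule poly_mapping_eq_of_singles[where f = "\<lambda>x. (a *\<^sub>C x) * y"
          and g = "\<lambda>x. a *\<^sub>C (x * y)" and p = x])
      (simp_all only: distrib_right scaleC_add_right *)
  have **: "Poly_Mapping.single k c * (a *\<^sub>C y) = a *\<^sub>C (Poly_Mapping.single k c * y)" for k c
    by (rule poly_mapping_eq_of_singles[where f = "\<lambda>y. Poly_Mapping.single k c * (a *\<^sub>C y)"
          and g = "\<lambda>y. a *\<^sub>C (Poly_Mapping.single k c * y)" and p = y])
      (simp_all only: distrib_left scaleC_add_right scaleC_single mult_single mult_scaleC_right)
  show "x * (a *\<^sub>C y) = a *\<^sub>C (x * y)"
    by (rule poly_mapping_eq_of_singles[where f = "\<lambda>x. x * (a *\<^sub>C y)"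
          and g = "\<lambda>x. a *\<^sub>C (x * y)" and p = x])
      (simp_all only: distrib_right scaleC_add_right **)
qed

section \<open>Tensor products\<close>

(* The tensor product is the free vector space on pairs modulo the bilinearity relations. *)

definition tensor_relators :: "(('a::complex_vector \<times> 'b::complex_vector) \<Rightarrow>\<^sub>0 complex) set" where
  "tensor_relators =
     {Poly_Mapping.single (x + x', y) 1 - Poly_Mapping.single (x, y) 1
        - Poly_Mapping.single (x', y) 1 | x x' y. True}
   \<union> {Poly_Mapping.single (x, y + y') 1 - Poly_Mapping.single (x, y) 1
        - Poly_Mapping.single (x, y') 1 | x y y'. True}
   \<union> {Poly_Mapping.single (c *\<^sub>C x, y) 1 - c *\<^sub>C Poly_Mapping.single (x, y) 1 | c x y. True}
   \<union> {Poly_Mapping.single (x, c *\<^sub>C y) 1 - c *\<^sub>C Poly_Mapping.single (x, y) 1 | c x y. True}"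

definition tensor_rel ::
  "(('a::complex_vector \<times> 'b::complex_vector) \<Rightarrow>\<^sub>0 complex) \<Rightarrow> (('a \<times> 'b) \<Rightarrow>\<^sub>0 complex) \<Rightarrow> bool" where
  "tensor_rel p p' \<longleftrightarrow> p - p' \<in> cspan tensor_relators"

quotient_type (overloaded) ('a, 'b) tensor =
  "('a::complex_vector \<times> 'b::complex_vector) \<Rightarrow>\<^sub>0 complex" / tensor_rel
proof (rule equivpI)
  show "reflp (tensor_rel :: (('a \<times> 'b) \<Rightarrow>\<^sub>0 complex) \<Rightarrow> _)"
    by (rule reflpI) (simp add: tensor_rel_def complex_vector.span_zero)
  show "symp (tensor_rel :: (('a \<times> 'b) \<Rightarrow>\<^sub>0 complex) \<Rightarrow> _)"
  proof (rule sympI)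
    fix p r :: "('a \<times> 'b) \<Rightarrow>\<^sub>0 complex"
    assume "tensor_rel p r"
    then have "- (p - r) \<in> cspan tensor_relators"
      unfolding tensor_rel_def by (rule complex_vector.span_neg)
    then show "tensor_rel r p" by (simp only: tensor_rel_def minus_diff_eq)
  qed
  show "transp (tensor_rel :: (('a \<times> 'b) \<Rightarrow>\<^sub>0 complex) \<Rightarrow> _)"
  proof (rule transpI)
    fix p r s :: "('a \<times> 'b) \<Rightarrow>\<^sub>0 complex"
    assume "tensor_rel p r" "tensor_rel r s"
    then have "(p - r) + (r - s) \<in> cspan tensor_relators"
      unfolding tensor_rel_def by (rule complex_vector.span_add)
    then show "tensor_rel p s" by (simp add: tensor_rel_def)
  qed
qed

instantiation tensor :: (complex_vector, complex_vector) complex_vector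
begin

lift_definition zero_tensor :: "('a, 'b) tensor" is 0 .

lift_definition plus_tensor :: "('a, 'b) tensor \<Rightarrow> ('a, 'b) tensor \<Rightarrow> ('a, 'b) tensor" is "(+)"
  unfolding tensor_rel_def by (simp only: add_diff_add complex_vector.span_add)

lift_definition uminus_tensor :: "('a, 'b) tensor \<Rightarrow> ('a, 'b) tensor" is uminus
  unfolding tensor_rel_def minus_diff_minus by (rule complex_vector.span_neg)

lift_definition minus_tensor :: "('a, 'b) tensor \<Rightarrow> ('a, 'b) tensor \<Rightarrow> ('a, 'b) tensor" is "(-)"
proof -
  fix p p' r r' :: "('a \<times> 'b) \<Rightarrow>\<^sub>0 complex"
  assume "tensor_rel p p'" "tensor_rel r r'"
  moreover have "(p - r) - (p' - r') = (p - p') - (r - r')" by simp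
  ultimately show "tensor_rel (p - r) (p' - r')"
    unfolding tensor_rel_def by (simp only: complex_vector.span_diff)
qed

lift_definition scaleC_tensor :: "complex \<Rightarrow> ('a, 'b) tensor \<Rightarrow> ('a, 'b) tensor" is scaleC
  unfolding tensor_rel_def complex_vector.scale_right_diff_distrib[symmetric]
  by (rule complex_vector.span_scale)

instance
proof
  have refl: "tensor_rel p p" for p :: "('a \<times> 'b) \<Rightarrow>\<^sub>0 complex"
    by (simp add: tensor_rel_def complex_vector.span_zero)
  fix x y z :: "('a, 'b) tensor" and a b :: complex
  show "x + y + z = x + (y + z)" by transfer (simp only: add.assoc refl)
  show "x + y = y + x" by transfer (simp only: add.commute refl)
  show "0 + x = x" by transfer (simp only: add_0 refl)
  show "- x + x = 0" by transfer (simp only: left_minus refl)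
  show "x - y = x + - y" by transfer (simp only: diff_conv_add_uminus refl)
  show "a *\<^sub>C (x + y) = a *\<^sub>C x + a *\<^sub>C y" by transfer (simp only: scaleC_add_right refl)
  show "(a + b) *\<^sub>C x = a *\<^sub>C x + b *\<^sub>C x" by transfer (simp only: scaleC_add_left refl)
  show "a *\<^sub>C b *\<^sub>C x = (a * b) *\<^sub>C x" by transfer (simp only: scaleC_scaleC refl)
  show "1 *\<^sub>C x = x" by transfer (simp only: scaleC_one refl)
qed

end

lift_definition tensor_elem :: "'a::complex_vector \<Rightarrow> 'b::complex_vector \<Rightarrow> ('a, 'b) tensor"
  (infixl \<open>\<otimes>\<close> 72) is "\<lambda>x y. Poly_Mapping.single (x, y) 1" .

lemma tensor_add_left: "(x + x') \<otimes> y = x \<otimes> y + x' \<otimes> y"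
  by transfer (unfold tensor_rel_def diff_diff_eq[symmetric], rule complex_vector.span_base,
      unfold tensor_relators_def, blast)

lemma tensor_add_right: "x \<otimes> (y + y') = x \<otimes> y + x \<otimes> y'"
  by transfer (unfold tensor_rel_def diff_diff_eq[symmetric], rule complex_vector.span_base,
      unfold tensor_relators_def, blast)

lemma tensor_scale_left: "(c *\<^sub>C x) \<otimes> y = c *\<^sub>C (x \<otimes> y)"
  by transfer (unfold tensor_rel_def, rule complex_vector.span_base,
      unfold tensor_relators_def, blast)

lemma tensor_scale_right: "x \<otimes> (c *\<^sub>C y) = c *\<^sub>C (x \<otimes> y)"
  by transfer (unfold tensor_rel_def, rule complex_vector.span_base,
      unfold tensor_relators_def, blast)

lemma tensor_induct [case_names elem add]:
  assumes "\<And>x y. P (x \<otimes> y)" "\<And>s t. P s \<Longrightarrow> P t \<Longrightarrow> P (s + t)"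
  shows "P t"
proof -
  have "P (abs_tensor p)" for p
  proof (induction p rule: poly_mapping_add_induct)
    case zero
    have "abs_tensor 0 = (0 :: 'a) \<otimes> (0 :: 'b)"
      using tensor_scale_left[of 0 "0::'a" "0::'b"] by (simp add: zero_tensor.abs_eq)
    then show ?case by (simp add: assms)
  next
    case (single k c)
    have "abs_tensor (Poly_Mapping.single k c) = c *\<^sub>C (fst k \<otimes> snd k)"
      by (simp add: tensor_elem.abs_eq scaleC_tensor.abs_eq scaleC_single scaleC_complex_def)
    then show ?case by (metis assms(1) tensor_scale_left)
  next
    case (add p q)
    then show ?case by (simp add: assms(2) flip: plus_tensor.abs_eq)
  qed
  then show ?thesis by (metis Quotient_abs_rep Quotient_tensor)
qed

lemma tensor_lift_exists:
  fixes B :: "'a::complex_vector \<Rightarrow> 'b::complex_vector \<Rightarrow> 'c::complex_vector"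
  assumes B: "cbilinear B"
  shows "\<exists>f. clinear f \<and> (\<forall>x y. f (x \<otimes> y) = B x y)"
proof -
  define E where "E p = (\<Sum>k\<in>Poly_Mapping.keys p. Poly_Mapping.lookup p k *\<^sub>C B (fst k) (snd k))"
    for p :: "('a \<times> 'b) \<Rightarrow>\<^sub>0 complex"
  have E_sup: "E p = (\<Sum>k\<in>S. Poly_Mapping.lookup p k *\<^sub>C B (fst k) (snd k))"
    if "finite S" "Poly_Mapping.keys p \<subseteq> S" for p S
    unfolding E_def using that by (intro sum.mono_neutral_left) (auto simp: in_keys_iff)
  have E: "clinear E"
  proof (rule clinearI)
    fix p q :: "('a \<times> 'b) \<Rightarrow>\<^sub>0 complex" and c
    let ?S = "Poly_Mapping.keys p \<union> Poly_Mapping.keys q"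
    have "Poly_Mapping.keys (p + q) \<subseteq> ?S" by (rule Poly_Mapping.keys_add)
    then show "E (p + q) = E p + E q"
      by (simp add: E_sup[of ?S] lookup_add scaleC_add_left sum.distrib)
    have "Poly_Mapping.keys (c *\<^sub>C p) \<subseteq> Poly_Mapping.keys p"
      by (auto simp: in_keys_iff)
    then show "E (c *\<^sub>C p) = c *\<^sub>C E p"
      by (simp add: E_sup[of "Poly_Mapping.keys p"] scaleC_complex_def scaleC_scaleC
          complex_vector.scale_sum_right)
  qed
  have E_single: "E (Poly_Mapping.single (x, y) 1) = B x y" for x y
    by (simp add: E_def)
  have B1: "B (x + x') y = B x y + B x' y" and B2: "B (c *\<^sub>C x) y = c *\<^sub>C B x y" for x x' y c
    using B clinear_add[of "\<lambda>x. B x y"] clinear_scale[of "\<lambda>x. B x y"]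
    by (auto simp: cbilinear_def)
  have B3: "B x (y + y') = B x y + B x y'" and B4: "B x (c *\<^sub>C y) = c *\<^sub>C B x y" for x y y' c
    using B clinear_add[of "B x"] clinear_scale[of "B x"] by (auto simp: cbilinear_def)
  have E_relator: "E p = 0" if "p \<in> tensor_relators" for p
    using that unfolding tensor_relators_def
    by (elim UnE CollectE exE conjE)
      (simp_all only: clinear_diff[OF E] clinear_scale[OF E] E_single B1 B2 B3 B4, simp_all)
  have "E p = 0" if "p \<in> cspan tensor_relators" for p
    using that by (induction rule: complex_vector.span_induct_alt)
      (simp_all add: clinear_add[OF E] clinear_scale[OF E] E_relator E_def[of 0])
  then have E_rel: "E p = E q" if "tensor_rel p q" for p q
    using that clinear_diff[OF E, of p q] by (simp add: tensor_rel_def)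
  define f where "f t = E (rep_tensor t)" for t
  have f_abs: "f (abs_tensor p) = E p" for p
    unfolding f_def by (rule E_rel) (metis Quotient_abs_rep Quotient_tensor tensor.abs_eq_iff)
  have abs_cases: "\<exists>p. t = abs_tensor p" for t :: "('a, 'b) tensor"
    by (metis Quotient_abs_rep Quotient_tensor)
  have "clinear f"
  proof (rule clinearI)
    fix s t :: "('a, 'b) tensor" and c
    obtain p q where "s = abs_tensor p" "t = abs_tensor q" using abs_cases by metis
    then show "f (s + t) = f s + f t" "f (c *\<^sub>C s) = c *\<^sub>C f s"
      by (simp_all add: plus_tensor.abs_eq scaleC_tensor.abs_eq f_abs clinear_add[OF E] clinear_scale[OF E])
  qed
  moreover have "f (x \<otimes> y) = B x y" for x y
    by (simp add: tensor_elem.abs_eq f_abs E_single)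
  ultimately show ?thesis by blast
qed

lemma tensor_map_eqI:
  assumes "clinear f" "clinear g" "\<And>x y. f (x \<otimes> y) = g (x \<otimes> y)"
  shows "f = g"
proof
  fix t show "f t = g t"
    by (induction t rule: tensor_induct) (simp_all add: assms clinear_add[OF assms(1)] clinear_add[OF assms(2)])
qed

definition tlift :: "('a::complex_vector \<Rightarrow> 'b::complex_vector \<Rightarrow> 'c::complex_vector)
    \<Rightarrow> ('a, 'b) tensor \<Rightarrow> 'c" where
  "tlift B = (THE f. clinear f \<and> (\<forall>x y. f (x \<otimes> y) = B x y))"

lemma tlift:
  assumes "cbilinear B"
  shows clinear_tlift: "clinear (tlift B)" and tlift_elem: "tlift B (x \<otimes> y) = B x y"
proof -
  have "\<exists>!f. clinear f \<and> (\<forall>x y. f (x \<otimes> y) = B x y)"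
    using tensor_lift_exists[OF assms] tensor_map_eqI by (metis (no_types, lifting))
  from theI'[OF this] show "clinear (tlift B)" "tlift B (x \<otimes> y) = B x y"
    by (auto simp: tlift_def)
qed

definition tmap :: "('a::complex_vector \<Rightarrow> 'c::complex_vector) \<Rightarrow> ('b::complex_vector \<Rightarrow> 'd::complex_vector)
    \<Rightarrow> ('a, 'b) tensor \<Rightarrow> ('c, 'd) tensor" where
  "tmap f g = tlift (\<lambda>x y. f x \<otimes> g y)"

section \<open>Hopf algebras\<close>

record (overloaded) 'a hopf =
  comult :: "'a::complex_algebra_1 \<Rightarrow> ('a, 'a) tensor"
  counit :: "'a \<Rightarrow> complex"
  antipode :: "'a \<Rightarrow> 'a"

(* sweedler2 H F h is the sum of F h_(1) h_(2); sweedler3 H F h that of F h_(1) h_(2) h_(3). *)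

definition sweedler2 ::
  "('a::complex_algebra_1, 'm) hopf_scheme \<Rightarrow> ('a \<Rightarrow> 'a \<Rightarrow> 'b::complex_vector) \<Rightarrow> 'a \<Rightarrow> 'b" where
  "sweedler2 H F h = tlift F (comult H h)"

definition sweedler3 ::
  "('a::complex_algebra_1, 'm) hopf_scheme \<Rightarrow> ('a \<Rightarrow> 'a \<Rightarrow> 'a \<Rightarrow> 'b::complex_vector) \<Rightarrow> 'a \<Rightarrow> 'b" where
  "sweedler3 H F h = sweedler2 H (\<lambda>a b. sweedler2 H (F a) b) h"

definition calgebra_hom :: "('a::complex_algebra_1 \<Rightarrow> 'b::complex_algebra_1) \<Rightarrow> bool" where
  "calgebra_hom f \<longleftrightarrow> clinear f \<and> f 1 = 1 \<and> (\<forall>x y. f (x * y) = f x * f y)"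

definition hopf_algebra :: "('a::complex_algebra_1, 'm) hopf_scheme \<Rightarrow> bool" where
  "hopf_algebra H \<longleftrightarrow>
     clinear (comult H) \<and> comult H 1 = 1 \<otimes> 1 \<and>
     (\<forall>g h. comult H (g * h)
        = sweedler2 H (\<lambda>a b. sweedler2 H (\<lambda>c d. (a * c) \<otimes> (b * d)) h) g) \<and>
     calgebra_hom (counit H) \<and>
     (\<forall>h. sweedler2 H (\<lambda>a b. comult H a \<otimes> b) h
        = sweedler3 H (\<lambda>a b c. (a \<otimes> b) \<otimes> c) h) \<and>
     (\<forall>h. sweedler2 H (\<lambda>a b. counit H a *\<^sub>C b) h = h) \<and>
     (\<forall>h. sweedler2 H (\<lambda>a b. counit H b *\<^sub>C a) h = h) \<and>
     clinear (antipode H) \<and>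
     (\<forall>h. sweedler2 H (\<lambda>a b. antipode H a * b) h = counit H h *\<^sub>C 1) \<and>
     (\<forall>h. sweedler2 H (\<lambda>a b. a * antipode H b) h = counit H h *\<^sub>C 1)"

definition hopf_algebra_hom ::
  "('a::complex_algebra_1, 'm) hopf_scheme \<Rightarrow> ('b::complex_algebra_1, 'n) hopf_scheme
     \<Rightarrow> ('a \<Rightarrow> 'b) \<Rightarrow> bool" where
  "hopf_algebra_hom G H f \<longleftrightarrow>
     calgebra_hom f \<and>
     (\<forall>x. comult H (f x) = tmap f f (comult G x)) \<and>
     (\<forall>x. counit H (f x) = counit G x) \<and>
     (\<forall>x. antipode H (f x) = f (antipode G x))"

(* The kernel H^+ of the counit. *)
definition aug :: "('a::complex_algebra_1, 'm) hopf_scheme \<Rightarrow> 'a set" where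
  "aug H = {h. counit H h = 0}"

definition coquasi_triangular ::
  "('a::complex_algebra_1, 'm) hopf_scheme \<Rightarrow> (('a, 'a) tensor \<Rightarrow> complex) \<Rightarrow> bool" where
  "coquasi_triangular H r \<longleftrightarrow>
     clinear r \<and>
     (\<exists>r'. clinear r' \<and>
        (\<forall>f g. sweedler2 H (\<lambda>f1 f2. sweedler2 H (\<lambda>g1 g2. r (f1 \<otimes> g1) * r' (f2 \<otimes> g2)) g) f
                = counit H f * counit H g) \<and>
        (\<forall>f g. sweedler2 H (\<lambda>f1 f2. sweedler2 H (\<lambda>g1 g2. r' (f1 \<otimes> g1) * r (f2 \<otimes> g2)) g) f
                = counit H f * counit H g)) \<and>
     (\<forall>f g. sweedler2 H (\<lambda>f1 f2. sweedler2 H (\<lambda>g1 g2. r (f2 \<otimes> g2) *\<^sub>C (g1 * f1)) g) f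
          = sweedler2 H (\<lambda>f1 f2. sweedler2 H (\<lambda>g1 g2. r (f1 \<otimes> g1) *\<^sub>C (f2 * g2)) g) f) \<and>
     (\<forall>f g h. r ((f * g) \<otimes> h) = sweedler2 H (\<lambda>h1 h2. r (f \<otimes> h1) * r (g \<otimes> h2)) h) \<and>
     (\<forall>f g h. r (f \<otimes> (g * h)) = sweedler2 H (\<lambda>f1 f2. r (f1 \<otimes> h) * r (f2 \<otimes> g)) f)"

section \<open>Algebras given by generators and relations\<close>

(* Words form the free monoid, so that ('x list \<Rightarrow>\<^sub>0 complex) with the convolution product
   of Poly_Mapping is the free unital complex algebra on 'x. *)

instantiation list :: (type) monoid_add
begin

definition zero_list :: "'a list" where "zero_list = []"
definition plus_list :: "'a list \<Rightarrow> 'a list \<Rightarrow> 'a list" where "plus_list = (@)"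

instance
  by standard (simp_all add: zero_list_def plus_list_def)

end

type_synonym 'x free_algebra = "'x list \<Rightarrow>\<^sub>0 complex"

definition free_gen :: "'x \<Rightarrow> 'x free_algebra" where
  "free_gen x = Poly_Mapping.single [x] 1"

definition free_algebra_on :: "'x set \<Rightarrow> 'x free_algebra set" where
  "free_algebra_on X = {p. Poly_Mapping.keys p \<subseteq> lists X}"

definition free_eval :: "('x \<Rightarrow> 'a::complex_algebra_1) \<Rightarrow> 'x free_algebra \<Rightarrow> 'a" where
  "free_eval \<phi> p = (\<Sum>w\<in>Poly_Mapping.keys p. Poly_Mapping.lookup p w *\<^sub>C prod_list (map \<phi> w))"

definition free_ideal :: "'x set \<Rightarrow> 'x free_algebra set \<Rightarrow> 'x free_algebra set" where
  "free_ideal X Rel = cspan {a * p * b | a p b. a \<in> free_algebra_on X \<and> p \<in> Rel \<and> b \<in> free_algebra_on X}"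

(* The algebra 'a, with x in X interpreted as \<phi> x, is the quotient of the free algebra on X
   by the two-sided ideal generated by Rel. *)
definition presented_by ::
  "'x set \<Rightarrow> 'x free_algebra set \<Rightarrow> ('x \<Rightarrow> 'a::complex_algebra_1) \<Rightarrow> bool" where
  "presented_by X Rel \<phi> \<longleftrightarrow>
     free_eval \<phi> ` free_algebra_on X = UNIV \<and>
     {p \<in> free_algebra_on X. free_eval \<phi> p = 0} = free_ideal X Rel"

section \<open>The quantum groups\<close>

definition Heav :: "int \<Rightarrow> complex" where
  "Heav x = (if x > 0 then 1 else 0)"

definition kron :: "nat \<Rightarrow> nat \<Rightarrow> complex" where
  "kron i j = (if i = j then 1 else 0)"

definition nu :: "real \<Rightarrow> complex" where
  "nu q = complex_of_real (q - inverse q)"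

(* Rmat q i k j l is the entry with upper indices i, k and lower indices j, l. *)
definition Rmat :: "real \<Rightarrow> nat \<Rightarrow> nat \<Rightarrow> nat \<Rightarrow> nat \<Rightarrow> complex" where
  "Rmat q i k j l =
     (if i = k then complex_of_real q else 1) * kron i l * kron k j
     + nu q * Heav (int k - int i) * kron i j * kron k l"

definition perm_length :: "nat \<Rightarrow> (nat \<Rightarrow> nat) \<Rightarrow> nat" where
  "perm_length n \<pi> = card {(i, j). 1 \<le> i \<and> i < j \<and> j \<le> n \<and> \<pi> j < \<pi> i}"

definition qdet :: "nat \<Rightarrow> real \<Rightarrow> (nat \<Rightarrow> nat \<Rightarrow> 'a::complex_algebra_1) \<Rightarrow> 'a" where
  "qdet n q u = (\<Sum>\<pi> | \<pi> permutes {1..n}.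
     (- complex_of_real q) ^ perm_length n \<pi> *\<^sub>C prod_list (map (\<lambda>i. u i (\<pi> i)) [1..<Suc n]))"

datatype qgen = Mat nat nat | DetInv

definition mat_gens :: "nat \<Rightarrow> qgen set" where
  "mat_gens n = {Mat i j | i j. i \<in> {1..n} \<and> j \<in> {1..n}}"

abbreviation fmat :: "nat \<Rightarrow> nat \<Rightarrow> qgen free_algebra" where
  "fmat i j \<equiv> free_gen (Mat i j)"

abbreviation fdetinv :: "qgen free_algebra" where
  "fdetinv \<equiv> free_gen DetInv"

definition RTT_relators :: "nat \<Rightarrow> real \<Rightarrow> qgen free_algebra set" where
  "RTT_relators n q =
     {(\<Sum>w\<in>{1..n}. \<Sum>x\<in>{1..n}. Rmat q a c w x *\<^sub>C (fmat w b * fmat x d))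
      - (\<Sum>y\<in>{1..n}. \<Sum>z\<in>{1..n}. Rmat q y z b d *\<^sub>C (fmat a y * fmat c z))
      | a b c d. a \<in> {1..n} \<and> b \<in> {1..n} \<and> c \<in> {1..n} \<and> d \<in> {1..n}}"

record (overloaded) 'a qgroup = "'a::complex_algebra_1 hopf" +
  mat :: "nat \<Rightarrow> nat \<Rightarrow> 'a"

(* Entries of mat G with an index outside {1..n} are irrelevant. *)

definition matrix_coalgebra :: "nat \<Rightarrow> ('a::complex_algebra_1, 'm) qgroup_scheme \<Rightarrow> bool" where
  "matrix_coalgebra n G \<longleftrightarrow>
     (\<forall>i\<in>{1..n}. \<forall>j\<in>{1..n}. comult G (mat G i j) = (\<Sum>k\<in>{1..n}. mat G i k \<otimes> mat G k j)
        \<and> counit G (mat G i j) = kron i j)"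

definition quantum_SU :: "nat \<Rightarrow> real \<Rightarrow> ('a::complex_algebra_1, 'm) qgroup_scheme \<Rightarrow> bool" where
  "quantum_SU n q G \<longleftrightarrow>
     hopf_algebra G \<and> matrix_coalgebra n G \<and>
     presented_by (mat_gens n) (RTT_relators n q \<union> {qdet n q fmat - 1})
       (\<lambda>x. case x of Mat i j \<Rightarrow> mat G i j | DetInv \<Rightarrow> 1)"

(* The adjoined inverse detinv is automatically central, the quantum determinant being so. *)
definition quantum_U ::
  "nat \<Rightarrow> real \<Rightarrow> ('a::complex_algebra_1, 'm) qgroup_scheme \<Rightarrow> 'a \<Rightarrow> bool" where
  "quantum_U n q H detinv \<longleftrightarrow>
     hopf_algebra H \<and> matrix_coalgebra n H \<and>
     presented_by (insert DetInv (mat_gens n))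
       (RTT_relators n q \<union> {qdet n q fmat * fdetinv - 1, fdetinv * qdet n q fmat - 1})
       (\<lambda>x. case x of Mat i j \<Rightarrow> mat H i j | DetInv \<Rightarrow> detinv)"

definition quantum_alpha ::
  "nat \<Rightarrow> ('a::complex_algebra_1, 'm) qgroup_scheme \<Rightarrow> ('b::complex_algebra_1, 'n) qgroup_scheme
     \<Rightarrow> 'b \<Rightarrow> ('a \<Rightarrow> 'b) \<Rightarrow> bool" where
  "quantum_alpha N G H detinv \<alpha> \<longleftrightarrow>
     hopf_algebra_hom G H \<alpha> \<and>
     \<alpha> (mat G 1 1) = detinv \<and>
     (\<forall>i\<in>{2..N}. \<alpha> (mat G 1 i) = 0 \<and> \<alpha> (mat G i 1) = 0) \<and>
     (\<forall>i\<in>{2..N}. \<forall>j\<in>{2..N}. \<alpha> (mat G i j) = mat H (i - 1) (j - 1))"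

(* q' is the chosen N-th root of q. *)
definition SU_coquasi_triangular ::
  "nat \<Rightarrow> real \<Rightarrow> complex \<Rightarrow> ('a::complex_algebra_1, 'm) qgroup_scheme
     \<Rightarrow> (('a, 'a) tensor \<Rightarrow> complex) \<Rightarrow> bool" where
  "SU_coquasi_triangular N q q' G r \<longleftrightarrow>
     coquasi_triangular G r \<and>
     (\<forall>i\<in>{1..N}. \<forall>j\<in>{1..N}. \<forall>k\<in>{1..N}. \<forall>l\<in>{1..N}.
        r (mat G i j \<otimes> mat G k l) = inverse q' * Rmat q k i j l)"

section \<open>The calculi\<close>

definition Qmat ::
  "('a::complex_algebra_1, 'm) qgroup_scheme \<Rightarrow> (('a, 'a) tensor \<Rightarrow> complex)
     \<Rightarrow> nat \<Rightarrow> nat \<Rightarrow> 'a \<Rightarrow> complex" where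
  "Qmat G r k l h = sweedler2 G (\<lambda>h1 h2. sweedler2 G (\<lambda>g1 g2.
     r (g1 \<otimes> h1) * r (h2 \<otimes> g2)) (mat G k l)) h"

definition kerQ ::
  "nat \<Rightarrow> ('a::complex_algebra_1, 'm) qgroup_scheme \<Rightarrow> (('a, 'a) tensor \<Rightarrow> complex) \<Rightarrow> 'a set" where
  "kerQ N G r = {h. \<forall>k\<in>{1..N}. \<forall>l\<in>{1..N}. Qmat G r k l h = 0}"

definition I_SU ::
  "nat \<Rightarrow> ('a::complex_algebra_1, 'm) qgroup_scheme \<Rightarrow> (('a, 'a) tensor \<Rightarrow> complex) \<Rightarrow> 'a set" where
  "I_SU N G r =
     {x + y + z | x y z. x \<in> kerQ N G r \<inter> aug G
        \<and> y \<in> cspan {mat G i 1 * antipode G (mat G 1 i) | i. i \<in> {2..N}}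
        \<and> z \<in> cspan {mat G i j | i j. i \<in> {2..N} \<and> j \<in> {2..N} \<and> i \<noteq> j}}"

(* cl exhibits the vector space 'b as the quotient V/W, with cl v the class of v in V.
   The values of cl outside V carry no information. *)
definition quotient_map ::
  "('a::complex_vector \<Rightarrow> 'b::complex_vector) \<Rightarrow> 'a set \<Rightarrow> 'a set \<Rightarrow> bool" where
  "quotient_map cl V W \<longleftrightarrow> clinear cl \<and> cl ` V = UNIV \<and> {v \<in> V. cl v = 0} = W"

(* In what follows cl is the quotient map from G^+ to Lambda^1, and the module of one-forms is
   the tensor product of G and Lambda^1. *)

definition bar ::
  "('a::complex_algebra_1, 'm) hopf_scheme \<Rightarrow> ('a \<Rightarrow> 'l::complex_vector) \<Rightarrow> 'a \<Rightarrow> 'l" where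
  "bar G cl h = cl (h - counit G h *\<^sub>C 1)"

definition e_zero ::
  "('a::complex_algebra_1, 'm) qgroup_scheme \<Rightarrow> ('a \<Rightarrow> 'l::complex_vector) \<Rightarrow> 'l" where
  "e_zero G cl = cl (mat G 1 1 - 1)"

definition e_plus ::
  "('a::complex_algebra_1, 'm) qgroup_scheme \<Rightarrow> ('a \<Rightarrow> 'l::complex_vector) \<Rightarrow> nat \<Rightarrow> 'l" where
  "e_plus G cl i = cl (mat G (i + 1) 1)"

definition e_minus ::
  "('a::complex_algebra_1, 'm) qgroup_scheme \<Rightarrow> ('a \<Rightarrow> 'l::complex_vector) \<Rightarrow> nat \<Rightarrow> 'l" where
  "e_minus G cl i = cl (mat G 1 (i + 1))"

definition left_mult :: "'a::complex_algebra_1 \<Rightarrow> ('a, 'l::complex_vector) tensor \<Rightarrow> ('a, 'l) tensor" where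
  "left_mult f = tmap (\<lambda>g. f * g) (\<lambda>x. x)"

definition right_mult ::
  "('a::complex_algebra_1, 'm) hopf_scheme \<Rightarrow> ('a \<Rightarrow> 'l::complex_vector)
     \<Rightarrow> ('a, 'l) tensor \<Rightarrow> 'a \<Rightarrow> ('a, 'l) tensor" where
  "right_mult G cl \<eta> h = (THE f. clinear f \<and>
     (\<forall>g. \<forall>v\<in>aug G. f (g \<otimes> cl v) = sweedler2 G (\<lambda>h1 h2. (g * h1) \<otimes> cl (v * h2)) h)) \<eta>"

definition dd ::
  "('a::complex_algebra_1, 'm) hopf_scheme \<Rightarrow> ('a \<Rightarrow> 'l::complex_vector) \<Rightarrow> 'a \<Rightarrow> ('a, 'l) tensor" where
  "dd G cl h = sweedler2 G (\<lambda>h1 h2. h1 \<otimes> bar G cl h2) h"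

definition coinvariants ::
  "('a::complex_algebra_1, 'm) hopf_scheme \<Rightarrow> ('a \<Rightarrow> 'b::complex_algebra_1) \<Rightarrow> 'a set" where
  "coinvariants G \<alpha> = {f. sweedler2 G (\<lambda>f1 f2. f1 \<otimes> \<alpha> f2) f = f \<otimes> 1}"

definition base_forms ::
  "('a::complex_algebra_1, 'm) hopf_scheme \<Rightarrow> ('a \<Rightarrow> 'l::complex_vector)
     \<Rightarrow> ('a \<Rightarrow> 'b::complex_algebra_1) \<Rightarrow> ('a, 'l) tensor set" where
  "base_forms G cl \<alpha> =
     cspan {left_mult f (dd G cl g) | f g. f \<in> coinvariants G \<alpha> \<and> g \<in> coinvariants G \<alpha>}"

(* P Omega^1(M) *)
definition left_horizontal ::
  "('a::complex_algebra_1, 'm) hopf_scheme \<Rightarrow> ('a \<Rightarrow> 'l::complex_vector)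
     \<Rightarrow> ('a \<Rightarrow> 'b::complex_algebra_1) \<Rightarrow> ('a, 'l) tensor set" where
  "left_horizontal G cl \<alpha> = cspan {left_mult p \<eta> | p \<eta>. \<eta> \<in> base_forms G cl \<alpha>}"

(* P Omega^1(M) P *)
definition horizontal ::
  "('a::complex_algebra_1, 'm) hopf_scheme \<Rightarrow> ('a \<Rightarrow> 'l::complex_vector)
     \<Rightarrow> ('a \<Rightarrow> 'b::complex_algebra_1) \<Rightarrow> ('a, 'l) tensor set" where
  "horizontal G cl \<alpha> =
     cspan {right_mult G cl (left_mult p \<eta>) p' | p \<eta> p'. \<eta> \<in> base_forms G cl \<alpha>}"

section \<open>Connections\<close>

(* The right H-coaction on one-forms, determined by covariance of the differential:
   f dg is sent to f_(1) dg_(1) \<otimes> \<alpha>(f_(2) g_(2)). *)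
definition form_coaction ::
  "('a::complex_algebra_1, 'm) hopf_scheme \<Rightarrow> ('a \<Rightarrow> 'l::complex_vector)
     \<Rightarrow> ('a \<Rightarrow> 'b::complex_algebra_1) \<Rightarrow> ('a, 'l) tensor \<Rightarrow> (('a, 'l) tensor, 'b) tensor" where
  "form_coaction G cl \<alpha> = (THE \<delta>. clinear \<delta> \<and>
     (\<forall>f g. \<delta> (left_mult f (dd G cl g)) =
        sweedler2 G (\<lambda>f1 f2. sweedler2 G (\<lambda>g1 g2.
          left_mult f1 (dd G cl g1) \<otimes> \<alpha> (f2 * g2)) g) f))"

definition is_connection ::
  "('a::complex_algebra_1, 'm) hopf_scheme \<Rightarrow> ('a \<Rightarrow> 'l::complex_vector)
     \<Rightarrow> ('a \<Rightarrow> 'b::complex_algebra_1) \<Rightarrow> (('a, 'l) tensor \<Rightarrow> ('a, 'l) tensor) \<Rightarrow> bool" where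
  "is_connection G cl \<alpha> \<Theta> \<longleftrightarrow>
     clinear \<Theta> \<and>
     (\<forall>p \<eta>. \<Theta> (left_mult p \<eta>) = left_mult p (\<Theta> \<eta>)) \<and>
     (\<forall>\<eta>. \<Theta> (\<Theta> \<eta>) = \<Theta> \<eta>) \<and>
     {\<eta>. \<Theta> \<eta> = 0} = horizontal G cl \<alpha> \<and>
     (\<forall>\<eta>. form_coaction G cl \<alpha> (\<Theta> \<eta>) = tmap \<Theta> (\<lambda>h. h) (form_coaction G cl \<alpha> \<eta>))"

definition is_strong ::
  "('a::complex_algebra_1, 'm) hopf_scheme \<Rightarrow> ('a \<Rightarrow> 'l::complex_vector)
     \<Rightarrow> ('a \<Rightarrow> 'b::complex_algebra_1) \<Rightarrow> (('a, 'l) tensor \<Rightarrow> ('a, 'l) tensor) \<Rightarrow> bool" where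
  "is_strong G cl \<alpha> \<Theta> \<longleftrightarrow> (\<forall>\<eta>. \<eta> - \<Theta> \<eta> \<in> left_horizontal G cl \<alpha>)"

definition ver ::
  "('a::complex_algebra_1, 'm) hopf_scheme \<Rightarrow> ('a \<Rightarrow> 'l::complex_vector)
     \<Rightarrow> ('b \<Rightarrow> 'k::complex_vector) \<Rightarrow> ('a \<Rightarrow> 'b::complex_algebra_1)
     \<Rightarrow> ('a, 'l) tensor \<Rightarrow> ('a, 'k) tensor" where
  "ver G clG clH \<alpha> = (THE f. clinear f \<and>
     (\<forall>g. \<forall>v\<in>aug G. f (g \<otimes> clG v) = g \<otimes> clH (\<alpha> v)))"

definition Pi_omega ::
  "('a::complex_algebra_1, 'm) hopf_scheme \<Rightarrow> ('a \<Rightarrow> 'l::complex_vector)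
     \<Rightarrow> ('b \<Rightarrow> 'k::complex_vector) \<Rightarrow> ('a \<Rightarrow> 'b::complex_algebra_1) \<Rightarrow> ('k \<Rightarrow> 'l)
     \<Rightarrow> ('a, 'l) tensor \<Rightarrow> ('a, 'l) tensor" where
  "Pi_omega G clG clH \<alpha> i \<eta> =
     (let \<omega> = (\<lambda>x. 1 \<otimes> i x) in tlift (\<lambda>g x. left_mult g (\<omega> x)) (ver G clG clH \<alpha> \<eta>))"

(* The coaction on G^+/I induced by v |-> v_(2) \<otimes> \<beta>(S(v_(1)) v_(3)).  For v in G^+ the sum of
   counit(v_(2)) \<beta>(S(v_(1)) v_(3)) vanishes, so replacing v_(2) by v_(2) - counit(v_(2)) 1 does not
   change the element of G \<otimes> H and makes the class of each v_(2) meaningful. *)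
definition ad_coaction ::
  "('a::complex_algebra_1, 'm) hopf_scheme \<Rightarrow> ('a \<Rightarrow> 'l::complex_vector)
     \<Rightarrow> ('a \<Rightarrow> 'b::complex_algebra_1) \<Rightarrow> 'l \<Rightarrow> ('l, 'b) tensor" where
  "ad_coaction G cl \<beta> = (THE \<delta>. clinear \<delta> \<and>
     (\<forall>v\<in>aug G. \<delta> (cl v) =
        sweedler3 G (\<lambda>v1 v2 v3. bar G cl v2 \<otimes> \<beta> (antipode G v1 * v3)) v))"

(* Splitting: i is a linear section of the map Lambda^1_G -> Lambda^1_H induced by \<alpha>.
   Bicovariant: i intertwines the adjoint H-coactions. *)
definition bicovariant_splitting_map ::
  "('a::complex_algebra_1, 'm) hopf_scheme \<Rightarrow> ('b::complex_algebra_1, 'n) hopf_scheme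
     \<Rightarrow> ('a \<Rightarrow> 'l::complex_vector) \<Rightarrow> ('b \<Rightarrow> 'k::complex_vector) \<Rightarrow> ('a \<Rightarrow> 'b) \<Rightarrow> ('k \<Rightarrow> 'l) \<Rightarrow> bool" where
  "bicovariant_splitting_map G H clG clH \<alpha> i \<longleftrightarrow>
     clinear i \<and>
     (\<forall>x. \<forall>v\<in>aug G. clG v = i x \<longrightarrow> clH (\<alpha> v) = x) \<and>
     (\<forall>x. ad_coaction G clG \<alpha> (i x) = tmap i (\<lambda>h. h) (ad_coaction H clH (\<lambda>h. h) x))"

end

theory Submission
  imports Defs
begin

text \<open>
  Write \<open>Q(h) = B(h\<^sub>1) A(h\<^sub>2)\<close> with the matrices \<open>B(h) = r(u \<otimes> h)\<close> and \<open>A(h) = r(h \<otimes> u)\<close>. The first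
  is lower and the second upper triangular, so \<open>Q\<^sub>1\<^sub>1\<close> is a character, and the relation
  \<open>Q(f g) = B(g\<^sub>1) Q(f) A(g\<^sub>2)\<close> shows that the ideal \<open>I\<close> consists of the \<open>v\<close> in \<open>G\<^sup>+\<close> for which the first
  row and the first column of \<open>Q(v)\<close> vanish. Hence these entries are coordinates on
  \<open>\<Lambda>\<^sup>1\<close>, dual to \<open>e\<^sup>0\<close>, \<open>e\<^sup>+\<close>, \<open>e\<^sup>-\<close> up to scalars. The character \<open>Q\<^sub>1\<^sub>1\<close> factors through \<open>\<alpha>\<close>, so the
  coordinate of \<open>e\<^sup>0\<close> descends to the fibre and the projection onto \<open>e\<^sup>0\<close> is \<open>\<Pi>\<^sub>\<omega>\<close>; it is covariant because
  \<open>Q\<close> intertwines the adjoint coaction with conjugation by \<open>u\<close>, which \<open>\<alpha>\<close> makes block diagonal.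
  Strongness holds since \<open>e\<^sup>+\<close> and \<open>e\<^sup>-\<close> are left combinations of the differentials of
  \<open>u\<^sup>i\<^sub>1 S(u\<^sup>1\<^sub>j)\<close>, which are coinvariant.
\<close>

section \<open>Linear maps and tensor products\<close>

text \<open>The parameter range contains q = 1, where Q has scalar values and the forms e^+ and e^-
  vanish; if moreover q'^2 = 1, then e^0 vanishes too. To keep one argument for all cases, the
  coordinates are normalised with \<open>inverse\<close>, whose value at 0 is 0, and c / c = 1 is
  replaced by fixed-point identities such as \<open>e0_fix\<close>. The operations of the calculus
  (\<open>ver\<close>, \<open>right_mult\<close>, \<open>ad_coaction\<close>,
  \<open>form_coaction\<close>) are definite descriptions, so each has to be matched with an
  explicit map. The description of I by Q makes the map descend to the quotient, and surjectivity of
  the class map gives uniqueness. The root q' enters through the determinant: Q_11 takes the value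
  q'^(-2) on each diagonal generator of the fibre and q^2 q'^(-2) on \<open>detinv\<close>, and
  these are compatible exactly because q'^N = q.\<close>

named_theorems clinear_intros

lemma clinear_id [clinear_intros]: "clinear (\<lambda>x. x)"
  by (rule clinearI) simp_all

lemma clinear_zero [clinear_intros]: "clinear (\<lambda>x. 0)"
  by (rule clinearI) simp_all

lemma clinear_plus [clinear_intros]: "clinear f \<Longrightarrow> clinear g \<Longrightarrow> clinear (\<lambda>x. f x + g x)"
  by (rule clinearI) (simp_all add: clinear_add clinear_scale scaleC_add_right)

lemma clinear_minus [clinear_intros]: "clinear f \<Longrightarrow> clinear g \<Longrightarrow> clinear (\<lambda>x. f x - g x)"
  by (rule clinearI)
    (simp_all add: clinear_add clinear_scale complex_vector.scale_right_diff_distrib)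

lemma clinear_scaleC [clinear_intros]: "clinear f \<Longrightarrow> clinear (\<lambda>x. c *\<^sub>C f x)"
  by (rule clinearI) (simp_all add: clinear_add clinear_scale scaleC_add_right scaleC_scaleC mult.commute)

lemma clinear_scaleC_left [clinear_intros]: "clinear f \<Longrightarrow> clinear (\<lambda>x. f x *\<^sub>C v)"
  by (rule clinearI) (simp_all add: clinear_add clinear_scale scaleC_add_left scaleC_scaleC scaleC_complex_def)

lemma clinear_mult_left [clinear_intros]: "clinear f \<Longrightarrow> clinear (\<lambda>x. f x * b)"
  for f :: "_ \<Rightarrow> 'a::complex_algebra_1"
  by (rule clinearI) (simp_all add: clinear_add clinear_scale distrib_right mult_scaleC_left)

lemma clinear_mult_right [clinear_intros]: "clinear f \<Longrightarrow> clinear (\<lambda>x. a * f x)"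
  for f :: "_ \<Rightarrow> 'a::complex_algebra_1"
  by (rule clinearI) (simp_all add: clinear_add clinear_scale distrib_left mult_scaleC_right)

lemma clinear_tensor_left [clinear_intros]: "clinear f \<Longrightarrow> clinear (\<lambda>x. f x \<otimes> b)"
  by (rule clinearI) (simp_all add: clinear_add clinear_scale tensor_add_left tensor_scale_left)

lemma clinear_tensor_right [clinear_intros]: "clinear f \<Longrightarrow> clinear (\<lambda>x. a \<otimes> f x)"
  by (rule clinearI) (simp_all add: clinear_add clinear_scale tensor_add_right tensor_scale_right)

lemma clinear_sum [clinear_intros]:
  assumes "\<And>i. i \<in> I \<Longrightarrow> clinear (f i)"
  shows "clinear (\<lambda>x. \<Sum>i\<in>I. f i x)"
  using assms by (induction I rule: infinite_finite_induct) (auto intro!: clinear_intros)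

lemma clinear_compose: "clinear f \<Longrightarrow> clinear g \<Longrightarrow> clinear (\<lambda>x. f (g x))"
  by (rule clinearI) (simp_all add: clinear_add clinear_scale)

lemma clinear_0: "clinear f \<Longrightarrow> f 0 = 0"
  using clinear_diff[of f 0 0] by simp

lemma clinear_map_sum:
  assumes "clinear f"
  shows "f (\<Sum>i\<in>I. x i) = (\<Sum>i\<in>I. f (x i))"
  by (induction I rule: infinite_finite_induct) (simp_all add: clinear_0 clinear_add assms)

lemma clinearD:
  assumes "clinear f"
  shows "f 0 = 0" "f (x + y) = f x + f y" "f (x - y) = f x - f y" "f (c *\<^sub>C x) = c *\<^sub>C f x"
  using assms by (simp_all add: clinear_0 clinear_add clinear_diff clinear_scale)

lemma cbilinearI:
  "(\<And>y. clinear (\<lambda>x. B x y)) \<Longrightarrow> (\<And>x. clinear (\<lambda>y. B x y)) \<Longrightarrow> cbilinear B"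
  by (simp add: cbilinear_def)

lemma cbilinearD:
  assumes "cbilinear B"
  shows "clinear (\<lambda>x. B x y)" "clinear (\<lambda>y. B x y)"
  using assms by (simp_all add: cbilinear_def)

lemma clinear_tlift_arg: "cbilinear B \<Longrightarrow> clinear g \<Longrightarrow> clinear (\<lambda>x. tlift B (g x))"
  by (rule clinear_compose[OF clinear_tlift])

text \<open>\<open>tlift\<close> is a definite description, so its dependence on the bilinear map is
  visible only on elementary tensors. Needed for nested Sweedler sums, where the inner map depends
  on the outer legs.\<close>

lemma clinear_tlift_fun:
  assumes "\<And>x. cbilinear (B x)" "\<And>a b. clinear (\<lambda>x. B x a b)"
  shows "clinear (\<lambda>x. tlift (B x) t)"
proof (rule clinearI)
  show "tlift (B (x + y)) t = tlift (B x) t + tlift (B y) t" for x y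
  proof (induction t rule: tensor_induct)
    case (elem a b)
    show ?case unfolding tlift_elem[OF assms(1)] by (rule clinear_add[OF assms(2)])
  qed (simp only: clinear_add[OF clinear_tlift[OF assms(1)]] ac_simps)
  show "tlift (B (c *\<^sub>C x)) t = c *\<^sub>C tlift (B x) t" for c x
  proof (induction t rule: tensor_induct)
    case (elem a b)
    show ?case unfolding tlift_elem[OF assms(1)] by (rule clinear_scale[OF assms(2)])
  qed (simp only: clinear_add[OF clinear_tlift[OF assms(1)]] scaleC_add_right)
qed

lemma tmap_cbilinear: "clinear f \<Longrightarrow> clinear g \<Longrightarrow> cbilinear (\<lambda>x y. f x \<otimes> g y)"
  by (intro cbilinearI clinear_intros)

lemma clinear_tmap: "clinear f \<Longrightarrow> clinear g \<Longrightarrow> clinear (tmap f g)"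
  and tmap_elem: "clinear f \<Longrightarrow> clinear g \<Longrightarrow> tmap f g (x \<otimes> y) = f x \<otimes> g y"
  unfolding tmap_def by (simp_all add: tmap_cbilinear clinear_tlift tlift_elem)

lemma tensor_zero [simp]: "0 \<otimes> y = 0" "x \<otimes> 0 = 0"
  using clinear_0[OF clinear_tensor_left[OF clinear_id]] clinear_0[OF clinear_tensor_right[OF clinear_id]]
  by blast+

lemma tensor_sum_left: "(\<Sum>i\<in>I. x i) \<otimes> y = (\<Sum>i\<in>I. x i \<otimes> y)"
  by (rule clinear_map_sum) (intro clinear_intros)

lemma tensor_sum_right: "x \<otimes> (\<Sum>i\<in>I. y i) = (\<Sum>i\<in>I. x \<otimes> y i)"
  by (rule clinear_map_sum) (intro clinear_intros)

lemma tlift_compose: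
  assumes "clinear f" "cbilinear B"
  shows "f (tlift B t) = tlift (\<lambda>x y. f (B x y)) t"
proof -
  have *: "cbilinear (\<lambda>x y. f (B x y))"
    by (intro cbilinearI clinear_compose[OF assms(1)] cbilinearD[OF assms(2)])
  have "(\<lambda>t. f (tlift B t)) = tlift (\<lambda>x y. f (B x y))"
    by (intro tensor_map_eqI clinear_compose[OF assms(1)] clinear_tlift assms(2) *)
      (simp add: tlift_elem assms(2) *)
  then show ?thesis by metis
qed

text \<open>Two such functionals multiply to a functional with value 1 on the unit tensor, which is
  how the tensor product of two algebras is seen to be nonzero.\<close>

lemma exists_functional_one: "\<exists>f :: 'a::complex_algebra_1 \<Rightarrow> complex. clinear f \<and> f 1 = 1"
proof -
  interpret vp: vector_space_pair "scaleC :: complex \<Rightarrow> 'a \<Rightarrow> 'a" "scaleC :: complex \<Rightarrow> complex \<Rightarrow> complex"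
    by unfold_locales
  have "complex_vector.independent {1 :: 'a}" by simp
  from vp.linear_independent_extend[OF this, of "\<lambda>_. 1"] show ?thesis by simp
qed

text \<open>With this product the multiplicativity axiom of \<open>hopf_algebra\<close> says that
  the comultiplication is a ring homomorphism. The definition repeats the nesting of that axiom, so
  that unfolding suffices.\<close>

instantiation tensor :: (complex_algebra_1, complex_algebra_1) complex_algebra_1
begin

definition one_tensor :: "('a, 'b) tensor" where "one_tensor = 1 \<otimes> 1"

definition times_tensor :: "('a, 'b) tensor \<Rightarrow> ('a, 'b) tensor \<Rightarrow> ('a, 'b) tensor" where
  "times_tensor s t = tlift (\<lambda>a b. tlift (\<lambda>c d. (a * c) \<otimes> (b * d)) t) s"

lemma times_tensor_cbilinear: "cbilinear ((*) :: ('a, 'b) tensor \<Rightarrow> ('a, 'b) tensor \<Rightarrow> ('a, 'b) tensor)"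
  unfolding times_tensor_def [abs_def]
  by (intro cbilinearI clinear_tlift_arg clinear_tlift_fun clinear_intros)

lemma times_tensor_elem: "(a \<otimes> b) * (c \<otimes> d) = (a * c) \<otimes> (b * d)" for a c :: 'a and b d :: 'b
  unfolding times_tensor_def
  by (subst tlift_elem, (intro cbilinearI clinear_tlift_arg clinear_tlift_fun clinear_intros)[1],
      rule tlift_elem, intro cbilinearI clinear_intros)

instance
proof
  fix r s t :: "('a, 'b) tensor" and c :: complex
  note lin = cbilinearD[OF times_tensor_cbilinear]
  note dist = clinear_add[OF lin(1)] clinear_add[OF lin(2)]
  show "(r + s) * t = r * t + s * t" "r * (s + t) = r * s + r * t" by (rule dist)+
  show "(c *\<^sub>C s) * t = c *\<^sub>C (s * t)" by (rule clinear_scale[OF lin(1)])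
  show "s * (c *\<^sub>C t) = c *\<^sub>C (s * t)" by (rule clinear_scale[OF lin(2)])
  have 1: "(a \<otimes> b) * (a' \<otimes> b') * t = (a \<otimes> b) * ((a' \<otimes> b') * t)" for a a' :: 'a and b b' :: 'b
    by (induction t rule: tensor_induct) (simp_all add: dist times_tensor_elem mult.assoc)
  have 2: "(a \<otimes> b) * s * t = (a \<otimes> b) * (s * t)" for a :: 'a and b :: 'b
    by (induction s rule: tensor_induct) (simp_all add: dist 1)
  show "r * s * t = r * (s * t)"
    by (induction r rule: tensor_induct) (simp_all add: dist 2)
  show "1 * s = s" "s * 1 = s"
    by (induction s rule: tensor_induct) (simp_all add: dist one_tensor_def times_tensor_elem)
  obtain f :: "'a \<Rightarrow> complex" and g :: "'b \<Rightarrow> complex"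
    where fg: "clinear f" "f 1 = 1" "clinear g" "g 1 = 1"
    using exists_functional_one by metis
  have *: "cbilinear (\<lambda>x y. f x * g y)" using fg by (intro cbilinearI clinear_intros)
  have "tlift (\<lambda>x y. f x * g y) (1 \<otimes> 1) = 1" using fg by (simp add: tlift_elem[OF *])
  then show "(0 :: ('a, 'b) tensor) \<noteq> 1"
    using clinear_0[OF clinear_tlift[OF *]] by (auto simp: one_tensor_def)
qed

end

text \<open>X = X (Z Y) = (X Z) Y = Y, valid over a noncommutative ring. It will identify the
  coproduct of the matrix S(u).\<close>

lemma matrix_inverse_unique:
  fixes X Y Z :: "'i \<Rightarrow> 'i \<Rightarrow> 'a::ring_1"
  assumes "finite I"
    and XZ: "\<And>i j. i \<in> I \<Longrightarrow> j \<in> I \<Longrightarrow> (\<Sum>k\<in>I. X i k * Z k j) = (if i = j then 1 else 0)"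
    and ZY: "\<And>i j. i \<in> I \<Longrightarrow> j \<in> I \<Longrightarrow> (\<Sum>k\<in>I. Z i k * Y k j) = (if i = j then 1 else 0)"
    and "i \<in> I" "j \<in> I"
  shows "X i j = Y i j"
proof -
  have "X i j = (\<Sum>k\<in>I. X i k * (if k = j then 1 else 0))"
    using assms by (simp add: sum.delta if_distrib[of "(*) _"] cong: if_cong)
  also have "\<dots> = (\<Sum>k\<in>I. X i k * (\<Sum>l\<in>I. Z k l * Y l j))"
    using assms by (intro sum.cong refl) (simp add: ZY)
  also have "\<dots> = (\<Sum>l\<in>I. (\<Sum>k\<in>I. X i k * Z k l) * Y l j)"
    by (simp only: sum_distrib_left sum_distrib_right mult.assoc) (rule sum.swap)
  also have "\<dots> = (\<Sum>l\<in>I. (if i = l then 1 else 0) * Y l j)"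
    using assms by (intro sum.cong refl) (simp add: XZ)
  also have "\<dots> = Y i j"
    using assms by (simp add: sum.delta if_distrib[of "\<lambda>x. x * _"] cong: if_cong)
  finally show ?thesis .
qed

text \<open>Universal property of V/W for a class map whose values matter only on V. Two preimages
  in V of the same point differ by an element of W, so any choice of preimage serves.\<close>

lemma quotient_map_factor:
  fixes cl :: "'a::complex_vector \<Rightarrow> 'b::complex_vector" and f :: "'a \<Rightarrow> 'c::complex_vector"
  assumes cl: "quotient_map cl V W" and f: "clinear f" "\<And>v. v \<in> W \<Longrightarrow> f v = 0"
    and V: "complex_vector.subspace V"
  shows "\<exists>g. clinear g \<and> (\<forall>v\<in>V. g (cl v) = f v)"
proof -
  define g where "g x = f (SOME v. v \<in> V \<and> cl v = x)" for x
  have g: "g (cl v) = f v" if "v \<in> V" for v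
  proof -
    define v' where "v' = (SOME v'. v' \<in> V \<and> cl v' = cl v)"
    have "v' \<in> V \<and> cl v' = cl v" unfolding v'_def by (rule someI[of _ v]) (simp add: that)
    then have "v' - v \<in> W"
      using cl that V by (auto simp: quotient_map_def clinear_diff complex_vector.subspace_diff)
    then show ?thesis using f(2)[of "v' - v"] by (simp add: g_def v'_def clinear_diff[OF f(1)])
  qed
  have surj: "\<exists>v\<in>V. x = cl v" for x
    using cl unfolding quotient_map_def by (metis UNIV_I imageE)
  have "clinear g"
  proof (rule clinearI)
    fix x y and c :: complex
    obtain v w where vw: "v \<in> V" "w \<in> V" "x = cl v" "y = cl w" using surj by metis
    have "x + y = cl (v + w)" "c *\<^sub>C x = cl (c *\<^sub>C v)"
      using cl by (simp_all add: vw quotient_map_def clinear_add clinear_scale)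
    then show "g (x + y) = g x + g y" "g (c *\<^sub>C x) = c *\<^sub>C g x"
      using V vw by (simp_all add: g f(1) clinear_add clinear_scale
          complex_vector.subspace_add complex_vector.subspace_scale)
  qed
  with g show ?thesis by blast
qed

text \<open>Keeps the matrix index 1 from being rewritten to \<open>Suc 0\<close>, so that facts
  about \<open>u 1 1\<close> continue to match.\<close>

declare One_nat_def [simp del]

section \<open>Presented algebras\<close>

lemma free_eval_superset:
  assumes "finite S" "Poly_Mapping.keys p \<subseteq> S"
  shows "free_eval \<phi> p = (\<Sum>w\<in>S. Poly_Mapping.lookup p w *\<^sub>C prod_list (map \<phi> w))"
  unfolding free_eval_def using assms by (intro sum.mono_neutral_left) (auto simp: in_keys_iff)

lemma clinear_free_eval: "clinear (free_eval \<phi>)"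
proof (rule clinearI)
  fix p r :: "'a free_algebra" and c
  let ?S = "Poly_Mapping.keys p \<union> Poly_Mapping.keys r"
  have "Poly_Mapping.keys (p + r) \<subseteq> ?S" by (rule Poly_Mapping.keys_add)
  then show "free_eval \<phi> (p + r) = free_eval \<phi> p + free_eval \<phi> r"
    by (simp add: free_eval_superset[of ?S] lookup_add scaleC_add_left sum.distrib)
  have "Poly_Mapping.keys (c *\<^sub>C p) \<subseteq> Poly_Mapping.keys p"
    by (auto simp: in_keys_iff)
  then show "free_eval \<phi> (c *\<^sub>C p) = c *\<^sub>C free_eval \<phi> p"
    by (simp add: free_eval_superset[of "Poly_Mapping.keys p"] scaleC_complex_def scaleC_scaleC
        complex_vector.scale_sum_right)
qed

lemma free_eval_single: "free_eval \<phi> (Poly_Mapping.single w c) = c *\<^sub>C prod_list (map \<phi> w)"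
  by (cases "c = 0") (simp_all add: free_eval_def)

lemma free_eval_mult: "free_eval \<phi> (p * r) = free_eval \<phi> p * free_eval \<phi> r"
proof -
  note add = clinear_add[OF clinear_free_eval]
  have *: "free_eval \<phi> (Poly_Mapping.single w c * r) = free_eval \<phi> (Poly_Mapping.single w c) * free_eval \<phi> r"
    for w c
    by (rule poly_mapping_eq_of_singles[where p = r
          and f = "\<lambda>r. free_eval \<phi> (Poly_Mapping.single w c * r)"
          and g = "\<lambda>r. free_eval \<phi> (Poly_Mapping.single w c) * free_eval \<phi> r"])
      (simp_all add: distrib_left add mult_single free_eval_single plus_list_def
        mult_scaleC_left mult_scaleC_right scaleC_scaleC mult.commute)
  show ?thesis
    by (rule poly_mapping_eq_of_singles[where p = p and f = "\<lambda>p. free_eval \<phi> (p * r)"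
          and g = "\<lambda>p. free_eval \<phi> p * free_eval \<phi> r"]) (simp_all add: distrib_right add *)
qed

lemma free_eval_one: "free_eval \<phi> 1 = 1"
proof -
  have "free_eval \<phi> (Poly_Mapping.single 0 1) = 1"
    by (simp only: free_eval_single zero_list_def) (simp add: scaleC_one)
  then show ?thesis by simp
qed

lemma free_eval_gen: "free_eval \<phi> (free_gen x) = \<phi> x"
  by (simp add: free_gen_def free_eval_single scaleC_one)

lemma free_eval_hom: "calgebra_hom (free_eval \<phi>)"
  by (simp add: calgebra_hom_def clinear_free_eval free_eval_mult free_eval_one)

lemma free_gen_in: "x \<in> X \<Longrightarrow> free_gen x \<in> free_algebra_on X"
  by (simp add: free_algebra_on_def free_gen_def)

lemma free_algebra_on_mult:
  assumes "p \<in> free_algebra_on X" "r \<in> free_algebra_on X"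
  shows "p * r \<in> free_algebra_on X"
proof -
  have "Poly_Mapping.keys p \<subseteq> lists X" "Poly_Mapping.keys r \<subseteq> lists X"
    using assms by (auto simp: free_algebra_on_def)
  then have "{a + b | a b. a \<in> Poly_Mapping.keys p \<and> b \<in> Poly_Mapping.keys r} \<subseteq> lists X"
    unfolding plus_list_def by (auto dest!: subsetD)
  then show ?thesis using keys_mult[of p r] by (simp add: free_algebra_on_def)
qed

lemma free_algebra_on_one: "1 \<in> free_algebra_on X"
  by (simp add: free_algebra_on_def zero_list_def)

lemma free_algebra_on_subspace: "complex_vector.subspace (free_algebra_on X)"
  unfolding complex_vector.subspace_def
proof (intro conjI ballI allI)
  fix p r :: "'a free_algebra" and c
  assume p: "p \<in> free_algebra_on X"
  show "p + r \<in> free_algebra_on X" if "r \<in> free_algebra_on X"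
    using p that Poly_Mapping.keys_add[of p r] by (auto simp: free_algebra_on_def)
  have "Poly_Mapping.keys (c *\<^sub>C p) \<subseteq> Poly_Mapping.keys p" by (auto simp: in_keys_iff)
  then show "c *\<^sub>C p \<in> free_algebra_on X" using p by (auto simp: free_algebra_on_def)
qed (simp add: free_algebra_on_def)

lemma presented_by_surj:
  assumes "presented_by X Rel \<phi>"
  obtains p where "p \<in> free_algebra_on X" "h = free_eval \<phi> p"
proof -
  have "h \<in> free_eval \<phi> ` free_algebra_on X" using assms by (simp add: presented_by_def)
  then show ?thesis using that by blast
qed

text \<open>Universal property of a presentation: evaluation at \<psi> kills the ideal because it
  kills the relators, and the induced map is multiplicative because the free algebra on
  \<open>X\<close> is closed under products.\<close>

lemma presented_by_hom_exists:
  fixes \<phi> :: "'x \<Rightarrow> 'a::complex_algebra_1" and \<psi> :: "'x \<Rightarrow> 'b::complex_algebra_1"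
  assumes pres: "presented_by X Rel \<phi>" and rel: "\<And>p. p \<in> Rel \<Longrightarrow> free_eval \<psi> p = 0"
  shows "\<exists>f. calgebra_hom f \<and> (\<forall>x\<in>X. f (\<phi> x) = \<psi> x)"
proof -
  have qm: "quotient_map (free_eval \<phi>) (free_algebra_on X) (free_ideal X Rel)"
    using pres by (simp add: presented_by_def quotient_map_def clinear_free_eval)
  have zero: "free_eval \<psi> p = 0" if "p \<in> free_ideal X Rel" for p
    using that unfolding free_ideal_def
  proof (induction rule: complex_vector.span_induct_alt)
    case (step c x y)
    then obtain a s b where x: "x = a * s * b" "s \<in> Rel" by blast
    have "free_eval \<psi> x = 0" by (simp only: x(1) free_eval_mult rel[OF x(2)]) simp
    then show ?case using step by (simp add: clinearD[OF clinear_free_eval])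
  qed (simp add: clinearD[OF clinear_free_eval])
  obtain f where f: "clinear f"
      "\<And>p. p \<in> free_algebra_on X \<Longrightarrow> f (free_eval \<phi> p) = free_eval \<psi> p"
    using quotient_map_factor[OF qm clinear_free_eval zero free_algebra_on_subspace] by blast
  have "f (x * y) = f x * f y" for x y
  proof -
    obtain p r where pr: "p \<in> free_algebra_on X" "x = free_eval \<phi> p" "r \<in> free_algebra_on X" "y = free_eval \<phi> r"
      using presented_by_surj[OF pres] by metis
    then show ?thesis
      using f(2)[of "p * r"] by (simp add: f(2) free_algebra_on_mult free_eval_mult)
  qed
  moreover have "f 1 = 1"
    using f(2)[OF free_algebra_on_one] by (simp add: free_eval_one)
  moreover have "f (\<phi> x) = \<psi> x" if "x \<in> X" for x
    using f(2)[OF free_gen_in[OF that]] by (simp add: free_eval_gen)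
  ultimately show ?thesis using f(1) by (auto simp: calgebra_hom_def)
qed

lemma presented_by_span:
  assumes "presented_by X Rel \<phi>"
  shows "h \<in> cspan {prod_list (map \<phi> w) | w. w \<in> lists X}"
proof -
  obtain p where p: "p \<in> free_algebra_on X" "h = free_eval \<phi> p"
    using presented_by_surj[OF assms] .
  show ?thesis
    unfolding p(2) free_eval_def using p(1)
    by (intro complex_vector.span_sum complex_vector.span_scale complex_vector.span_base)
      (auto simp: free_algebra_on_def)
qed

lemma calgebra_homD:
  assumes "calgebra_hom f"
  shows "clinear f" "f 1 = 1" "f (x * y) = f x * f y"
  using assms by (auto simp: calgebra_hom_def)

lemma calgebra_hom_prod_list: "calgebra_hom f \<Longrightarrow> f (prod_list xs) = prod_list (map f xs)"
  by (induction xs) (simp_all add: calgebra_hom_def)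

lemma presented_by_hom_eqI:
  assumes "presented_by X Rel \<phi>" "calgebra_hom f" "calgebra_hom g"
    and gens: "\<And>x. x \<in> X \<Longrightarrow> f (\<phi> x) = g (\<phi> x)"
  shows "f h = g h"
  using presented_by_span[OF assms(1), of h]
proof (induction rule: complex_vector.span_induct_alt)
  case (step c x y)
  then obtain w where w: "x = prod_list (map \<phi> w)" "w \<in> lists X" by blast
  then have "map f (map \<phi> w) = map g (map \<phi> w)" using gens by auto
  then have "f x = g x"
    by (simp only: w calgebra_hom_prod_list[OF assms(2)] calgebra_hom_prod_list[OF assms(3)])
  then show ?case using step assms
    by (simp add: clinearD[OF calgebra_homD(1)[OF assms(2)]] clinearD[OF calgebra_homD(1)[OF assms(3)]])
qed (simp add: clinearD[OF calgebra_homD(1)[OF assms(2)]] clinearD[OF calgebra_homD(1)[OF assms(3)]])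

section \<open>Hopf algebras generated by a matrix coalgebra\<close>

definition multi_indices :: "nat \<Rightarrow> nat \<Rightarrow> nat list set" where
  "multi_indices n m = {I. set I \<subseteq> {1..n} \<and> length I = m}"

lemma finite_multi_indices [simp]: "finite (multi_indices n m)"
  unfolding multi_indices_def by (rule finite_lists_length_eq) simp

lemma multi_indices_0 [simp]: "multi_indices n 0 = {[]}"
  by (auto simp: multi_indices_def)

lemma sum_multi_indices_Suc:
  "(\<Sum>K\<in>multi_indices n (Suc m). f K) = (\<Sum>k\<in>{1..n}. \<Sum>K\<in>multi_indices n m. f (k # K))"
proof -
  have "(\<Sum>K\<in>multi_indices n (Suc m). f K)
      = (\<Sum>(k, K)\<in>{1..n} \<times> multi_indices n m. f (k # K))"
    by (intro sum.reindex_bij_witness[of _ "\<lambda>(k, K). k # K" "\<lambda>L. (hd L, tl L)"])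
      (auto simp: multi_indices_def length_Suc_conv)
  then show ?thesis by (simp add: sum.cartesian_product)
qed

text \<open>Words in the generators are matrix coefficients of tensor powers of the fundamental corepresentation.
  They span, so an identity in Sweedler notation that is linear in \<open>h\<close> need only be checked on words, where it
  becomes an identity between finite sums over multi-indices.\<close>

abbreviation mword :: "(nat \<Rightarrow> nat \<Rightarrow> 'a::monoid_mult) \<Rightarrow> nat list \<Rightarrow> nat list \<Rightarrow> 'a" where
  "mword u I J \<equiv> prod_list (map2 u I J)"

text \<open>Only G is treated in this way. Words in the matrix entries of H leave out
  \<open>detinv\<close>, so statements about H are pulled back along \<alpha> instead.\<close>

locale matrix_hopf =
  fixes n :: nat and G :: "('a::complex_algebra_1, 'm) qgroup_scheme"
  assumes hopf: "hopf_algebra G" and coalg: "matrix_coalgebra n G"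
    and span_words: "h \<in> cspan {mword (mat G) I J | I J m. I \<in> multi_indices n m \<and> J \<in> multi_indices n m}"
begin

abbreviation u where "u \<equiv> mat G"
abbreviation w where "w \<equiv> mword u"
abbreviation S where "S \<equiv> antipode G"
abbreviation idx where "idx \<equiv> multi_indices n"

lemma clinear_comult: "clinear (comult G)"
  and clinear_counit: "clinear (counit G)"
  and clinear_antipode: "clinear S"
  and counit_hom: "calgebra_hom (counit G)"
  and comult_one: "comult G 1 = 1"
  and comult_mult: "comult G (g * h) = comult G g * comult G h"
  using hopf by (auto simp: hopf_algebra_def calgebra_hom_def one_tensor_def times_tensor_def
      sweedler2_def)

lemma clinear_counit' [clinear_intros]: "clinear f \<Longrightarrow> clinear (\<lambda>x. counit G (f x))"
  and clinear_antipode' [clinear_intros]: "clinear f \<Longrightarrow> clinear (\<lambda>x. S (f x))"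
  by (auto intro: clinear_compose clinear_counit clinear_antipode)

lemma counit_simps: "counit G 1 = 1" "counit G (g * h) = counit G g * counit G h"
  using counit_hom by (auto simp: calgebra_hom_def)

lemma comult_u: "i \<in> {1..n} \<Longrightarrow> j \<in> {1..n} \<Longrightarrow> comult G (u i j) = (\<Sum>k\<in>{1..n}. u i k \<otimes> u k j)"
  and counit_u: "i \<in> {1..n} \<Longrightarrow> j \<in> {1..n} \<Longrightarrow> counit G (u i j) = (if i = j then 1 else 0)"
  using coalg by (auto simp: matrix_coalgebra_def kron_def)

lemma clinear_sweedler2 [clinear_intros]:
  assumes "\<And>y. clinear (\<lambda>x. F x y)" "\<And>x. clinear (\<lambda>y. F x y)" "clinear g"
  shows "clinear (\<lambda>x. sweedler2 G F (g x))"
  unfolding sweedler2_def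
  by (intro clinear_tlift_arg cbilinearI clinear_compose[OF clinear_comult] assms)

lemma clinear_sweedler2_fun [clinear_intros]:
  assumes "\<And>x b. clinear (\<lambda>a. F x a b)" "\<And>x a. clinear (\<lambda>b. F x a b)" "\<And>a b. clinear (\<lambda>x. F x a b)"
  shows "clinear (\<lambda>x. sweedler2 G (F x) h)"
  unfolding sweedler2_def by (intro clinear_tlift_fun cbilinearI assms)

lemma clinear_sweedler3 [clinear_intros]:
  assumes "\<And>a b. clinear (\<lambda>x. F x a b)" "\<And>a b. clinear (\<lambda>x. F a x b)" "\<And>a b. clinear (\<lambda>x. F a b x)"
    "clinear g"
  shows "clinear (\<lambda>x. sweedler3 G F (g x))"
  unfolding sweedler3_def by (intro clinear_intros assms)

lemma sweedler2_sum:
  assumes "comult G h = (\<Sum>i\<in>I. a i \<otimes> b i)"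
    and "\<And>y. clinear (\<lambda>x. F x y)" "\<And>x. clinear (\<lambda>y. F x y)"
  shows "sweedler2 G F h = (\<Sum>i\<in>I. F (a i) (b i))"
  unfolding sweedler2_def assms(1)
  by (subst clinear_map_sum[OF clinear_tlift]) (simp_all add: tlift_elem cbilinearI assms(2,3))

lemma comult_word:
  assumes "I \<in> idx m" "J \<in> idx m"
  shows "comult G (w I J) = (\<Sum>K\<in>idx m. w I K \<otimes> w K J)"
  using assms
proof (induction m arbitrary: I J)
  case 0
  then show ?case by (simp add: comult_one flip: one_tensor_def)
next
  case (Suc m)
  then obtain i I' j J' where IJ: "I = i # I'" "J = j # J'" "i \<in> {1..n}" "j \<in> {1..n}"
      "I' \<in> idx m" "J' \<in> idx m"
    by (auto simp: multi_indices_def length_Suc_conv)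
  have "comult G (w I J) = (\<Sum>k\<in>{1..n}. u i k \<otimes> u k j) * (\<Sum>K\<in>idx m. w I' K \<otimes> w K J')"
    using IJ by (simp add: comult_mult comult_u Suc.IH)
  also have "\<dots> = (\<Sum>K\<in>idx (Suc m). w I K \<otimes> w K J)"
    by (simp add: sum_multi_indices_Suc sum_distrib_left sum_distrib_right times_tensor_elem IJ)
       (rule sum.swap)
  finally show ?case .
qed

lemma counit_word:
  assumes "I \<in> idx m" "J \<in> idx m"
  shows "counit G (w I J) = (if I = J then 1 else 0)"
  using assms
proof (induction m arbitrary: I J)
  case (Suc m)
  then obtain i I' j J' where IJ: "I = i # I'" "J = j # J'" "i \<in> {1..n}" "j \<in> {1..n}"
      "I' \<in> idx m" "J' \<in> idx m"
    by (auto simp: multi_indices_def length_Suc_conv)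
  then show ?case using Suc.IH[of I' J'] by (simp add: counit_simps counit_u)
qed (simp add: counit_simps)

lemma sweedler2_word:
  assumes "I \<in> idx m" "J \<in> idx m" "\<And>y. clinear (\<lambda>x. F x y)" "\<And>x. clinear (\<lambda>y. F x y)"
  shows "sweedler2 G F (w I J) = (\<Sum>K\<in>idx m. F (w I K) (w K J))"
  by (rule sweedler2_sum[OF comult_word]) (use assms in auto)

lemma sweedler3_word:
  assumes "I \<in> idx m" "J \<in> idx m" "\<And>a b. clinear (\<lambda>x. F x a b)" "\<And>a b. clinear (\<lambda>x. F a x b)"
    "\<And>a b. clinear (\<lambda>x. F a b x)"
  shows "sweedler3 G F (w I J) = (\<Sum>K\<in>idx m. \<Sum>L\<in>idx m. F (w I K) (w K L) (w L J))"
proof -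
  have "sweedler3 G F (w I J) = (\<Sum>K\<in>idx m. sweedler2 G (F (w I K)) (w K J))"
    unfolding sweedler3_def
    by (rule sweedler2_word[OF assms(1,2)]) (intro clinear_intros assms)+
  also have "\<dots> = (\<Sum>K\<in>idx m. \<Sum>L\<in>idx m. F (w I K) (w K L) (w L J))"
    using assms(2) by (intro sum.cong refl sweedler2_word assms(4,5)) auto
  finally show ?thesis .
qed

lemma sweedler2_u:
  assumes "i \<in> {1..n}" "j \<in> {1..n}" "\<And>y. clinear (\<lambda>x. F x y)" "\<And>x. clinear (\<lambda>y. F x y)"
  shows "sweedler2 G F (u i j) = (\<Sum>k\<in>{1..n}. F (u i k) (u k j))"
  by (rule sweedler2_sum[OF comult_u]) (use assms in auto)

lemma antipode_left: "sweedler2 G (\<lambda>a b. S a * b) h = counit G h *\<^sub>C 1"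
  and antipode_right: "sweedler2 G (\<lambda>a b. a * S b) h = counit G h *\<^sub>C 1"
  using hopf by (auto simp: hopf_algebra_def)

lemma antipode_word:
  assumes "I \<in> idx m" "J \<in> idx m"
  shows "(\<Sum>K\<in>idx m. S (w I K) * w K J) = (if I = J then 1 else 0)"
    and "(\<Sum>K\<in>idx m. w I K * S (w K J)) = (if I = J then 1 else 0)"
  using antipode_left[of "w I J"] antipode_right[of "w I J"]
  by (simp_all add: sweedler2_word[OF assms] clinear_intros counit_word[OF assms] scaleC_one
      split: if_splits)

lemma antipode_u:
  assumes "i \<in> {1..n}" "j \<in> {1..n}"
  shows "(\<Sum>k\<in>{1..n}. S (u i k) * u k j) = (if i = j then 1 else 0)"
    and "(\<Sum>k\<in>{1..n}. u i k * S (u k j)) = (if i = j then 1 else 0)"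
  using antipode_left[of "u i j"] antipode_right[of "u i j"]
  by (simp_all add: sweedler2_u[OF assms] clinear_intros counit_u[OF assms] scaleC_one
      split: if_splits)

lemma words_eqI:
  assumes "clinear f" "clinear g"
    and "\<And>m I J. I \<in> idx m \<Longrightarrow> J \<in> idx m \<Longrightarrow> f (w I J) = g (w I J)"
  shows "f h = g h"
  using span_words[of h]
  by (induction rule: complex_vector.span_induct_alt)
    (auto simp: clinearD[OF assms(1)] clinearD[OF assms(2)] assms(3))

text \<open>Meant for properties such as triangularity of A and B, which are stable under products
  and linear combinations. The zero element arises by scaling 1 with 0.\<close>

lemma generators_induct [case_names one gen mult add scale]:
  assumes "P 1" "\<And>i j. i \<in> {1..n} \<Longrightarrow> j \<in> {1..n} \<Longrightarrow> P (u i j)"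
    and "\<And>f g. P f \<Longrightarrow> P g \<Longrightarrow> P (f * g)" "\<And>f g. P f \<Longrightarrow> P g \<Longrightarrow> P (f + g)"
    and "\<And>c f. P f \<Longrightarrow> P (c *\<^sub>C f)"
  shows "P h"
proof -
  have word: "P (w I J)" if "I \<in> idx m" "J \<in> idx m" for I J m
    using that
  proof (induction m arbitrary: I J)
    case (Suc m)
    then show ?case
      by (auto simp: multi_indices_def length_Suc_conv intro!: assms(2,3))
  qed (simp add: assms)
  show ?thesis using span_words[of h]
  proof (induction rule: complex_vector.span_induct_alt)
    case base
    show ?case using assms(5)[OF assms(1), of 0] by simp
  qed (auto intro!: assms(4,5) word)
qed

text \<open>That the antipode reverses the coproduct is not among the axioms in
  \<open>hopf_algebra\<close>. On the entries it follows from uniqueness of inverses: over the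
  tensor square of G, both sides are inverse to the matrix of coproducts of the u^i_j.\<close>

lemma comult_antipode_u:
  assumes "i \<in> {1..n}" "j \<in> {1..n}"
  shows "comult G (S (u i j)) = (\<Sum>k\<in>{1..n}. S (u k j) \<otimes> S (u i k))"
proof (rule matrix_inverse_unique[where I = "{1..n}" and X = "\<lambda>i j. comult G (S (u i j))"
      and Z = "\<lambda>i j. comult G (u i j)"])
  fix i j assume ij: "i \<in> {1..n}" "j \<in> {1..n}"
  have "(\<Sum>k\<in>{1..n}. comult G (S (u i k)) * comult G (u k j)) = comult G (\<Sum>k\<in>{1..n}. S (u i k) * u k j)"
    by (simp add: comult_mult clinear_map_sum[OF clinear_comult])
  then show "(\<Sum>k\<in>{1..n}. comult G (S (u i k)) * comult G (u k j)) = (if i = j then 1 else 0)"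
    by (simp add: antipode_u[OF ij] comult_one clinear_0[OF clinear_comult])
  have "(\<Sum>k\<in>{1..n}. comult G (u i k) * (\<Sum>l\<in>{1..n}. S (u l j) \<otimes> S (u k l)))
      = (\<Sum>k\<in>{1..n}. \<Sum>l\<in>{1..n}. \<Sum>a\<in>{1..n}. (u i a * S (u l j)) \<otimes> (u a k * S (u k l)))"
    using ij by (intro sum.cong refl)
       (simp add: comult_u sum_distrib_left sum_distrib_right times_tensor_elem)
  also have "\<dots> = (\<Sum>l\<in>{1..n}. \<Sum>a\<in>{1..n}. \<Sum>k\<in>{1..n}. (u i a * S (u l j)) \<otimes> (u a k * S (u k l)))"
    by (subst sum.swap) (intro sum.cong refl sum.swap)
  also have "\<dots> = (\<Sum>l\<in>{1..n}. \<Sum>a\<in>{1..n}. (u i a * S (u l j)) \<otimes> (if a = l then 1 else 0))"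
    by (intro sum.cong refl) (simp add: antipode_u flip: tensor_sum_right)
  also have "\<dots> = (\<Sum>l\<in>{1..n}. u i l * S (u l j)) \<otimes> 1"
    by (simp add: tensor_sum_left if_distrib[of "(\<otimes>) _"] cong: if_cong)
  also have "\<dots> = (if i = j then 1 else 0)"
    by (simp add: antipode_u[OF ij] one_tensor_def)
  finally show "(\<Sum>k\<in>{1..n}. comult G (u i k) * (\<Sum>l\<in>{1..n}. S (u l j) \<otimes> S (u k l)))
      = (if i = j then 1 else 0)" .
qed (use assms in auto)

lemma sweedler2_antipode_u:
  assumes "i \<in> {1..n}" "j \<in> {1..n}" "\<And>y. clinear (\<lambda>x. F x y)" "\<And>x. clinear (\<lambda>y. F x y)"
  shows "sweedler2 G F (S (u i j)) = (\<Sum>k\<in>{1..n}. F (S (u k j)) (S (u i k)))"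
  by (rule sweedler2_sum[OF comult_antipode_u]) (use assms in auto)

lemma counit_antipode_u:
  assumes "i \<in> {1..n}" "j \<in> {1..n}"
  shows "counit G (S (u i j)) = (if i = j then 1 else 0)"
proof -
  have "counit G (S (u i j)) = (\<Sum>k\<in>{1..n}. counit G (S (u i k)) * (if k = j then 1 else 0))"
    using assms by (simp add: if_distrib[of "(*) _"] cong: if_cong)
  also have "\<dots> = (\<Sum>k\<in>{1..n}. counit G (S (u i k)) * counit G (u k j))"
    using assms by (intro sum.cong refl) (simp add: counit_u)
  also have "\<dots> = counit G (\<Sum>k\<in>{1..n}. S (u i k) * u k j)"
    by (simp add: counit_simps clinear_map_sum[OF clinear_counit])
  finally show ?thesis
    by (simp add: antipode_u[OF assms] counit_simps clinear_0[OF clinear_counit])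
qed

text \<open>The antipode axiom at S(u^i_j), whose coproduct is \<open>comult_antipode_u\<close>. It
  cancels the right-hand factor S(u^l_j) when differentials of coinvariants are contracted to
  left-invariant forms.\<close>

lemma antipode_antipode_u:
  assumes "i \<in> {1..n}" "j \<in> {1..n}"
  shows "(\<Sum>k\<in>{1..n}. S (S (u k j)) * S (u i k)) = (if i = j then 1 else 0)"
proof -
  have "sweedler2 G (\<lambda>a b. S a * b) (S (u i j)) = (\<Sum>k\<in>{1..n}. S (S (u k j)) * S (u i k))"
    by (intro sweedler2_antipode_u assms clinear_intros)
  then show ?thesis by (simp add: antipode_left counit_antipode_u[OF assms] scaleC_one split: if_splits)
qed

lemma sweedler3_compose:
  assumes "clinear f" "\<And>a b. clinear (\<lambda>x. F x a b)" "\<And>a b. clinear (\<lambda>x. F a x b)"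
    "\<And>a b. clinear (\<lambda>x. F a b x)"
  shows "f (sweedler3 G F h) = sweedler3 G (\<lambda>a b c. f (F a b c)) h"
proof (rule words_eqI[where h = h])
  fix m I J assume IJ: "I \<in> idx m" "J \<in> idx m"
  have "sweedler3 G (\<lambda>a b c. f (F a b c)) (w I J)
      = (\<Sum>K\<in>idx m. \<Sum>L\<in>idx m. f (F (w I K) (w K L) (w L J)))"
    by (rule sweedler3_word) (intro IJ clinear_compose[OF assms(1)] assms(2-))+
  moreover have "sweedler3 G F (w I J) = (\<Sum>K\<in>idx m. \<Sum>L\<in>idx m. F (w I K) (w K L) (w L J))"
    by (rule sweedler3_word) (intro IJ assms(2-))+
  ultimately show "f (sweedler3 G F (w I J)) = sweedler3 G (\<lambda>a b c. f (F a b c)) (w I J)"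
    by (simp add: clinear_map_sum[OF assms(1)])
qed (intro clinear_compose[OF assms(1)] clinear_sweedler3 assms(2-) clinear_id)+

lemma sweedler2_compose:
  assumes "clinear f" "\<And>y. clinear (\<lambda>x. F x y)" "\<And>x. clinear (\<lambda>y. F x y)"
  shows "f (sweedler2 G F h) = sweedler2 G (\<lambda>a b. f (F a b)) h"
  unfolding sweedler2_def by (rule tlift_compose) (intro assms cbilinearI)+

lemma sweedler3_minus:
  assumes "clinear f" "clinear g"
  shows "sweedler3 G (\<lambda>a b c. (f b - g b) *\<^sub>C (S a * c)) h
    = sweedler3 G (\<lambda>a b c. f b *\<^sub>C (S a * c)) h - sweedler3 G (\<lambda>a b c. g b *\<^sub>C (S a * c)) h"
proof (rule words_eqI[where h = h])
  note [clinear_intros] = clinear_compose[OF assms(1)] clinear_compose[OF assms(2)]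
  fix m I J assume IJ: "I \<in> idx m" "J \<in> idx m"
  have *: "sweedler3 G (\<lambda>a b c. k b *\<^sub>C (S a * c)) (w I J)
      = (\<Sum>K\<in>idx m. \<Sum>L\<in>idx m. k (w K L) *\<^sub>C (S (w I K) * w L J))" if "clinear k" for k
  proof -
    note [clinear_intros] = clinear_compose[OF that]
    show ?thesis by (rule sweedler3_word) (intro IJ clinear_intros)+
  qed
  show "sweedler3 G (\<lambda>a b c. (f b - g b) *\<^sub>C (S a * c)) (w I J)
    = sweedler3 G (\<lambda>a b c. f b *\<^sub>C (S a * c)) (w I J) - sweedler3 G (\<lambda>a b c. g b *\<^sub>C (S a * c)) (w I J)"
    unfolding *[OF assms(1)] *[OF assms(2)] *[OF clinear_minus[OF assms]]
    by (simp add: complex_vector.scale_left_diff_distrib sum_subtractf)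
next
  note [clinear_intros] = clinear_compose[OF assms(1)] clinear_compose[OF assms(2)]
  show "clinear (sweedler3 G (\<lambda>a b c. (f b - g b) *\<^sub>C (S a * c)))"
    "clinear (\<lambda>h. sweedler3 G (\<lambda>a b c. f b *\<^sub>C (S a * c)) h - sweedler3 G (\<lambda>a b c. g b *\<^sub>C (S a * c)) h)"
    by (intro clinear_intros clinear_sweedler3[where g = "\<lambda>x. x", simplified])+
qed

text \<open>The counit on the middle leg leaves S(h_1) h_2. Subtracted from the corresponding
  formula for Q_11 after applying \<alpha>, this shows that the coordinate of e^0 is invariant under
  the adjoint coaction.\<close>

lemma sweedler3_counit: "sweedler3 G (\<lambda>a b c. counit G b *\<^sub>C (S a * c)) h = counit G h *\<^sub>C 1"
proof (rule words_eqI[where h = h])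
  fix m I J assume IJ: "I \<in> idx m" "J \<in> idx m"
  have "sweedler3 G (\<lambda>a b c. counit G b *\<^sub>C (S a * c)) (w I J)
      = (\<Sum>K\<in>idx m. \<Sum>L\<in>idx m. counit G (w K L) *\<^sub>C (S (w I K) * w L J))"
    by (rule sweedler3_word) (intro IJ clinear_intros)+
  also have "\<dots> = (\<Sum>K\<in>idx m. \<Sum>L\<in>idx m. if K = L then S (w I K) * w L J else 0)"
    by (intro sum.cong refl) (auto simp: counit_word scaleC_one)
  also have "\<dots> = counit G (w I J) *\<^sub>C 1"
    using IJ by (simp add: antipode_word counit_word scaleC_one)
  finally show "sweedler3 G (\<lambda>a b c. counit G b *\<^sub>C (S a * c)) (w I J) = counit G (w I J) *\<^sub>C 1" .
qed (intro clinear_intros)+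

lemma sweedler2_zero: "sweedler2 G (\<lambda>a b. 0) h = 0"
  using sweedler2_compose[OF clinear_zero, of "\<lambda>a b. 0 :: complex" h] by (simp add: clinear_intros)

lemma sweedler2_word_mult:
  assumes IJ: "I \<in> idx m" "J \<in> idx m" "I' \<in> idx m'" "J' \<in> idx m'"
    and F: "\<And>y. clinear (\<lambda>x. F x y)" "\<And>x. clinear (\<lambda>y. F x y)"
  shows "sweedler2 G F (w I J * w I' J')
    = (\<Sum>K\<in>idx m. \<Sum>K'\<in>idx m'. F (w I K * w I' K') (w K J * w K' J'))"
proof -
  have "comult G (w I J * w I' J') = (\<Sum>x\<in>idx m \<times> idx m'.
      (w I (fst x) * w I' (snd x)) \<otimes> (w (fst x) J * w (snd x) J'))"
    unfolding comult_mult comult_word[OF IJ(1,2)] comult_word[OF IJ(3,4)] sum_product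
    by (simp add: times_tensor_elem sum.cartesian_product case_prod_beta)
  from sweedler2_sum[OF this F] show ?thesis by (simp add: sum.cartesian_product case_prod_beta)
qed

lemma aug_minus_counit: "h - counit G h *\<^sub>C 1 \<in> aug G"
  by (simp add: aug_def clinearD[OF clinear_counit] counit_simps scaleC_complex_def)

end

section \<open>The coquasi-triangular structure\<close>

lemma sum_swap_pairs:
  "(\<Sum>a\<in>A. \<Sum>b\<in>B. \<Sum>c\<in>C. \<Sum>d\<in>D. f a b c d) = (\<Sum>c\<in>C. \<Sum>d\<in>D. \<Sum>a\<in>A. \<Sum>b\<in>B. f a b c d)"
proof -
  have 1: "(\<Sum>a\<in>A. \<Sum>b\<in>B. g a b) = (\<Sum>x\<in>A \<times> B. g (fst x) (snd x))" for g
    by (simp add: sum.cartesian_product case_prod_beta)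
  have 2: "(\<Sum>c\<in>C. \<Sum>d\<in>D. g c d) = (\<Sum>y\<in>C \<times> D. g (fst y) (snd y))" for g
    by (simp add: sum.cartesian_product case_prod_beta)
  show ?thesis unfolding 1 2 by (rule sum.swap)
qed

text \<open>P = P (P P') = (P P) P' = P P' = 1.\<close>

lemma idempotent_matrix_with_right_inverse:
  fixes P P' :: "'i \<Rightarrow> 'i \<Rightarrow> 'a::ring_1"
  assumes "finite I"
    and idem: "\<And>i j. i \<in> I \<Longrightarrow> j \<in> I \<Longrightarrow> (\<Sum>k\<in>I. P i k * P k j) = P i j"
    and inv: "\<And>i j. i \<in> I \<Longrightarrow> j \<in> I \<Longrightarrow> (\<Sum>k\<in>I. P i k * P' k j) = (if i = j then 1 else 0)"
    and "i \<in> I" "j \<in> I"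
  shows "P i j = (if i = j then 1 else 0)"
proof -
  have "P i j = (\<Sum>k\<in>I. P i k * (if k = j then 1 else 0))"
    using assms by (simp add: if_distrib[of "(*) _"] cong: if_cong)
  also have "\<dots> = (\<Sum>k\<in>I. P i k * (\<Sum>l\<in>I. P k l * P' l j))"
    using assms by (intro sum.cong refl) (simp add: inv)
  also have "\<dots> = (\<Sum>l\<in>I. (\<Sum>k\<in>I. P i k * P k l) * P' l j)"
    by (simp only: sum_distrib_left sum_distrib_right mult.assoc) (rule sum.swap)
  also have "\<dots> = (if i = j then 1 else 0)"
    using assms by (simp add: idem inv)
  finally show ?thesis .
qed

locale coquasi_triangular_SU = matrix_hopf N G
  for N :: nat and G :: "('a::complex_algebra_1, 'm) qgroup_scheme" +
  fixes q :: real and q' :: complex and r :: "('a, 'a) tensor \<Rightarrow> complex"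
  assumes N: "N \<ge> 2" and q: "0 < q" "q \<le> 1" and q': "q' ^ N = complex_of_real q"
    and coquasi: "SU_coquasi_triangular N q q' G r"
begin

section \<open>The matrix functionals A and B of the coquasi-triangular structure\<close>

abbreviation A where "A k l h \<equiv> r (h \<otimes> u k l)"
abbreviation B where "B k l h \<equiv> r (u k l \<otimes> h)"
abbreviation Q where "Q \<equiv> Qmat G r"

lemma q'_nz: "q' \<noteq> 0"
  using q q' N by (metis of_real_eq_0_iff not_less_iff_gr_or_eq power_0_left not_numeral_le_zero)

lemma clinear_r: "clinear r"
  using coquasi by (simp add: SU_coquasi_triangular_def coquasi_triangular_def)

lemma clinear_r' [clinear_intros]: "clinear f \<Longrightarrow> clinear (\<lambda>x. r (f x))"
  by (rule clinear_compose[OF clinear_r])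

lemma r_mult_left: "r ((f * g) \<otimes> h) = sweedler2 G (\<lambda>h1 h2. r (f \<otimes> h1) * r (g \<otimes> h2)) h"
  and r_mult_right: "r (f \<otimes> (g * h)) = sweedler2 G (\<lambda>f1 f2. r (f1 \<otimes> h) * r (f2 \<otimes> g)) f"
  and quasi_comm: "sweedler2 G (\<lambda>f1 f2. sweedler2 G (\<lambda>g1 g2. r (f2 \<otimes> g2) *\<^sub>C (g1 * f1)) g) f
          = sweedler2 G (\<lambda>f1 f2. sweedler2 G (\<lambda>g1 g2. r (f1 \<otimes> g1) *\<^sub>C (f2 * g2)) g) f"
  using coquasi by (simp_all add: SU_coquasi_triangular_def coquasi_triangular_def)

lemma A_mult: "k \<in> {1..N} \<Longrightarrow> l \<in> {1..N} \<Longrightarrow> A k l (f * g) = (\<Sum>m\<in>{1..N}. A k m f * A m l g)"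
  unfolding r_mult_left by (intro sweedler2_u clinear_intros)

lemma B_mult: "k \<in> {1..N} \<Longrightarrow> l \<in> {1..N} \<Longrightarrow> B k l (g * h) = (\<Sum>m\<in>{1..N}. B k m h * B m l g)"
  unfolding r_mult_right by (intro sweedler2_u clinear_intros)

text \<open>The value of r at the unit is not prescribed by \<open>coquasi_triangular\<close>.
  Multiplicativity makes A(1) and B(1) idempotent, and the convolution inverse r' provides right
  inverses, so both are identity matrices.\<close>

lemma
  assumes "k \<in> {1..N}" "l \<in> {1..N}"
  shows A_one: "A k l 1 = (if k = l then 1 else 0)" and B_one: "B k l 1 = (if k = l then 1 else 0)"
proof -
  obtain r' where r': "clinear r'"
      "\<And>f g. sweedler2 G (\<lambda>f1 f2. sweedler2 G (\<lambda>g1 g2. r (f1 \<otimes> g1) * r' (f2 \<otimes> g2)) g) f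
                = counit G f * counit G g"
    using coquasi by (auto simp: SU_coquasi_triangular_def coquasi_triangular_def)
  have lin [clinear_intros]: "clinear f \<Longrightarrow> clinear (\<lambda>x. r' (f x))" for f :: "'x::complex_vector \<Rightarrow> _"
    by (rule clinear_compose[OF r'(1)])
  have one: "sweedler2 G F 1 = F 1 1" if "\<And>y. clinear (\<lambda>x. F x y)" "\<And>x. clinear (\<lambda>y. F x y)"
    for F :: "'a \<Rightarrow> 'a \<Rightarrow> complex"
    using that by (simp add: sweedler2_def comult_one one_tensor_def tlift_elem cbilinearI)
  have 1: "(\<Sum>m\<in>{1..N}. A i m 1 * r' (1 \<otimes> u m j)) = (if i = j then 1 else 0)"
    if "i \<in> {1..N}" "j \<in> {1..N}" for i j
  proof -
    have "sweedler2 G (\<lambda>f1 f2. sweedler2 G (\<lambda>g1 g2. r (f1 \<otimes> g1) * r' (f2 \<otimes> g2)) (u i j)) 1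
        = sweedler2 G (\<lambda>g1 g2. r (1 \<otimes> g1) * r' (1 \<otimes> g2)) (u i j)"
      by (intro one clinear_intros)
    also have "\<dots> = (\<Sum>m\<in>{1..N}. A i m 1 * r' (1 \<otimes> u m j))"
      by (intro sweedler2_u that clinear_intros)
    finally show ?thesis using that by (simp add: r'(2) counit_simps counit_u)
  qed
  have 2: "(\<Sum>m\<in>{1..N}. B i m 1 * r' (u m j \<otimes> 1)) = (if i = j then 1 else 0)"
    if "i \<in> {1..N}" "j \<in> {1..N}" for i j
  proof -
    have "(\<lambda>f1 f2. sweedler2 G (\<lambda>g1 g2. r (f1 \<otimes> g1) * r' (f2 \<otimes> g2)) 1)
        = (\<lambda>f1 f2. r (f1 \<otimes> 1) * r' (f2 \<otimes> 1))"
      by (intro ext one clinear_intros)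
    moreover have "sweedler2 G (\<lambda>f1 f2. r (f1 \<otimes> 1) * r' (f2 \<otimes> 1)) (u i j)
        = (\<Sum>m\<in>{1..N}. B i m 1 * r' (u m j \<otimes> 1))"
      by (intro sweedler2_u that clinear_intros)
    ultimately show ?thesis using r'(2)[where f = "u i j" and g = 1] that by (simp add: counit_simps counit_u)
  qed
  show "A k l 1 = (if k = l then 1 else 0)"
    by (rule idempotent_matrix_with_right_inverse[where I = "{1..N}" and P' = "\<lambda>m j. r' (1 \<otimes> u m j)"])
      (simp_all only: 1 assms finite_atLeastAtMost A_mult[where f = 1 and g = 1, symmetric] mult_1)
  show "B k l 1 = (if k = l then 1 else 0)"
    by (rule idempotent_matrix_with_right_inverse[where I = "{1..N}" and P' = "\<lambda>m j. r' (u m j \<otimes> 1)"])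
      (simp_all only: 2 assms finite_atLeastAtMost B_mult[where g = 1 and h = 1, symmetric] mult_1)
qed

lemma A_u:
  assumes "p \<in> {1..N}" "l \<in> {1..N}" "m \<in> {1..N}" "j \<in> {1..N}"
  shows "A p l (u m j) = inverse q' * (if p = l \<and> m = j then if m = p then complex_of_real q else 1
    else if p < m \<and> j = p \<and> l = m then nu q else 0)"
proof -
  have "A p l (u m j) = inverse q' * Rmat q p m j l"
    using assms coquasi by (simp add: SU_coquasi_triangular_def)
  then show ?thesis by (auto simp: Rmat_def kron_def Heav_def)
qed

lemma B_u:
  assumes "k \<in> {1..N}" "p \<in> {1..N}" "i \<in> {1..N}" "m \<in> {1..N}"
  shows "B k p (u i m) = inverse q' * (if k = p \<and> i = m then if i = k then complex_of_real q else 1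
    else if i < k \<and> p = i \<and> m = k then nu q else 0)"
  using A_u[of i m k p] assms by auto

text \<open>A is multiplicative, so triangularity passes from the generators, where
  \<open>A_u\<close> shows it, to their products.\<close>

lemma A_triangular: "l < k \<Longrightarrow> k \<in> {1..N} \<Longrightarrow> l \<in> {1..N} \<Longrightarrow> A k l h = 0"
proof (induction h arbitrary: k l rule: generators_induct)
  case (mult f g)
  have "A k m f * A m l g = 0" if "m \<in> {1..N}" for m
    using mult that by (cases "m < k") auto
  then show ?case unfolding A_mult[OF mult.prems(2,3)] by (intro sum.neutral) blast
qed (auto simp: A_one A_u tensor_add_left tensor_scale_left clinearD[OF clinear_r])

lemma B_triangular: "k < l \<Longrightarrow> k \<in> {1..N} \<Longrightarrow> l \<in> {1..N} \<Longrightarrow> B k l h = 0"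
proof (induction h arbitrary: k l rule: generators_induct)
  case (mult f g)
  have "B k m g * B m l f = 0" if "m \<in> {1..N}" for m
    using mult that by (cases "k < m") auto
  then show ?case unfolding B_mult[OF mult.prems(2,3)] by (intro sum.neutral) blast
qed (auto simp: B_one B_u tensor_add_right tensor_scale_right clinearD[OF clinear_r])

section \<open>The matrix Q: products, the character Q_11, values on generators\<close>

lemma Q_eq:
  assumes "k \<in> {1..N}" "l \<in> {1..N}"
  shows "Q k l h = sweedler2 G (\<lambda>a b. \<Sum>m\<in>{1..N}. B k m a * A m l b) h"
  unfolding Qmat_def using assms
  by (subst sweedler2_u) (auto intro!: clinear_intros)

lemma clinear_Q' [clinear_intros]: "clinear f \<Longrightarrow> clinear (\<lambda>x. Q k l (f x))"
  unfolding Qmat_def by (intro clinear_intros)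

lemma clinear_Q: "clinear (Q k l)"
  using clinear_Q'[OF clinear_id] by simp

lemma Q_word:
  assumes "k \<in> {1..N}" "l \<in> {1..N}" "I \<in> idx m" "J \<in> idx m"
  shows "Q k l (w I J) = (\<Sum>K\<in>idx m. \<Sum>p\<in>{1..N}. B k p (w I K) * A p l (w K J))"
  unfolding Q_eq[OF assms(1,2)] by (rule sweedler2_word) (intro assms clinear_intros)+

lemma Q_one:
  assumes "k \<in> {1..N}" "l \<in> {1..N}"
  shows "Q k l 1 = (if k = l then 1 else 0)"
  using Q_word[of k l "[]" 0 "[]"] assms
  by (simp add: A_one B_one if_distrib[of "\<lambda>x. x * _"] cong: if_cong)

text \<open>B reverses products and A preserves them, so B(f_1 g_1) A(f_2 g_2) = B(g_1) (B(f_1)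
  A(f_2)) A(g_2). This is verified for words in both arguments.\<close>

lemma Q_mult:
  assumes kl: "k \<in> {1..N}" "l \<in> {1..N}"
  shows "Q k l (f * g) = sweedler2 G (\<lambda>a b. \<Sum>i\<in>{1..N}. \<Sum>j\<in>{1..N}. B k i a * Q i j f * A j l b) g"
proof (rule words_eqI[where h = f])
  fix m I J assume IJ: "I \<in> idx m" "J \<in> idx m"
  show "Q k l (w I J * g) = sweedler2 G (\<lambda>a b. \<Sum>i\<in>{1..N}. \<Sum>j\<in>{1..N}. B k i a * Q i j (w I J) * A j l b) g"
  proof (rule words_eqI[where h = g])
    fix m' I' J' assume IJ': "I' \<in> idx m'" "J' \<in> idx m'"
    have "Q k l (w I J * w I' J') = (\<Sum>K\<in>idx m. \<Sum>K'\<in>idx m'. \<Sum>p\<in>{1..N}.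
        B k p (w I K * w I' K') * A p l (w K J * w K' J'))"
      unfolding Q_eq[OF kl] by (rule sweedler2_word_mult[OF IJ IJ']) (intro clinear_intros)+
    also have "\<dots> = (\<Sum>K\<in>idx m. \<Sum>K'\<in>idx m'. \<Sum>p\<in>{1..N}. \<Sum>i\<in>{1..N}. \<Sum>j\<in>{1..N}.
        B k i (w I' K') * (B i p (w I K) * A p j (w K J)) * A j l (w K' J'))"
      using kl by (intro sum.cong refl)
        (simp only: B_mult A_mult sum_product, simp only: sum_distrib_left sum_distrib_right mult.assoc)
    also have "\<dots> = (\<Sum>K'\<in>idx m'. \<Sum>K\<in>idx m. \<Sum>p\<in>{1..N}. \<Sum>i\<in>{1..N}. \<Sum>j\<in>{1..N}.
        B k i (w I' K') * (B i p (w I K) * A p j (w K J)) * A j l (w K' J'))"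
      by (rule sum.swap)
    also have "\<dots> = (\<Sum>K'\<in>idx m'. \<Sum>i\<in>{1..N}. \<Sum>j\<in>{1..N}. \<Sum>K\<in>idx m. \<Sum>p\<in>{1..N}.
        B k i (w I' K') * (B i p (w I K) * A p j (w K J)) * A j l (w K' J'))"
      by (rule sum.cong[OF refl]) (rule sum_swap_pairs)
    also have "\<dots> = (\<Sum>K'\<in>idx m'. \<Sum>i\<in>{1..N}. \<Sum>j\<in>{1..N}.
        B k i (w I' K') * Q i j (w I J) * A j l (w K' J'))"
      by (intro sum.cong refl) (simp only: Q_word[OF _ _ IJ] sum_distrib_left sum_distrib_right)
    also have "\<dots> = sweedler2 G (\<lambda>a b. \<Sum>i\<in>{1..N}. \<Sum>j\<in>{1..N}. B k i a * Q i j (w I J) * A j l b) (w I' J')"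
      by (rule sweedler2_word[symmetric]) (intro IJ' clinear_intros)+
    finally show "Q k l (w I J * w I' J') = \<dots>" .
  qed (intro clinear_intros)+
qed (intro clinear_intros)+

lemma one_in: "1 \<in> {1..N}"
  using N by simp

lemma sum_at_one:
  assumes "\<And>i. i \<in> {1..N} \<Longrightarrow> i \<noteq> 1 \<Longrightarrow> f i = (0 :: 'b::comm_monoid_add)"
  shows "(\<Sum>i\<in>{1..N}. f i) = f 1"
proof -
  have "(\<Sum>i\<in>{1..N}. f i) = (\<Sum>i\<in>{1}. f i)"
    by (rule sum.mono_neutral_right) (use assms one_in in auto)
  then show ?thesis by simp
qed

text \<open>Row 1 of a lower triangular matrix is supported in column 1, so row 1 of Q(f g) depends
  on f only through row 1 of Q(f). Together with the column version this makes I a right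
  ideal.\<close>

lemma Q_row_one:
  assumes "l \<in> {1..N}"
  shows "Q 1 l (f * g) = sweedler2 G (\<lambda>a b. \<Sum>j\<in>{1..N}. B 1 1 a * Q 1 j f * A j l b) g"
  unfolding Q_mult[OF one_in assms]
  by (subst sum_at_one) (auto simp: B_triangular one_in)

lemma Q_column_one:
  assumes "k \<in> {1..N}"
  shows "Q k 1 (f * g) = sweedler2 G (\<lambda>a b. \<Sum>i\<in>{1..N}. B k i a * Q i 1 f * A 1 1 b) g"
  unfolding Q_mult[OF assms one_in]
  by (subst sum.swap, subst sum_at_one) (auto simp: A_triangular one_in)

text \<open>Both triangularities together leave B_11(g_1) Q_11(f) A_11(g_2), from which the scalar
  Q_11(f) can be taken out.\<close>

lemma chi_hom: "calgebra_hom (Q 1 1)"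
proof -
  have *: "Q 1 1 g = sweedler2 G (\<lambda>a b. B 1 1 a * A 1 1 b) g" for g
    unfolding Q_eq[OF one_in one_in] by (subst sum_at_one) (auto simp: B_triangular one_in)
  have "Q 1 1 (f * g) = Q 1 1 f * Q 1 1 g" for f g
  proof -
    have "Q 1 1 (f * g) = sweedler2 G (\<lambda>a b. B 1 1 a * Q 1 1 f * A 1 1 b) g"
      unfolding Q_row_one[OF one_in] by (subst sum_at_one) (auto simp: A_triangular one_in)
    also have "\<dots> = sweedler2 G (\<lambda>a b. Q 1 1 f * (B 1 1 a * A 1 1 b)) g"
      by (simp add: mult_ac)
    also have "\<dots> = Q 1 1 f * Q 1 1 g"
      unfolding * sweedler2_def
      by (rule tlift_compose[symmetric]) (intro clinear_intros cbilinearI)+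
    finally show ?thesis .
  qed
  then show ?thesis by (simp add: calgebra_hom_def clinear_Q Q_one[OF one_in one_in])
qed

lemma Q_u:
  assumes "k \<in> {1..N}" "l \<in> {1..N}" "i \<in> {1..N}" "j \<in> {1..N}"
  shows "Q k l (u i j) = inverse q' ^ 2 *
    (if i = j then if k = l then if i = k then complex_of_real q ^ 2 else if i < k then 1 + nu q ^ 2 else 1
       else 0
     else if k = j \<and> l = i then nu q else 0)"
proof -
  \<comment> \<open>Written as a sum of two delta functions so that the double sum collapses. The
    supports are disjoint, since i < k separates a = i from a = k.\<close>
  have B: "B k p (u i a) =
      (if a = i then if p = k then inverse q' * (if i = k then complex_of_real q else 1) else 0 else 0)
      + (if a = k then if p = i then if i < k then inverse q' * nu q else 0 else 0 else 0)"
    if "p \<in> {1..N}" "a \<in> {1..N}" for p a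
    using B_u[of k p i a] assms that by auto
  have "Q k l (u i j) = (\<Sum>a\<in>{1..N}. \<Sum>p\<in>{1..N}. B k p (u i a) * A p l (u a j))"
    unfolding Q_eq[OF assms(1,2)] by (rule sweedler2_u) (intro assms clinear_intros)+
  also have "\<dots> = (\<Sum>a\<in>{1..N}. \<Sum>p\<in>{1..N}.
      (if a = i then if p = k then inverse q' * (if i = k then complex_of_real q else 1) * A p l (u a j) else 0 else 0)
      + (if a = k then if p = i then if i < k then inverse q' * nu q * A p l (u a j) else 0 else 0 else 0))"
    by (intro sum.cong refl) (subst B, auto simp: distrib_right)
  also have "\<dots> = inverse q' * (if i = k then complex_of_real q else 1) * A k l (u i j)
      + (if i < k then inverse q' * nu q * A i l (u k j) else 0)"
    using assms by (simp add: sum.distrib sum.delta if_distrib[of "sum _"] cong: if_cong)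
      (simp add: sum.If_cases)
  also have "\<dots> = inverse q' ^ 2 *
    (if i = j then if k = l then if i = k then complex_of_real q ^ 2 else if i < k then 1 + nu q ^ 2 else 1
       else 0
     else if k = j \<and> l = i then nu q else 0)"
    unfolding A_u[OF assms(1,2,3,4)] A_u[OF assms(3,2,1,4)]
    by (auto simp: power2_eq_square algebra_simps)
  finally show ?thesis .
qed

text \<open>Quasi-commutativity is applied twice, once to move u past the word in the presence of A
  (fact \<open>2\<close>) and once in the presence of B (fact \<open>1\<close>). In Sweedler
  notation the result is Q(h_1) h_2 u = h_1 u Q(h_2).\<close>

lemma covariance:
  assumes kl: "k \<in> {1..N}" "l \<in> {1..N}" and IJ: "I \<in> idx m" "J \<in> idx m"
  shows "(\<Sum>L\<in>idx m. \<Sum>p\<in>{1..N}. Q k p (w I L) *\<^sub>C (w L J * u p l))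
    = (\<Sum>K\<in>idx m. \<Sum>p\<in>{1..N}. Q p l (w K J) *\<^sub>C (w I K * u k p))"
proof -
  have 1: "(\<Sum>p\<in>{1..N}. \<Sum>K\<in>idx m. B p l (w K J) *\<^sub>C (w I K * u k p))
      = (\<Sum>p\<in>{1..N}. \<Sum>K\<in>idx m. B k p (w I K) *\<^sub>C (u p l * w K J))"
    if "I \<in> idx m" "J \<in> idx m" "k \<in> {1..N}" "l \<in> {1..N}" for I J k l
    using quasi_comm[of "w I J" "u k l"] that
    by (simp add: sweedler2_u sweedler2_word clinear_intros)
  have 2: "(\<Sum>K\<in>idx m. \<Sum>p\<in>{1..N}. A p l (w K J) *\<^sub>C (u k p * w I K))
      = (\<Sum>K\<in>idx m. \<Sum>p\<in>{1..N}. A k p (w I K) *\<^sub>C (w K J * u p l))"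
    if "I \<in> idx m" "J \<in> idx m" "k \<in> {1..N}" "l \<in> {1..N}" for I J k l
    using quasi_comm[of "u k l" "w I J"] that
    by (simp add: sweedler2_u sweedler2_word clinear_intros)
  have "(\<Sum>L\<in>idx m. \<Sum>p\<in>{1..N}. Q k p (w I L) *\<^sub>C (w L J * u p l))
     = (\<Sum>L\<in>idx m. \<Sum>p\<in>{1..N}. \<Sum>K\<in>idx m. \<Sum>s\<in>{1..N}.
          B k s (w I K) *\<^sub>C A s p (w K L) *\<^sub>C (w L J * u p l))"
    using kl IJ by (intro sum.cong refl) (simp add: Q_word scaleC_scaleC complex_vector.scale_sum_left)
  also have "\<dots> = (\<Sum>K\<in>idx m. \<Sum>s\<in>{1..N}. \<Sum>L\<in>idx m. \<Sum>p\<in>{1..N}.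
          B k s (w I K) *\<^sub>C A s p (w K L) *\<^sub>C (w L J * u p l))"
    by (rule sum_swap_pairs)
  also have "\<dots> = (\<Sum>K\<in>idx m. \<Sum>s\<in>{1..N}. \<Sum>L\<in>idx m. \<Sum>p\<in>{1..N}.
          B k s (w I K) *\<^sub>C A p l (w L J) *\<^sub>C (u s p * w K L))"
    using kl IJ by (rule_tac sum.cong[OF refl], rule_tac sum.cong[OF refl])
      (simp only: 2 complex_vector.scale_sum_right[symmetric])
  also have "\<dots> = (\<Sum>L\<in>idx m. \<Sum>p\<in>{1..N}. \<Sum>K\<in>idx m. \<Sum>s\<in>{1..N}.
          B k s (w I K) *\<^sub>C A p l (w L J) *\<^sub>C (u s p * w K L))"
    by (rule sum_swap_pairs)
  also have "\<dots> = (\<Sum>L\<in>idx m. \<Sum>p\<in>{1..N}. A p l (w L J) *\<^sub>C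
          (\<Sum>s\<in>{1..N}. \<Sum>K\<in>idx m. B k s (w I K) *\<^sub>C (u s p * w K L)))"
    by (intro sum.cong refl)
      (subst sum.swap, simp add: complex_vector.scale_sum_right scaleC_scaleC mult.commute)
  also have "\<dots> = (\<Sum>L\<in>idx m. \<Sum>p\<in>{1..N}. A p l (w L J) *\<^sub>C
          (\<Sum>s\<in>{1..N}. \<Sum>K\<in>idx m. B s p (w K L) *\<^sub>C (w I K * u k s)))"
    using kl IJ by (intro sum.cong refl) (simp only: 1)
  also have "\<dots> = (\<Sum>L\<in>idx m. \<Sum>p\<in>{1..N}. \<Sum>K\<in>idx m. \<Sum>s\<in>{1..N}.
          (B s p (w K L) * A p l (w L J)) *\<^sub>C (w I K * u k s))"
    by (intro sum.cong refl)
      (subst sum.swap, simp add: complex_vector.scale_sum_right scaleC_scaleC mult.commute)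
  also have "\<dots> = (\<Sum>K\<in>idx m. \<Sum>s\<in>{1..N}. \<Sum>L\<in>idx m. \<Sum>p\<in>{1..N}.
          (B s p (w K L) * A p l (w L J)) *\<^sub>C (w I K * u k s))"
    by (rule sum_swap_pairs)
  also have "\<dots> = (\<Sum>K\<in>idx m. \<Sum>s\<in>{1..N}. Q s l (w K J) *\<^sub>C (w I K * u k s))"
    using kl IJ by (intro sum.cong refl) (simp add: Q_word complex_vector.scale_sum_left)
  finally show ?thesis .
qed

text \<open>\<open>covariance\<close> solved for the adjoint expression: multiply by S(h_1) from the
  left, which gives the fact \<open>T\<close>, and then by S(u) from the right. This is the
  conjugation of Q(h) by u.\<close>

lemma Q_adjoint:
  assumes kl: "k \<in> {1..N}" "l \<in> {1..N}"
  shows "sweedler3 G (\<lambda>a b c. Q k l b *\<^sub>C (S a * c)) h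
    = (\<Sum>p\<in>{1..N}. \<Sum>s\<in>{1..N}. Q s p h *\<^sub>C (u k s * S (u p l)))"
proof (rule words_eqI[where h = h])
  fix m I J assume IJ: "I \<in> idx m" "J \<in> idx m"
  define T where "T p = (\<Sum>M\<in>idx m. \<Sum>L\<in>idx m. Q k p (w M L) *\<^sub>C (S (w I M) * w L J))" for p
  have T: "(\<Sum>p\<in>{1..N}. T p * u p j) = (\<Sum>s\<in>{1..N}. Q s j (w I J) *\<^sub>C u k s)" if "j \<in> {1..N}" for j
  proof -
    have "(\<Sum>p\<in>{1..N}. T p * u p j)
        = (\<Sum>M\<in>idx m. S (w I M) * (\<Sum>L\<in>idx m. \<Sum>p\<in>{1..N}. Q k p (w M L) *\<^sub>C (w L J * u p j)))"
      unfolding T_def sum_distrib_left sum_distrib_right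
      by (subst sum.swap, rule sum.cong[OF refl], subst sum.swap)
        (simp add: mult_scaleC_left mult_scaleC_right mult.assoc)
    also have "\<dots> = (\<Sum>M\<in>idx m. S (w I M) * (\<Sum>K\<in>idx m. \<Sum>s\<in>{1..N}. Q s j (w K J) *\<^sub>C (w M K * u k s)))"
      using covariance that kl IJ by (intro sum.cong refl) simp
    also have "\<dots> = (\<Sum>K\<in>idx m. \<Sum>s\<in>{1..N}. Q s j (w K J) *\<^sub>C ((\<Sum>M\<in>idx m. S (w I M) * w M K) * u k s))"
      unfolding sum_distrib_left sum_distrib_right complex_vector.scale_sum_right
      by (subst sum.swap, rule sum.cong[OF refl], subst sum.swap)
        (simp add: mult_scaleC_left mult_scaleC_right mult.assoc)
    also have "\<dots> = (\<Sum>K\<in>idx m. if I = K then \<Sum>s\<in>{1..N}. Q s j (w K J) *\<^sub>C u k s else 0)"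
      using IJ by (intro sum.cong refl) (simp add: antipode_word)
    also have "\<dots> = (\<Sum>s\<in>{1..N}. Q s j (w I J) *\<^sub>C u k s)"
      using IJ by simp
    finally show ?thesis .
  qed
  have "sweedler3 G (\<lambda>a b c. Q k l b *\<^sub>C (S a * c)) (w I J) = T l"
    unfolding T_def by (rule sweedler3_word) (intro IJ clinear_intros)+
  also have "\<dots> = (\<Sum>p\<in>{1..N}. T p * (if p = l then 1 else 0))"
    using kl by (simp add: if_distrib[of "(*) _"] cong: if_cong)
  also have "\<dots> = (\<Sum>p\<in>{1..N}. T p * (\<Sum>j\<in>{1..N}. u p j * S (u j l)))"
    using kl by (intro sum.cong refl) (simp add: antipode_u)
  also have "\<dots> = (\<Sum>j\<in>{1..N}. (\<Sum>p\<in>{1..N}. T p * u p j) * S (u j l))"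
    unfolding sum_distrib_left sum_distrib_right by (subst sum.swap) (simp add: mult.assoc)
  also have "\<dots> = (\<Sum>j\<in>{1..N}. \<Sum>s\<in>{1..N}. Q s j (w I J) *\<^sub>C (u k s * S (u j l)))"
    by (intro sum.cong refl) (simp add: T sum_distrib_right mult_scaleC_left)
  finally show "sweedler3 G (\<lambda>a b c. Q k l b *\<^sub>C (S a * c)) (w I J) = \<dots>" .
qed (intro clinear_intros)+

section \<open>The right ideal of the calculus\<close>

text \<open>A is applied to the first row of S(u) u = 1. Since A(u) is known and sparse, a linear
  system for the unknown entries of A(S(u^1_j)) remains.\<close>

lemma A_antipode_eq:
  assumes "p \<in> {1..N}" "l \<in> {1..N}" "j \<in> {1..N}"
  shows "(if j = l then complex_of_real q else 1) * A p l (S (u 1 j))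
    + (if j < l then nu q * A p j (S (u 1 l)) else 0) = (if j = 1 \<and> p = l then q' else 0)"
proof -
  have A: "A s l (u m j) = inverse q' *
     ((if m = j then if s = l then if j = l then complex_of_real q else 1 else 0 else 0)
      + (if m = l then if s = j then if j < l then nu q else 0 else 0 else 0))"
    if "s \<in> {1..N}" "m \<in> {1..N}" for s m
    using A_u[of s l m j] assms that by auto
  have "(\<Sum>m\<in>{1..N}. \<Sum>s\<in>{1..N}. A p s (S (u 1 m)) * A s l (u m j)) = A p l (\<Sum>m\<in>{1..N}. S (u 1 m) * u m j)"
    using assms by (simp add: A_mult tensor_sum_left clinear_map_sum[OF clinear_r])
  also have "\<dots> = (if j = 1 \<and> p = l then 1 else 0)"
    using assms by (auto simp: antipode_u[OF one_in] A_one clinearD[OF clinear_r])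
  also have "(\<Sum>m\<in>{1..N}. \<Sum>s\<in>{1..N}. A p s (S (u 1 m)) * A s l (u m j))
    = (\<Sum>m\<in>{1..N}. \<Sum>s\<in>{1..N}. inverse q' *
     ((if m = j then if s = l then A p s (S (u 1 m)) * (if j = l then complex_of_real q else 1) else 0 else 0)
      + (if m = l then if s = j then if j < l then A p s (S (u 1 m)) * nu q else 0 else 0 else 0)))"
    by (intro sum.cong refl) (subst A, auto simp: algebra_simps)
  also have "\<dots> = inverse q' * ((if j = l then complex_of_real q else 1) * A p l (S (u 1 j))
    + (if j < l then nu q * A p j (S (u 1 l)) else 0))"
    using assms by (simp add: sum.distrib if_distrib[of "sum _"] cong: if_cong flip: sum_distrib_left)
      (simp add: sum.If_cases mult.commute)
  finally show ?thesis using q'_nz by (auto simp: field_simps split: if_splits)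
qed

text \<open>For 1 < j and l <= j the cross term of \<open>A_antipode_eq\<close> is absent and the
  entry is 0. A cross term at j < l is such an entry with j and l exchanged, so it always vanishes
  and the system is diagonal.\<close>

lemma A_antipode:
  assumes "p \<in> {1..N}" "l \<in> {1..N}" "j \<in> {1..N}"
  shows "A p l (S (u 1 j)) =
    (if j = 1 \<and> p = l then if p = 1 then q' * inverse (complex_of_real q) else q' else 0)"
proof -
  have *: "A p l (S (u 1 j)) = 0" if "1 < j" "l \<le> j" "l \<in> {1..N}" "j \<in> {1..N}" for l j
    using A_antipode_eq[OF assms(1) that(3,4)] that q by (auto split: if_splits)
  have "A p l (S (u 1 j)) = 0" if "1 < j"
    using *[of j l] *[of l j] A_antipode_eq[OF assms] assms that by (cases "l \<le> j") auto
  moreover have "A p l (S (u 1 1)) =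
      (if p = l then if p = 1 then q' * inverse (complex_of_real q) else q' else 0)"
    using A_antipode_eq[OF assms(1,2) one_in] *[OF _ _ one_in, of l] assms q
    by (auto simp: field_simps split: if_splits)
  ultimately show ?thesis using assms by (cases "j = 1") auto
qed

text \<open>B is applied to u S(u) = 1. Choosing the column of B equal to the row index a of u makes
  B_sa(u^a_m) vanish unless m = s, so that the unknowns B_ps(S(u^s_j)) with s >= a form a closed
  triangular system.\<close>

lemma B_antipode_eq:
  assumes "p \<in> {1..N}" "a \<in> {1..N}" "j \<in> {1..N}"
  shows "complex_of_real q * B p a (S (u a j)) + nu q * (\<Sum>s\<in>{a<..N}. B p s (S (u s j)))
    = (if a = j \<and> p = a then q' else 0)"
proof -
  have B: "B s a (u a m) = inverse q' *
     (if m = s then if s = a then complex_of_real q else if a < s then nu q else 0 else 0)"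
    if "s \<in> {1..N}" "m \<in> {1..N}" for s m
    using B_u[of s a a m] assms that by auto
  have "(\<Sum>m\<in>{1..N}. \<Sum>s\<in>{1..N}. B p s (S (u m j)) * B s a (u a m)) = B p a (\<Sum>m\<in>{1..N}. u a m * S (u m j))"
    using assms by (simp add: B_mult tensor_sum_right clinear_map_sum[OF clinear_r])
  also have "\<dots> = (if a = j \<and> p = a then 1 else 0)"
    using assms by (auto simp: antipode_u[OF assms(2,3)] B_one clinearD[OF clinear_r])
  also have "(\<Sum>m\<in>{1..N}. \<Sum>s\<in>{1..N}. B p s (S (u m j)) * B s a (u a m))
     = (\<Sum>s\<in>{1..N}. \<Sum>m\<in>{1..N}. if m = s then inverse q' *
         ((if s = a then complex_of_real q else if a < s then nu q else 0) * B p s (S (u m j))) else 0)"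
    by (subst sum.swap, intro sum.cong refl) (subst B, auto)
  also have "\<dots> = inverse q' * (\<Sum>s\<in>{1..N}. (if s = a then complex_of_real q else if a < s then nu q else 0)
      * B p s (S (u s j)))"
    by (simp add: sum_distrib_left)
  also have "(\<Sum>s\<in>{1..N}. (if s = a then complex_of_real q else if a < s then nu q else 0) * B p s (S (u s j)))
      = (\<Sum>s\<in>{1..N}. (if s = a then complex_of_real q * B p s (S (u s j)) else 0)
          + (if s \<in> {a<..N} then nu q * B p s (S (u s j)) else 0))"
    by (intro sum.cong refl) auto
  also have "\<dots> = complex_of_real q * B p a (S (u a j)) + nu q * (\<Sum>s\<in>{a<..N}. B p s (S (u s j)))"
  proof -
    have "{1..N} \<inter> {a<..N} = {a<..N}" using assms by auto
    then have "(\<Sum>s\<in>{1..N}. if s \<in> {a<..N} then nu q * B p s (S (u s j)) else 0)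
        = (\<Sum>s\<in>{a<..N}. nu q * B p s (S (u s j)))"
      using sum.inter_restrict[of "{1..N}" "\<lambda>s. nu q * B p s (S (u s j))" "{a<..N}"] by (simp only: finite_atLeastAtMost)
    then show ?thesis
      using assms by (simp add: sum.distrib sum_distrib_left del: greaterThanAtMost_iff)
  qed
  finally show ?thesis using q'_nz by (auto simp: field_simps split: if_splits)
qed

text \<open>The matrix \<open>Q(u\<^sup>i\<^sub>1 S(u\<^sup>1\<^sub>i))\<close> is \<open>kappa i * inverse q' * nu q\<close> times the diagonal matrix unit at \<open>i\<close>
  for \<open>i \<ge> 2\<close>.\<close>

definition kappa :: "nat \<Rightarrow> complex" where
  "kappa l = B l 1 (S (u 1 l))"

text \<open>With T_a the tail sum from a, the left side of \<open>B_antipode_eq\<close> is q T_a -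
  (q - nu) T_(a+1), and q - nu = 1/q. This turns the system into a two-term recursion.\<close>

lemma B_antipode_tail:
  assumes "p \<in> {1..N}" "a \<in> {1..N}" "j \<in> {1..N}"
  shows "complex_of_real q * (\<Sum>s\<in>{a..N}. B p s (S (u s j)))
    = (if a = j \<and> p = a then q' else 0) + inverse (complex_of_real q) * (\<Sum>s\<in>{Suc a..N}. B p s (S (u s j)))"
proof -
  have "{a..N} = insert a {Suc a..N}" "{a<..N} = {Suc a..N}" using assms by auto
  then have "complex_of_real q * (\<Sum>s\<in>{a..N}. B p s (S (u s j)))
     = (complex_of_real q * B p a (S (u a j)) + nu q * (\<Sum>s\<in>{a<..N}. B p s (S (u s j))))
       + (complex_of_real q - nu q) * (\<Sum>s\<in>{Suc a..N}. B p s (S (u s j)))"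
    by (simp add: algebra_simps)
  then show ?thesis unfolding B_antipode_eq[OF assms] by (simp add: nu_def)
qed

text \<open>For p different from j the recursion has no source term. Starting from the empty tail at
  N + 1, all tails vanish, and the equation at a = 1 leaves only the wanted entry.\<close>

lemma B_antipode_zero:
  assumes "p \<in> {1..N}" "j \<in> {1..N}" "p \<noteq> j"
  shows "B p 1 (S (u 1 j)) = 0"
proof -
  have *: "(\<Sum>s\<in>{a..N}. B p s (S (u s j))) = 0" if "a \<le> Suc N" "1 \<le> a" for a
    using that
  proof (induction rule: inc_induct)
    case (step a)
    then show ?case using B_antipode_tail[of p a j] assms q by (auto split: if_splits)
  qed simp
  have "{1<..N} = {2..N}" by auto
  then show ?thesis using B_antipode_eq[OF assms(1) one_in assms(2)] *[of 2] assms N q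
    by (auto split: if_splits)
qed

text \<open>For p = j = l the source sits at a = l: the tails vanish above l, are nonzero at l, and
  each step down multiplies them by q^(-2). The equation at a = 1 then reads q kappa = q' if l = 1,
  and q kappa = -nu s(2) with nonzero s(2) if l >= 2.\<close>

lemma kappa_nonzero:
  assumes "l \<in> {1..N}" "l = 1 \<or> nu q \<noteq> 0"
  shows "kappa l \<noteq> 0"
proof -
  define s where "s a = (\<Sum>s\<in>{a..N}. B l s (S (u s l)))" for a
  have tail: "complex_of_real q * s a = (if a = l then q' else 0) + inverse (complex_of_real q) * s (Suc a)"
    if "a \<in> {1..N}" for a
    using B_antipode_tail[OF assms(1) that assms(1)] by (auto simp: s_def split: if_splits)
  have zero: "s a = 0" if "a \<le> Suc N" "l < a" for a
    using that
  proof (induction rule: inc_induct)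
    case (step a)
    then show ?case using tail[of a] assms q by auto
  qed (simp add: s_def)
  have nz: "s a \<noteq> 0" if "a \<le> l" "1 \<le> a" for a
    using that
  proof (induction rule: inc_induct)
    case base
    then show ?case using tail[of l] zero[of "Suc l"] assms q q'_nz by auto
  next
    case (step a)
    then show ?case using tail[of a] assms q by auto
  qed
  have "{1<..N} = {2..N}" by auto
  then have eq: "complex_of_real q * kappa l + nu q * s 2 = (if 1 = l then q' else 0)"
    using B_antipode_eq[OF assms(1) one_in assms(1)] by (auto simp: kappa_def s_def split: if_splits)
  show ?thesis
  proof (cases "l = 1")
    case True
    then show ?thesis using eq zero[of 2] N q'_nz by auto
  next
    case False
    then show ?thesis using eq nz[of 2] assms by auto
  qed
qed

text \<open>In the coproduct of S(u^1_l), with terms S(u^n_l) and S(u^1_n), only n = 1 contributes,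
  because A(S(u^1_n)) = 0 otherwise; A(S(u^1_1)) is diagonal.\<close>

lemma Q_uS:
  assumes "p \<in> {1..N}" "s \<in> {1..N}" "k \<in> {1..N}" "l \<in> {1..N}"
  shows "Q p s (u k 1 * S (u 1 l))
    = (\<Sum>i\<in>{1..N}. B p i (S (u 1 l)) * Q i s (u k 1)) * A s s (S (u 1 1))"
proof -
  have "Q p s (u k 1 * S (u 1 l)) = (\<Sum>n\<in>{1..N}. \<Sum>i\<in>{1..N}. \<Sum>j\<in>{1..N}.
      B p i (S (u n l)) * Q i j (u k 1) * A j s (S (u 1 n)))"
    unfolding Q_mult[OF assms(1,2)]
    by (rule sweedler2_antipode_u) (intro assms one_in clinear_intros)+
  also have "\<dots> = (\<Sum>i\<in>{1..N}. \<Sum>j\<in>{1..N}. B p i (S (u 1 l)) * Q i j (u k 1) * A j s (S (u 1 1)))"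
    by (rule sum_at_one) (use assms in \<open>simp add: A_antipode\<close>)
  also have "\<dots> = (\<Sum>i\<in>{1..N}. \<Sum>j\<in>{1..N}. if j = s then B p i (S (u 1 l)) * Q i s (u k 1) * A s s (S (u 1 1)) else 0)"
    using assms one_in by (intro sum.cong refl) (auto simp: A_antipode)
  also have "\<dots> = (\<Sum>i\<in>{1..N}. B p i (S (u 1 l)) * Q i s (u k 1)) * A s s (S (u 1 1))"
    using assms by (simp add: sum_distrib_right)
  finally show ?thesis .
qed

lemma Q_uS_plus:
  assumes "p \<in> {1..N}" "s \<in> {1..N}" "k \<in> {1..N}" "l \<in> {1..N}" "k \<noteq> 1"
  shows "Q p s (u k 1 * S (u 1 l)) = (if p = l \<and> s = k then kappa l * inverse q' * nu q else 0)"
proof -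
  have *: "(\<Sum>i\<in>{1..N}. B p i (S (u 1 l)) * Q i s (u k 1)) = B p 1 (S (u 1 l)) * Q 1 s (u k 1)"
    by (rule sum_at_one) (use assms one_in in \<open>auto simp: Q_u\<close>)
  show ?thesis
    unfolding Q_uS[OF assms(1-4)] * using assms one_in q'_nz
    by (auto simp: Q_u A_antipode B_antipode_zero kappa_def power2_eq_square)
qed

lemma Q_uS_minus:
  assumes "p \<in> {1..N}" "l \<in> {1..N}"
  shows "Q p 1 (u 1 1 * S (u 1 l)) = (if p = l then kappa l * inverse q' * complex_of_real q else 0)"
proof -
  have *: "(\<Sum>i\<in>{1..N}. B p i (S (u 1 l)) * Q i 1 (u 1 1)) = B p 1 (S (u 1 l)) * Q 1 1 (u 1 1)"
    by (rule sum_at_one) (use assms one_in in \<open>auto simp: Q_u\<close>)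
  show ?thesis
    unfolding Q_uS[OF assms(1) one_in one_in assms(2)] * using assms one_in q'_nz q
    by (auto simp: Q_u A_antipode B_antipode_zero kappa_def power2_eq_square field_simps)
qed

lemma Q_uS_minus_row:
  assumes "s \<in> {1..N}" "l \<in> {1..N}" "s \<noteq> 1"
  shows "Q 1 s (u 1 1 * S (u 1 l)) = 0"
proof -
  have "(\<Sum>i\<in>{1..N}. B 1 i (S (u 1 l)) * Q i s (u 1 1)) = B 1 1 (S (u 1 l)) * Q 1 s (u 1 1)"
    by (rule sum_at_one) (use assms one_in in \<open>auto simp: B_triangular\<close>)
  then show ?thesis
    unfolding Q_uS[OF one_in assms(1) one_in assms(2)] using assms one_in by (simp add: Q_u)
qed

section \<open>Degenerate parameters\<close>

lemma nu_eq_0: "nu q = 0 \<Longrightarrow> q = 1"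
proof -
  assume "nu q = 0"
  then have "q * q = 1" using q by (simp add: nu_def field_simps flip: of_real_mult)
  then show "q = 1" using q by (metis abs_of_pos abs_square_eq_1 power2_eq_square)
qed

text \<open>At q = 1 the matrix R is the flip, so A and B are scalar matrices on the generators,
  hence on all of G.\<close>

lemma Q_scalar:
  assumes "nu q = 0" "k \<in> {1..N}" "l \<in> {1..N}"
  shows "Q k l h = (if k = l then Q 1 1 h else 0)"
proof -
  note q1 = nu_eq_0[OF assms(1)]
  \<comment> \<open>The scalar depends on h and is explicit only on generators, so it is quantified
    existentially and afterwards read off from the entry (1,1).\<close>
  have "\<exists>c. \<forall>k\<in>{1..N}. \<forall>l\<in>{1..N}. A k l h = (if k = l then c else 0)" for h
  proof (induction h rule: generators_induct)
    case one
    show ?case by (rule exI[of _ 1]) (auto simp: A_one)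
  next
    case (gen i j)
    then show ?case
      by (intro exI[of _ "if i = j then inverse q' else 0"]) (auto simp: A_u q1 nu_def)
  next
    case (mult f g)
    then obtain a b where a: "\<And>k l. k \<in> {1..N} \<Longrightarrow> l \<in> {1..N} \<Longrightarrow> A k l f = (if k = l then a else 0)"
      and b: "\<And>k l. k \<in> {1..N} \<Longrightarrow> l \<in> {1..N} \<Longrightarrow> A k l g = (if k = l then b else 0)" by blast
    have "A k l (f * g) = (if k = l then a * b else 0)" if "k \<in> {1..N}" "l \<in> {1..N}" for k l
    proof -
      have "A k l (f * g) = (\<Sum>m\<in>{1..N}. if m = k then if k = l then a * b else 0 else 0)"
        unfolding A_mult[OF that] by (intro sum.cong refl) (use a b that in auto)
      then show ?thesis using that by simp
    qed
    then show ?case by blast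
  next
    case (add f g)
    then obtain a b where "\<forall>k\<in>{1..N}. \<forall>l\<in>{1..N}. A k l f = (if k = l then a else 0)"
      "\<forall>k\<in>{1..N}. \<forall>l\<in>{1..N}. A k l g = (if k = l then b else 0)" by blast
    then show ?case
      by (intro exI[of _ "a + b"]) (auto simp: tensor_add_left clinearD[OF clinear_r])
  next
    case (scale c f)
    then obtain a where "\<forall>k\<in>{1..N}. \<forall>l\<in>{1..N}. A k l f = (if k = l then a else 0)" by blast
    then show ?case
      by (intro exI[of _ "c *\<^sub>C a"]) (auto simp: tensor_scale_left clinearD[OF clinear_r])
  qed
  then have A: "A k l h = (if k = l then A 1 1 h else 0)" if "k \<in> {1..N}" "l \<in> {1..N}" for k l h
    using that one_in by (metis (no_types, lifting))
  have "\<exists>c. \<forall>k\<in>{1..N}. \<forall>l\<in>{1..N}. B k l h = (if k = l then c else 0)" for h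
  proof (induction h rule: generators_induct)
    case one
    show ?case by (rule exI[of _ 1]) (auto simp: B_one)
  next
    case (gen i j)
    then show ?case
      by (intro exI[of _ "if i = j then inverse q' else 0"]) (auto simp: B_u q1 nu_def)
  next
    case (mult f g)
    then obtain a b where a: "\<And>k l. k \<in> {1..N} \<Longrightarrow> l \<in> {1..N} \<Longrightarrow> B k l f = (if k = l then a else 0)"
      and b: "\<And>k l. k \<in> {1..N} \<Longrightarrow> l \<in> {1..N} \<Longrightarrow> B k l g = (if k = l then b else 0)" by blast
    have "B k l (f * g) = (if k = l then a * b else 0)" if "k \<in> {1..N}" "l \<in> {1..N}" for k l
    proof -
      have "B k l (f * g) = (\<Sum>m\<in>{1..N}. if m = k then if k = l then a * b else 0 else 0)"
        unfolding B_mult[OF that] by (intro sum.cong refl) (use a b that in auto)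
      then show ?thesis using that by simp
    qed
    then show ?case by blast
  next
    case (add f g)
    then obtain a b where "\<forall>k\<in>{1..N}. \<forall>l\<in>{1..N}. B k l f = (if k = l then a else 0)"
      "\<forall>k\<in>{1..N}. \<forall>l\<in>{1..N}. B k l g = (if k = l then b else 0)" by blast
    then show ?case
      by (intro exI[of _ "a + b"]) (auto simp: tensor_add_right clinearD[OF clinear_r])
  next
    case (scale c f)
    then obtain a where "\<forall>k\<in>{1..N}. \<forall>l\<in>{1..N}. B k l f = (if k = l then a else 0)" by blast
    then show ?case
      by (intro exI[of _ "c *\<^sub>C a"]) (auto simp: tensor_scale_right clinearD[OF clinear_r])
  qed
  then have B: "B k l h = (if k = l then B 1 1 h else 0)" if "k \<in> {1..N}" "l \<in> {1..N}" for k l h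
    using that one_in by (metis (no_types, lifting))
  have "(\<lambda>a b. \<Sum>m\<in>{1..N}. B k m a * A m l b) = (\<lambda>a b. if k = l then B 1 1 a * A 1 1 b else 0)"
    if "k \<in> {1..N}" "l \<in> {1..N}" for k l
  proof (intro ext)
    fix a b
    have "(\<Sum>m\<in>{1..N}. B k m a * A m l b) = (\<Sum>m\<in>{1..N}. if m = k then B 1 1 a * A k l b else 0)"
    proof (intro sum.cong refl)
      fix m assume "m \<in> {1..N}"
      from B[OF that(1) this, of a]
      show "B k m a * A m l b = (if m = k then B 1 1 a * A k l b else 0)" by auto
    qed
    then show "(\<Sum>m\<in>{1..N}. B k m a * A m l b) = (if k = l then B 1 1 a * A 1 1 b else 0)"
      using that A[OF that, of b] by auto
  qed
  note * = this[OF assms(2,3)] this[OF one_in one_in]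
  show ?thesis unfolding Q_eq[OF assms(2,3)] Q_eq[OF one_in one_in] *
    by (simp add: sweedler2_zero)
qed

text \<open>The value of \<open>Q\<^sub>1\<^sub>1\<close> on \<open>u\<^sup>1\<^sub>1 - 1\<close>; it vanishes only if \<open>q = 1\<close> and \<open>q'\<^sup>2 = 1\<close>.\<close>

definition "weight = inverse q' ^ 2 * complex_of_real q ^ 2 - 1"

lemma chi_u:
  assumes "i \<in> {1..N}" "j \<in> {1..N}"
  shows "Q 1 1 (u i j) = (if i = j then if i = 1 then weight + 1 else inverse q' ^ 2 else 0)"
  using assms one_in by (auto simp: Q_u weight_def)

text \<open>A vanishing weight gives |q'| = q, hence q^N = q; since N >= 2 and q <= 1, this forces q
  = 1 and then q'^2 = 1. The character is now the counit on every generator.\<close>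

lemma chi_eq_counit: "weight = 0 \<Longrightarrow> Q 1 1 h = counit G h"
proof -
  assume w: "weight = 0"
  then have "q' ^ 2 = complex_of_real q ^ 2"
    using q'_nz by (simp add: weight_def field_simps)
  then have "norm q' ^ 2 = q ^ 2"
    using q by (metis norm_power norm_of_real of_real_power abs_of_nonneg zero_le_power less_imp_le)
  then have "norm q' = q" using q by (simp add: power2_eq_iff_nonneg)
  then have "q ^ N = q" using q' q by (metis norm_power norm_of_real abs_of_pos)
  moreover have "q ^ N \<le> q ^ 2" using N q by (intro power_decreasing) auto
  ultimately have "q = 1" using q by (simp add: power2_eq_square)
  then have "inverse q' ^ 2 = 1" using w unfolding weight_def by simp
  with w show "Q 1 1 h = counit G h"
    by (induction h rule: generators_induct)
      (simp_all add: chi_u counit_u counit_simps calgebra_homD(2,3)[OF chi_hom]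
        clinearD[OF clinear_Q] clinearD[OF clinear_counit])
qed

text \<open>The generators added to ker Q fill the block with indices 2..N: the u^i_1 S(u^1_i) give
  its diagonal matrix units and the u^i_j the others, as long as nu is nonzero. For nu = 0 the
  matrix Q(v) is scalar, so the vanishing of its entry (1,1) already puts v into ker Q.\<close>

lemma I_SU_eq: "I_SU N G r = {v \<in> aug G. \<forall>m\<in>{1..N}. Q 1 m v = 0 \<and> Q m 1 v = 0}" (is "_ = ?K")
proof (intro equalityI subsetI)
  have K: "complex_vector.subspace ?K"
    by (auto simp: complex_vector.subspace_def aug_def clinearD[OF clinear_Q] clinearD[OF clinear_counit])
  fix v assume "v \<in> I_SU N G r"
  then obtain x y z where v: "v = x + y + z" "x \<in> kerQ N G r \<inter> aug G"
      "y \<in> cspan {u i 1 * S (u 1 i) | i. i \<in> {2..N}}"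
      "z \<in> cspan {u i j | i j. i \<in> {2..N} \<and> j \<in> {2..N} \<and> i \<noteq> j}"
    unfolding I_SU_def by blast
  have x: "x \<in> ?K" using v(2) one_in by (auto simp: kerQ_def)
  have "{u i 1 * S (u 1 i) | i. i \<in> {2..N}} \<subseteq> ?K"
    using one_in by (auto simp: aug_def counit_simps counit_u Q_uS_plus)
  then have y: "y \<in> ?K" using v(3) complex_vector.span_minimal[OF _ K] by blast
  have "{u i j | i j. i \<in> {2..N} \<and> j \<in> {2..N} \<and> i \<noteq> j} \<subseteq> ?K"
    using one_in by (auto simp: aug_def counit_u Q_u)
  then have z: "z \<in> ?K" using v(4) complex_vector.span_minimal[OF _ K] by blast
  show "v \<in> ?K" unfolding v(1) by (intro complex_vector.subspace_add[OF K] x y z)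
next
  fix v assume v: "v \<in> ?K"
  show "v \<in> I_SU N G r"
  proof (cases "nu q = 0")
    case True
    have "Q k l v = 0" if "k \<in> {1..N}" "l \<in> {1..N}" for k l
      using Q_scalar[OF True that, of v] v one_in by (auto split: if_splits)
    then have "v \<in> kerQ N G r \<inter> aug G" using v by (simp add: kerQ_def)
    then show ?thesis unfolding I_SU_def
      by (intro CollectI exI[of _ v] exI[of _ 0]) (simp add: complex_vector.span_zero)
  next
    case False
    \<comment> \<open>The divisors are the scalars of \<open>Q_uS_plus\<close> and
      \<open>Q_u\<close>, so that y reproduces the diagonal of the block and z the rest of it. The
      indices in z are crossed because u^i_j goes to the matrix unit at (j,i).\<close>
    define y where "y = (\<Sum>i\<in>{2..N}. (Q i i v / (kappa i * inverse q' * nu q)) *\<^sub>C (u i 1 * S (u 1 i)))"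
    define z where "z = (\<Sum>i\<in>{2..N}. \<Sum>j\<in>{2..N} - {i}. (Q j i v / (inverse q' ^ 2 * nu q)) *\<^sub>C u i j)"
    have y: "y \<in> cspan {u i 1 * S (u 1 i) | i. i \<in> {2..N}}" unfolding y_def
      by (intro complex_vector.span_sum complex_vector.span_scale complex_vector.span_base) auto
    have z: "z \<in> cspan {u i j | i j. i \<in> {2..N} \<and> j \<in> {2..N} \<and> i \<noteq> j}" unfolding z_def
      by (intro complex_vector.span_sum complex_vector.span_scale complex_vector.span_base) auto
    have Qy: "Q k l y = (if k = l \<and> k \<in> {2..N} then Q k k v else 0)" if "k \<in> {1..N}" "l \<in> {1..N}" for k l
    proof -
      have "Q k l y = (\<Sum>i\<in>{2..N}. Q i i v / (kappa i * inverse q' * nu q) * Q k l (u i 1 * S (u 1 i)))"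
        by (simp add: y_def clinear_map_sum[OF clinear_Q] clinearD[OF clinear_Q] scaleC_complex_def)
      also have "\<dots> = (\<Sum>i\<in>{2..N}. if i = k then if k = l then Q k k v else 0 else 0)"
        using that kappa_nonzero q'_nz False by (intro sum.cong refl) (auto simp: Q_uS_plus)
      finally show ?thesis by auto
    qed
    have Qz: "Q k l z = (if k \<noteq> l \<and> k \<in> {2..N} \<and> l \<in> {2..N} then Q k l v else 0)"
      if "k \<in> {1..N}" "l \<in> {1..N}" for k l
    proof -
      have "Q k l z = (\<Sum>i\<in>{2..N}. \<Sum>j\<in>{2..N} - {i}. Q j i v / (inverse q' ^ 2 * nu q) * Q k l (u i j))"
        by (simp add: z_def clinear_map_sum[OF clinear_Q] clinearD[OF clinear_Q] scaleC_complex_def)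
      also have "\<dots> = (\<Sum>i\<in>{2..N}. \<Sum>j\<in>{2..N} - {i}. if j = k then if i = l then Q k l v else 0 else 0)"
        using that q'_nz False by (intro sum.cong refl) (auto simp: Q_u)
      also have "\<dots> = (\<Sum>i\<in>{2..N}. if i = l then if k \<in> {2..N} - {l} then Q k l v else 0 else 0)"
        by (intro sum.cong refl) auto
      finally show ?thesis by auto
    qed
    have "Q k l (v - y - z) = 0" if "k \<in> {1..N}" "l \<in> {1..N}" for k l
      using v that by (cases "k = 1"; cases "l = 1") (auto simp: clinearD[OF clinear_Q] Qy Qz)
    moreover have "counit G (v - y - z) = 0"
    proof -
      have "counit G y = 0" unfolding y_def
        by (auto simp: clinear_map_sum[OF clinear_counit] clinearD[OF clinear_counit] counit_simps counit_u
            intro!: sum.neutral)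
      moreover have "counit G z = 0" unfolding z_def
        by (auto simp: clinear_map_sum[OF clinear_counit] clinearD[OF clinear_counit] counit_u
            intro!: sum.neutral)
      ultimately show ?thesis using v by (simp add: clinearD[OF clinear_counit] aug_def)
    qed
    ultimately have "v - y - z \<in> kerQ N G r \<inter> aug G" by (auto simp: kerQ_def aug_def)
    with y z show ?thesis unfolding I_SU_def
      by (intro CollectI exI[of _ "v - y - z"] exI[of _ y] exI[of _ z]) auto
  qed
qed

text \<open>These vanish on \<open>I\<close> and are the coordinates with respect to \<open>e\<^sup>+\<close>, \<open>e\<^sup>-\<close>, \<open>e\<^sup>0\<close>.
  For \<open>q = 1\<close> the coefficient \<open>inverse (nu q)\<close> is \<open>0\<close>, and so are the functionals it multiplies;
  the same convention covers \<open>weight = 0\<close>.\<close>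

definition coord_plus :: "nat \<Rightarrow> 'a \<Rightarrow> complex" where
  "coord_plus m v = q' ^ 2 * inverse (nu q) * Q 1 m v"

definition coord_minus :: "nat \<Rightarrow> 'a \<Rightarrow> complex" where
  "coord_minus m v = q' ^ 2 * inverse (nu q) * Q m 1 v"

definition coord_zero :: "'a \<Rightarrow> complex" where
  "coord_zero v = inverse weight * (Q 1 1 v - counit G v)"

lemma clinear_coord [clinear_intros]:
  "clinear f \<Longrightarrow> clinear (\<lambda>x. coord_plus m (f x))" "clinear f \<Longrightarrow> clinear (\<lambda>x. coord_minus m (f x))"
  "clinear f \<Longrightarrow> clinear (\<lambda>x. coord_zero (f x))"
  unfolding coord_plus_def coord_minus_def coord_zero_def
  by (intro clinear_intros; assumption)+

text \<open>By \<open>I_SU_eq\<close>, only row 1 and column 1 of Q and the counit have to be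
  compared. There Q(u^m_1) contributes only at (1,m), Q(u^1_m) only at (m,1), and the diagonal
  matrix Q(u^1_1 - 1) only at (1,1), so each entry is matched separately.\<close>

lemma coord_decomposition:
  assumes "v \<in> aug G"
  shows "v - (coord_zero v *\<^sub>C (u 1 1 - 1) + (\<Sum>m\<in>{2..N}. coord_plus m v *\<^sub>C u m 1)
    + (\<Sum>m\<in>{2..N}. coord_minus m v *\<^sub>C u 1 m)) \<in> I_SU N G r" (is "?v' \<in> _")
proof -
  have eps: "counit G v = 0" using assms by (simp add: aug_def)
  \<comment> \<open>If nu is 0, the coefficients of e^+ and e^- are 0 by the convention on
    \<open>inverse\<close>, and so are the entries they have to match.\<close>
  have off: "nu q \<noteq> 0 \<or> Q 1 m v = 0 \<and> Q m 1 v = 0" if "m \<in> {2..N}" for m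
    using that Q_scalar[OF _ one_in, of m v] Q_scalar[OF _ _ one_in, of m v] by auto
  have Q': "Q k l ?v' = Q k l v - (coord_zero v * (Q k l (u 1 1) - Q k l 1)
      + (\<Sum>m\<in>{2..N}. coord_plus m v * Q k l (u m 1)) + (\<Sum>m\<in>{2..N}. coord_minus m v * Q k l (u 1 m)))" for k l
    by (simp add: clinear_map_sum[OF clinear_Q] clinearD[OF clinear_Q] scaleC_complex_def)
  have "Q 1 1 ?v' = 0"
  proof -
    have "Q 1 1 v = coord_zero v * weight"
      using chi_eq_counit[of v] eps by (cases "weight = 0") (auto simp: coord_zero_def)
    then show ?thesis unfolding Q' using one_in by (simp add: chi_u Q_one)
  qed
  moreover have "Q 1 s ?v' = 0" if "s \<in> {2..N}" for s
  proof -
    have "(\<Sum>m\<in>{2..N}. coord_plus m v * Q 1 s (u m 1))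
        = (\<Sum>m\<in>{2..N}. if m = s then coord_plus s v * (inverse q' ^ 2 * nu q) else 0)"
      using that one_in by (intro sum.cong refl) (auto simp: Q_u)
    moreover have "(\<Sum>m\<in>{2..N}. coord_minus m v * Q 1 s (u 1 m)) = 0"
      using that one_in by (intro sum.neutral) (auto simp: Q_u)
    ultimately show ?thesis unfolding Q' using that one_in off[OF that] q'_nz
      by (auto simp: Q_u Q_one coord_plus_def field_simps)
  qed
  moreover have "Q s 1 ?v' = 0" if "s \<in> {2..N}" for s
  proof -
    have "(\<Sum>m\<in>{2..N}. coord_minus m v * Q s 1 (u 1 m))
        = (\<Sum>m\<in>{2..N}. if m = s then coord_minus s v * (inverse q' ^ 2 * nu q) else 0)"
      using that one_in by (intro sum.cong refl) (auto simp: Q_u)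
    moreover have "(\<Sum>m\<in>{2..N}. coord_plus m v * Q s 1 (u m 1)) = 0"
      using that one_in by (intro sum.neutral) (auto simp: Q_u)
    ultimately show ?thesis unfolding Q' using that one_in off[OF that] q'_nz
      by (auto simp: Q_u Q_one coord_minus_def field_simps)
  qed
  ultimately have "\<forall>m\<in>insert 1 {2..N}. Q 1 m ?v' = 0 \<and> Q m 1 ?v' = 0" by blast
  moreover have "insert 1 {2..N} = {1..N}" using N by auto
  moreover have "counit G ?v' = 0"
  proof -
    have "counit G ?v' = counit G v - (coord_zero v * (counit G (u 1 1) - counit G 1)
      + (\<Sum>m\<in>{2..N}. coord_plus m v * counit G (u m 1)) + (\<Sum>m\<in>{2..N}. coord_minus m v * counit G (u 1 m)))"
      by (simp add: clinear_map_sum[OF clinear_counit] clinearD[OF clinear_counit] scaleC_complex_def)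
    moreover have "(\<Sum>m\<in>{2..N}. coord_plus m v * counit G (u m 1)) = 0"
      "(\<Sum>m\<in>{2..N}. coord_minus m v * counit G (u 1 m)) = 0"
      using one_in by (auto simp: counit_u intro!: sum.neutral)
    ultimately show ?thesis using eps one_in by (simp add: counit_u counit_simps)
  qed
  ultimately show ?thesis unfolding I_SU_eq aug_def by (simp only: mem_Collect_eq)
qed

end

section \<open>The bundle over quantum projective space\<close>

lemma quantum_SU_matrix_hopf:
  assumes "quantum_SU n q G"
  shows "matrix_hopf n G"
proof
  show "hopf_algebra G" "matrix_coalgebra n G" using assms by (auto simp: quantum_SU_def)
  let ?\<phi> = "\<lambda>x. case x of Mat i j \<Rightarrow> mat G i j | DetInv \<Rightarrow> 1"
  fix h
  have word: "\<exists>I J. prod_list (map ?\<phi> xs) = mword (mat G) I J \<and> I \<in> multi_indices n (length xs)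
      \<and> J \<in> multi_indices n (length xs)" if "xs \<in> lists (mat_gens n)" for xs
    using that
  proof (induction xs)
    case (Cons x xs)
    then obtain I J i j where "prod_list (map ?\<phi> xs) = mword (mat G) I J"
        "I \<in> multi_indices n (length xs)" "J \<in> multi_indices n (length xs)"
        "x = Mat i j" "i \<in> {1..n}" "j \<in> {1..n}"
      by (auto simp: mat_gens_def)
    then show ?case by (intro exI[of _ "i # I"] exI[of _ "j # J"]) (auto simp: multi_indices_def)
  qed simp
  have sub: "{prod_list (map ?\<phi> xs) |xs. xs \<in> lists (mat_gens n)}
     \<subseteq> {mword (mat G) I J | I J m. I \<in> multi_indices n m \<and> J \<in> multi_indices n m}"
    using word by blast
  show "h \<in> cspan {mword (mat G) I J | I J m. I \<in> multi_indices n m \<and> J \<in> multi_indices n m}"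
    using assms
    by (intro subsetD[OF complex_vector.span_mono[OF sub]] presented_by_span) (auto simp: quantum_SU_def)
qed

lemma perm_length_id: "perm_length n id = 0"
proof -
  have "{(i, j). 1 \<le> i \<and> i < j \<and> j \<le> n \<and> id j < id i} = {}" by auto
  then show ?thesis by (simp only: perm_length_def card.empty)
qed

text \<open>A permutation other than the identity moves some index, which puts an off-diagonal
  factor 0 into its product. The identity has length 0 and contributes with coefficient 1.\<close>

lemma qdet_diagonal:
  fixes f :: "'b::complex_algebra_1 \<Rightarrow> complex"
  assumes f: "calgebra_hom f" and u: "\<And>i j. f (v i j) = (if i = j then t else 0)"
  shows "f (qdet n q v) = t ^ n"
proof -
  have "f (qdet n q v) = (\<Sum>\<pi> | \<pi> permutes {1..n}.
      (- complex_of_real q) ^ perm_length n \<pi> * prod_list (map (\<lambda>i. f (v i (\<pi> i))) [1..<Suc n]))"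
    by (simp add: qdet_def clinear_map_sum[OF calgebra_homD(1)[OF f]] clinearD[OF calgebra_homD(1)[OF f]]
        calgebra_hom_prod_list[OF f] scaleC_complex_def comp_def del: upt_Suc)
  also have "\<dots> = (\<Sum>\<pi>\<in>{id}.
      (- complex_of_real q) ^ perm_length n \<pi> * prod_list (map (\<lambda>i. f (v i (\<pi> i))) [1..<Suc n]))"
  proof (rule sum.mono_neutral_right)
    show "finite {\<pi>. \<pi> permutes {1..n}}" by (simp add: finite_permutations)
    show "{id} \<subseteq> {\<pi>. \<pi> permutes {1..n}}" by (simp add: permutes_id)
    show "\<forall>\<pi>\<in>{\<pi>. \<pi> permutes {1..n}} - {id}.
      (- complex_of_real q) ^ perm_length n \<pi> * prod_list (map (\<lambda>i. f (v i (\<pi> i))) [1..<Suc n]) = 0"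
    proof
      fix \<pi> assume \<pi>: "\<pi> \<in> {\<pi>. \<pi> permutes {1..n}} - {id}"
      then obtain i where "\<pi> i \<noteq> i" by (metis DiffD2 eq_id_iff singletonI)
      moreover from this \<pi> have "i \<in> {1..n}" by (auto simp: permutes_def)
      ultimately have "0 \<in> set (map (\<lambda>i. f (v i (\<pi> i))) [1..<Suc n])"
        by (auto simp: u image_iff intro!: bexI[of _ i] simp del: upt_Suc)
      then have "prod_list (map (\<lambda>i. f (v i (\<pi> i))) [1..<Suc n]) = 0"
        by (subst prod_list_zero_iff)
      then show "(- complex_of_real q) ^ perm_length n \<pi> * prod_list (map (\<lambda>i. f (v i (\<pi> i))) [1..<Suc n]) = 0"
        by (simp only: mult_zero_right)
    qed
  qed
  also have "\<dots> = prod_list (map (\<lambda>i. t) [1..<Suc n])"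
    by (simp add: u perm_length_id del: upt_Suc)
  also have "\<dots> = t ^ n"
    by (simp only: map_replicate_const length_upt prod_list_replicate) simp
  finally show ?thesis .
qed

locale projective_bundle = coquasi_triangular_SU N G q q' r
  for N :: nat and G :: "('a::complex_algebra_1, 'm) qgroup_scheme" and q q' r +
  fixes H :: "('b::complex_algebra_1, 'n) qgroup_scheme" and detinv :: 'b and \<alpha> :: "'a \<Rightarrow> 'b"
    and clG :: "'a \<Rightarrow> 'l::complex_vector" and clH :: "'b \<Rightarrow> 'k::complex_vector"
  assumes SU: "quantum_SU N q G" and U: "quantum_U (N - 1) q H detinv"
    and alpha: "quantum_alpha N G H detinv \<alpha>"
    and clG: "quotient_map clG (aug G) (I_SU N G r)"
    and clH: "quotient_map clH (aug H) (\<alpha> ` I_SU N G r)"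
begin

section \<open>The Hopf algebra map onto the fibre\<close>

lemma alpha_hom: "calgebra_hom \<alpha>"
  and comult_alpha: "comult H (\<alpha> x) = tmap \<alpha> \<alpha> (comult G x)"
  and counit_alpha: "counit H (\<alpha> x) = counit G x"
  and antipode_alpha: "antipode H (\<alpha> x) = \<alpha> (S x)"
  and alpha_11: "\<alpha> (u 1 1) = detinv"
  and alpha_1i: "i \<in> {2..N} \<Longrightarrow> \<alpha> (u 1 i) = 0"
  and alpha_i1: "i \<in> {2..N} \<Longrightarrow> \<alpha> (u i 1) = 0"
  and alpha_ij: "i \<in> {2..N} \<Longrightarrow> j \<in> {2..N} \<Longrightarrow> \<alpha> (u i j) = mat H (i - 1) (j - 1)"
  using alpha by (auto simp: quantum_alpha_def hopf_algebra_hom_def)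

lemmas clinear_alpha = calgebra_homD(1)[OF alpha_hom]
lemmas alpha_simps = calgebra_homD(2,3)[OF alpha_hom] clinearD[OF clinear_alpha]

lemma clinear_alpha' [clinear_intros]: "clinear f \<Longrightarrow> clinear (\<lambda>x. \<alpha> (f x))"
  by (rule clinear_compose[OF clinear_alpha])

lemma hopf_H: "hopf_algebra H"
  using U by (simp add: quantum_U_def)

lemma antipode_H_0: "antipode H 0 = 0"
  using hopf_H by (simp add: hopf_algebra_def clinear_0)

lemma clinear_counit_H: "clinear (counit H)"
  using hopf_H by (simp add: hopf_algebra_def calgebra_hom_def)

lemma alpha_S_1i: "i \<in> {2..N} \<Longrightarrow> \<alpha> (S (u 1 i)) = 0"
  and alpha_S_i1: "i \<in> {2..N} \<Longrightarrow> \<alpha> (S (u i 1)) = 0"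
  by (simp_all add: alpha_1i alpha_i1 antipode_H_0 flip: antipode_alpha)

lemma in_2N: "i \<in> {1..N} \<Longrightarrow> i \<noteq> 1 \<Longrightarrow> i \<in> {2..N}"
  by auto

lemma detinv_inverse: "detinv * \<alpha> (S (u 1 1)) = 1"
proof -
  \<comment> \<open>The image of u is block diagonal, so only k = 1 survives in the first diagonal
    entry of u S(u) = 1.\<close>
  have "1 = \<alpha> (\<Sum>k\<in>{1..N}. u 1 k * S (u k 1))" using antipode_u(2)[OF one_in one_in] by (simp add: alpha_simps)
  also have "\<dots> = (\<Sum>k\<in>{1..N}. \<alpha> (u 1 k) * \<alpha> (S (u k 1)))"
    by (simp add: clinear_map_sum[OF clinear_alpha] alpha_simps)
  also have "\<dots> = \<alpha> (u 1 1) * \<alpha> (S (u 1 1))"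
    by (rule sum_at_one) (use in_2N in \<open>simp add: alpha_1i\<close>)
  finally show ?thesis by (simp add: alpha_11)
qed

text \<open>Every generator of H is hit: \<open>detinv\<close> by u^1_1, and the matrix entries by
  those of G with both indices raised by one. This allows statements about H to be proved on
  G.\<close>

lemma alpha_surj: obtains v where "h = \<alpha> v"
proof -
  let ?\<phi> = "\<lambda>x. case x of Mat i j \<Rightarrow> mat H i j | DetInv \<Rightarrow> detinv"
  have "h \<in> cspan {prod_list (map ?\<phi> xs) | xs. xs \<in> lists (insert DetInv (mat_gens (N - 1)))}"
    using U by (intro presented_by_span) (auto simp: quantum_U_def)
  then have "h \<in> range \<alpha>"
  proof (rule complex_vector.span_induct[where P = "\<lambda>h. h \<in> range \<alpha>"])
    show "complex_vector.subspace {h. h \<in> range \<alpha>}"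
      unfolding complex_vector.subspace_def
    proof (safe, goal_cases)
      case 1
      show ?case by (rule image_eqI[of _ _ 0]) (simp_all add: alpha_simps)
    next
      case (2 _ _ a b)
      show ?case by (rule image_eqI[of _ _ "a + b"]) (simp_all add: alpha_simps)
    next
      case (3 c _ a)
      show ?case by (rule image_eqI[of _ _ "c *\<^sub>C a"]) (simp_all add: alpha_simps)
    qed
    fix x assume "x \<in> {prod_list (map ?\<phi> xs) | xs. xs \<in> lists (insert DetInv (mat_gens (N - 1)))}"
    then obtain xs where "xs \<in> lists (insert DetInv (mat_gens (N - 1)))" "x = prod_list (map ?\<phi> xs)"
      by blast
    then show "x \<in> range \<alpha>"
    proof (induction xs arbitrary: x rule: list.induct)
      case Nil
      then show ?case by (intro image_eqI[of _ _ 1]) (simp_all add: alpha_simps)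
    next
      case (Cons y ys)
      have "?\<phi> y \<in> range \<alpha>"
      proof (cases y)
        case (Mat i j)
        then have "i + 1 \<in> {2..N}" "j + 1 \<in> {2..N}" using Cons.prems by (auto simp: mat_gens_def)
        then show ?thesis
          using alpha_ij[of "i + 1" "j + 1"] Mat by (intro image_eqI[of _ _ "u (i + 1) (j + 1)"]) simp_all
      next
        case DetInv
        then show ?thesis by (intro image_eqI[of _ _ "u 1 1"]) (simp_all add: alpha_11)
      qed
      moreover have "prod_list (map ?\<phi> ys) \<in> range \<alpha>" using Cons by auto
      ultimately obtain a b where "?\<phi> y = \<alpha> a" "prod_list (map ?\<phi> ys) = \<alpha> b" by blast
      then have "x = \<alpha> (a * b)" using Cons.prems(2) by (simp add: alpha_simps)
      then show ?case by blast
    qed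
  qed
  then show ?thesis using that by blast
qed

text \<open>A character of H is prescribed on generators with the values of Q_11 and agrees with it
  after composition with \<alpha>. The determinant relation becomes q'^(-2(N-1)) q^2 q'^(-2) =
  (q'^N)^(-2) q^2 = 1, which is the choice of q' as an N-th root of q.\<close>

lemma chi_factors: "\<exists>\<chi>. calgebra_hom \<chi> \<and> (\<forall>h. \<chi> (\<alpha> h) = Q 1 1 h)"
proof -
  let ?t = "inverse q' ^ 2"
  let ?\<psi> = "\<lambda>x. case x of Mat i j \<Rightarrow> if i = j then ?t else 0 | DetInv \<Rightarrow> weight + 1"
  let ?\<phi> = "\<lambda>x. case x of Mat i j \<Rightarrow> mat H i j | DetInv \<Rightarrow> detinv"
  have "?t ^ (N - 1) * (weight + 1) = (?t ^ (N - 1) * ?t) * complex_of_real q ^ 2"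
    by (simp add: weight_def)
  also have "\<dots> = ?t ^ N * complex_of_real q ^ 2"
    using N by (simp add: power_Suc2[symmetric] del: power_Suc)
  also have "\<dots> = inverse (q' ^ N) ^ 2 * complex_of_real q ^ 2"
    by (simp add: power_mult[symmetric] mult.commute power_inverse)
  also have "\<dots> = 1" using q by (simp add: q' flip: power_mult_distrib)
  finally have det: "?t ^ (N - 1) * (weight + 1) = 1" .
  have qd: "free_eval ?\<psi> (qdet (N - 1) q fmat) = ?t ^ (N - 1)"
    by (rule qdet_diagonal[OF free_eval_hom]) (simp add: free_eval_gen)
  have "free_eval ?\<psi> p = 0" if "p \<in> RTT_relators (N - 1) q" for p
  proof -
    from that obtain a b c d where p: "p = (\<Sum>w\<in>{1..N - 1}. \<Sum>x\<in>{1..N - 1}. Rmat q a c w x *\<^sub>C (fmat w b * fmat x d))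
      - (\<Sum>y\<in>{1..N - 1}. \<Sum>z\<in>{1..N - 1}. Rmat q y z b d *\<^sub>C (fmat a y * fmat c z))"
      and abcd: "a \<in> {1..N - 1}" "b \<in> {1..N - 1}" "c \<in> {1..N - 1}" "d \<in> {1..N - 1}"
      unfolding RTT_relators_def by blast
    \<comment> \<open>For a scalar matrix both sides of the RTT relation reduce to the same entry of
      R times the square of the scalar.\<close>
    have "free_eval ?\<psi> p =
        (\<Sum>w\<in>{1..N - 1}. \<Sum>x\<in>{1..N - 1}. if x = d then if w = b then Rmat q a c b d * (?t * ?t) else 0 else 0)
      - (\<Sum>y\<in>{1..N - 1}. \<Sum>z\<in>{1..N - 1}. if z = c then if y = a then Rmat q a c b d * (?t * ?t) else 0 else 0)"
      unfolding p clinearD(3)[OF clinear_free_eval] clinear_map_sum[OF clinear_free_eval]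
      by (intro arg_cong2[where f = "(-)"] sum.cong refl)
        (auto simp: clinearD[OF clinear_free_eval] free_eval_mult free_eval_gen scaleC_complex_def)
    also have "\<dots> = 0" using abcd by simp
    finally show ?thesis .
  qed
  then have rel: "free_eval ?\<psi> p = 0"
    if "p \<in> RTT_relators (N - 1) q \<union> {qdet (N - 1) q fmat * fdetinv - 1, fdetinv * qdet (N - 1) q fmat - 1}" for p
    using that det
    by (auto simp: clinearD(3)[OF clinear_free_eval] free_eval_mult free_eval_gen free_eval_one qd mult.commute)
  have "presented_by (insert DetInv (mat_gens (N - 1))) (RTT_relators (N - 1) q
      \<union> {qdet (N - 1) q fmat * fdetinv - 1, fdetinv * qdet (N - 1) q fmat - 1}) ?\<phi>"
    using U by (simp only: quantum_U_def)
  from presented_by_hom_exists[OF this rel] obtain \<chi>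
    where both: "calgebra_hom \<chi> \<and> (\<forall>x\<in>insert DetInv (mat_gens (N - 1)). \<chi> (?\<phi> x) = ?\<psi> x)" ..
  note \<chi> = conjunct1[OF both] bspec[OF conjunct2[OF both]]
  have "\<chi> (\<alpha> h) = Q 1 1 h" for h
  proof (rule presented_by_hom_eqI[where f = "\<lambda>h. \<chi> (\<alpha> h)" and g = "Q 1 1"])
    show "presented_by (mat_gens N) (RTT_relators N q \<union> {qdet N q fmat - 1})
       (\<lambda>x. case x of Mat i j \<Rightarrow> mat G i j | DetInv \<Rightarrow> 1)"
      using SU by (simp add: quantum_SU_def)
    show "calgebra_hom (\<lambda>h. \<chi> (\<alpha> h))"
      using \<chi>(1) by (auto simp: calgebra_hom_def alpha_simps intro: clinear_compose[OF _ clinear_alpha])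
    show "calgebra_hom (Q 1 1)" by (rule chi_hom)
    fix x assume "x \<in> mat_gens N"
    then obtain i j where x: "x = Mat i j" "i \<in> {1..N}" "j \<in> {1..N}" by (auto simp: mat_gens_def)
    have "\<chi> (\<alpha> (u i j)) = Q 1 1 (u i j)"
    proof (cases "i = 1"; cases "j = 1")
      assume "i = 1" "j = 1"
      then show ?thesis using \<chi>(2)[of DetInv] x by (simp add: alpha_11 chi_u)
    next
      assume "i \<noteq> 1" "j \<noteq> 1"
      then have ij: "i \<in> {2..N}" "j \<in> {2..N}" using x in_2N by auto
      then have "Mat (i - 1) (j - 1) \<in> mat_gens (N - 1)" by (auto simp: mat_gens_def)
      then have "\<chi> (mat H (i - 1) (j - 1)) = (if i - 1 = j - 1 then ?t else 0)"
        using \<chi>(2)[of "Mat (i - 1) (j - 1)"] by simp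
      moreover have "i - 1 = j - 1 \<longleftrightarrow> i = j" using ij by auto
      ultimately show ?thesis using ij x by (auto simp: alpha_ij chi_u)
    qed (use x in_2N in \<open>auto simp: alpha_1i alpha_i1 chi_u clinear_0[OF calgebra_homD(1)[OF \<chi>(1)]]\<close>)
    then show "\<chi> (\<alpha> (case x of Mat i j \<Rightarrow> mat G i j | DetInv \<Rightarrow> 1))
        = Q 1 1 (case x of Mat i j \<Rightarrow> mat G i j | DetInv \<Rightarrow> 1)"
      by (simp add: x)
  qed
  with \<chi>(1) show ?thesis by blast
qed

section \<open>Coordinates on the invariant forms of the total space and of the fibre\<close>

lemma clinear_clG: "clinear clG" and clinear_clH: "clinear clH"
  using clG clH by (simp_all add: quotient_map_def)

lemma clinear_cl' [clinear_intros]: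
  "clinear f \<Longrightarrow> clinear (\<lambda>x. clG (f x))" "clinear f' \<Longrightarrow> clinear (\<lambda>x. clH (f' x))"
  by (rule clinear_compose[OF clinear_clG], assumption) (rule clinear_compose[OF clinear_clH])

lemma clG_surj: obtains v where "v \<in> aug G" "x = clG v"
proof -
  have "x \<in> clG ` aug G" using clG by (simp add: quotient_map_def)
  then show ?thesis using that by blast
qed

lemma clG_eq_0: "v \<in> I_SU N G r \<Longrightarrow> clG v = 0"
  and clH_eq_0: "v \<in> I_SU N G r \<Longrightarrow> clH (\<alpha> v) = 0"
  using clG clH by (auto simp: quotient_map_def)

lemma subspace_aug: "complex_vector.subspace (aug G)"
  by (auto simp: complex_vector.subspace_def aug_def clinearD[OF clinear_counit])

lemma subspace_aug_H: "complex_vector.subspace (aug H)"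
  by (auto simp: complex_vector.subspace_def aug_def clinearD[OF clinear_counit_H])

abbreviation e0 where "e0 \<equiv> e_zero G clG"
abbreviation ep where "ep m \<equiv> clG (u m 1)"
abbreviation em where "em m \<equiv> clG (u 1 m)"
abbreviation f0 where "f0 \<equiv> clH (detinv - 1)"

lemma clG_expand:
  assumes "v \<in> aug G"
  shows "clG v = coord_zero v *\<^sub>C e0 + (\<Sum>m\<in>{2..N}. coord_plus m v *\<^sub>C ep m)
    + (\<Sum>m\<in>{2..N}. coord_minus m v *\<^sub>C em m)"
  using clG_eq_0[OF coord_decomposition[OF assms]]
  by (simp add: clinearD[OF clinear_clG] clinear_map_sum[OF clinear_clG] e_zero_def)

text \<open>\<alpha> annihilates u^m_1 and u^1_m, so only the first term of the coordinate
  decomposition survives on the fibre. Thus \<open>f0\<close> spans the forms there.\<close>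

lemma clH_alpha:
  assumes "v \<in> aug G"
  shows "clH (\<alpha> v) = coord_zero v *\<^sub>C f0"
  using clH_eq_0[OF coord_decomposition[OF assms]]
  by (simp add: alpha_simps clinearD[OF clinear_clH] clinear_map_sum[OF clinear_clH]
      clinear_map_sum[OF clinear_alpha] alpha_11 alpha_1i alpha_i1)

lemma clH_surj: obtains v where "v \<in> aug G" "x = clH (\<alpha> v)"
proof -
  have "x \<in> clH ` aug H" using clH by (simp add: quotient_map_def)
  then obtain h where h: "h \<in> aug H" "x = clH h" by blast
  obtain v where "h = \<alpha> v" by (rule alpha_surj)
  then show ?thesis using h that[of v] by (simp add: aug_def counit_alpha)
qed

lemma coord_one:
  "coord_zero 1 = 0" "m \<in> {2..N} \<Longrightarrow> coord_plus m 1 = 0" "m \<in> {2..N} \<Longrightarrow> coord_minus m 1 = 0"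
  using one_in by (auto simp: coord_zero_def coord_plus_def coord_minus_def Q_one counit_simps)

lemmas coord_linear =
  clinearD[OF clinear_coord(1)[OF clinear_id]] clinearD[OF clinear_coord(2)[OF clinear_id]]
  clinearD[OF clinear_coord(3)[OF clinear_id]]

lemma bar_expand:
  "bar G clG h = coord_zero h *\<^sub>C e0 + (\<Sum>m\<in>{2..N}. coord_plus m h *\<^sub>C ep m)
    + (\<Sum>m\<in>{2..N}. coord_minus m h *\<^sub>C em m)"
  using clG_expand[OF aug_minus_counit]
  by (simp add: bar_def coord_linear coord_one scaleC_complex_def)

lemma bar_H_alpha: "bar H clH (\<alpha> h) = coord_zero h *\<^sub>C f0"
  using clH_alpha[OF aug_minus_counit]
  by (simp add: bar_def coord_linear coord_one scaleC_complex_def counit_alpha alpha_simps)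

lemma clinear_bar [clinear_intros]: "clinear f \<Longrightarrow> clinear (\<lambda>x. bar G clG (f x))"
  unfolding bar_def by (intro clinear_intros; assumption)

lemma bar_aug: "v \<in> aug G \<Longrightarrow> bar G clG v = clG v"
  by (simp add: bar_def aug_def)

lemma bar_one: "bar G clG 1 = 0"
  by (simp add: bar_def counit_simps scaleC_one clinearD[OF clinear_clG])

lemma u11_aug: "u 1 1 - 1 \<in> aug G"
  and um1_aug: "m \<in> {2..N} \<Longrightarrow> u m 1 \<in> aug G" and u1m_aug: "m \<in> {2..N} \<Longrightarrow> u 1 m \<in> aug G"
  using one_in by (auto simp: aug_def clinearD[OF clinear_counit] counit_u counit_simps)

lemma coord_u:
  "m \<in> {2..N} \<Longrightarrow> coord_zero (u m 1) = 0" "m \<in> {2..N} \<Longrightarrow> coord_zero (u 1 m) = 0"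
  "m \<in> {2..N} \<Longrightarrow> coord_plus m (u 1 1) = 0" "m \<in> {2..N} \<Longrightarrow> coord_minus m (u 1 1) = 0"
  "m \<in> {2..N} \<Longrightarrow> s \<in> {2..N} \<Longrightarrow> coord_plus s (u 1 m) = 0"
  "m \<in> {2..N} \<Longrightarrow> s \<in> {2..N} \<Longrightarrow> coord_minus s (u m 1) = 0"
  "m \<in> {2..N} \<Longrightarrow> s \<in> {2..N} \<Longrightarrow> coord_plus s (u m 1) = (if s = m then inverse (nu q) * nu q else 0)"
  "m \<in> {2..N} \<Longrightarrow> s \<in> {2..N} \<Longrightarrow> coord_minus s (u 1 m) = (if s = m then inverse (nu q) * nu q else 0)"
  using one_in q'_nz
  by (auto simp: coord_zero_def coord_plus_def coord_minus_def Q_u counit_u chi_u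
      clinearD[OF clinear_Q] clinearD[OF clinear_counit] Q_one counit_simps power2_eq_square field_simps)

lemma coord_zero_u11: "coord_zero (u 1 1) = inverse weight * weight"
  using one_in by (simp add: coord_zero_def chi_u counit_u)

text \<open>Expanding e^0 in its own coordinate produces this factor, which is 1 except at weight 0,
  where the identity says that e^0 = 0. Carrying it along avoids case distinctions.\<close>

lemma e0_fix: "(inverse weight * weight) *\<^sub>C e0 = e0"
  using clG_expand[OF u11_aug] by (simp add: coord_u coord_zero_u11 coord_linear coord_one e_zero_def)

lemma ep_fix: "m \<in> {2..N} \<Longrightarrow> (inverse (nu q) * nu q) *\<^sub>C ep m = ep m"
  using clG_expand[OF um1_aug, of m]
  by (simp add: coord_u if_distrib[of "\<lambda>c. c *\<^sub>C _"] cong: if_cong)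

lemma em_fix: "m \<in> {2..N} \<Longrightarrow> (inverse (nu q) * nu q) *\<^sub>C em m = em m"
  using clG_expand[OF u1m_aug, of m]
  by (simp add: coord_u if_distrib[of "\<lambda>c. c *\<^sub>C _"] cong: if_cong)

lemma coord_zero_I: "v \<in> I_SU N G r \<Longrightarrow> coord_zero v = 0"
  using one_in by (simp add: I_SU_eq aug_def coord_zero_def)

definition lam :: "'l \<Rightarrow> complex" where
  "lam = (SOME g. clinear g \<and> (\<forall>v\<in>aug G. g (clG v) = coord_zero v))"

lemma clinear_lam: "clinear lam" and lam_clG: "v \<in> aug G \<Longrightarrow> lam (clG v) = coord_zero v"
proof -
  have "\<exists>g. clinear g \<and> (\<forall>v\<in>aug G. g (clG v) = coord_zero v)"
    by (rule quotient_map_factor[OF clG _ coord_zero_I subspace_aug]) (intro clinear_intros)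
  then have "clinear lam \<and> (\<forall>v\<in>aug G. lam (clG v) = coord_zero v)" unfolding lam_def by (rule someI_ex)
  then show "clinear lam" "v \<in> aug G \<Longrightarrow> lam (clG v) = coord_zero v" by blast+
qed

lemma clinear_lam' [clinear_intros]: "clinear f \<Longrightarrow> clinear (\<lambda>x. lam (f x))"
  by (rule clinear_compose[OF clinear_lam])

lemma lam_bar: "lam (bar G clG h) = coord_zero h"
  using lam_clG[OF aug_minus_counit]
  by (simp add: bar_def coord_linear coord_one scaleC_complex_def)

lemma lam_e: "lam e0 = inverse weight * weight"
  "m \<in> {2..N} \<Longrightarrow> lam (ep m) = 0" "m \<in> {2..N} \<Longrightarrow> lam (em m) = 0"
  by (simp_all add: e_zero_def lam_clG u11_aug um1_aug u1m_aug coord_u coord_zero_u11 coord_linear coord_one)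

text \<open>Prescribing the value at \<open>f0\<close> is consistent only if \<open>f0\<close> = 0
  forces e^0 = 0. The character on H makes the coordinate of e^0 a functional on the fibre forms;
  its value at \<open>f0\<close> is the factor of \<open>e0_fix\<close>, so multiplying e^0 by this
  functional gives the splitting.\<close>

lemma splitting_exists: "\<exists>i. clinear i \<and> i f0 = e0"
proof -
  obtain \<chi> where \<chi>: "calgebra_hom \<chi>" "\<And>h. \<chi> (\<alpha> h) = Q 1 1 h" using chi_factors by blast
  define \<mu> where "\<mu> w = inverse weight * (\<chi> w - counit H w)" for w
  have \<mu>_alpha: "\<mu> (\<alpha> v) = coord_zero v" for v
    by (simp add: \<mu>_def \<chi> counit_alpha coord_zero_def)
  have "clinear \<mu>" unfolding \<mu>_def
    by (intro clinear_mult_right clinear_minus calgebra_homD(1)[OF \<chi>(1)] clinear_counit_H)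
  then have "\<exists>g. clinear g \<and> (\<forall>w\<in>aug H. g (clH w) = \<mu> w)"
    by (rule quotient_map_factor[OF clH _ _ subspace_aug_H]) (auto simp: \<mu>_alpha coord_zero_I)
  then obtain g where g: "clinear g" "\<And>w. w \<in> aug H \<Longrightarrow> g (clH w) = \<mu> w" by blast
  have "detinv - 1 = \<alpha> (u 1 1 - 1)" by (simp add: alpha_simps alpha_11)
  then have "g f0 = \<mu> (\<alpha> (u 1 1 - 1))"
    using g(2)[of "\<alpha> (u 1 1 - 1)"] u11_aug by (simp add: aug_def counit_alpha)
  then have "g f0 = inverse weight * weight" by (simp only: \<mu>_alpha coord_linear coord_one coord_zero_u11) simp
  then have "clinear (\<lambda>x. g x *\<^sub>C e0) \<and> g f0 *\<^sub>C e0 = e0"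
    using e0_fix by (auto intro: clinear_scaleC_left[OF g(1)])
  then show ?thesis by blast
qed

lemma splitting_clH:
  assumes "clinear i" "i f0 = e0" "v \<in> aug G"
  shows "i (clH (\<alpha> v)) = coord_zero v *\<^sub>C e0"
  by (simp add: clH_alpha assms clinearD[OF assms(1)])

lemma splitting_unique:
  assumes "clinear i" "i f0 = e0" "clinear j" "j f0 = e0"
  shows "i = j"
proof
  fix x
  obtain v where "v \<in> aug G" "x = clH (\<alpha> v)" by (rule clH_surj)
  then show "i x = j x" using splitting_clH assms by metis
qed

section \<open>The projection onto the e^0 direction\<close>

definition proj :: "('a, 'l) tensor \<Rightarrow> ('a, 'l) tensor" where
  "proj = tmap (\<lambda>g. g) (\<lambda>x. lam x *\<^sub>C e0)"

lemma clinear_proj: "clinear proj" and proj_elem: "proj (g \<otimes> x) = lam x *\<^sub>C (g \<otimes> e0)"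
  unfolding proj_def
  by (rule clinear_tmap, intro clinear_intros, intro clinear_intros)
    (subst tmap_elem, intro clinear_intros, intro clinear_intros, rule tensor_scale_right)

lemma left_mult_elem: "left_mult f (g \<otimes> x) = (f * g) \<otimes> x"
  unfolding left_mult_def by (intro tmap_elem clinear_intros)

lemma clinear_left_mult: "clinear (left_mult f)"
  unfolding left_mult_def by (intro clinear_tmap clinear_intros)

lemma clinear_left_mult' [clinear_intros]: "clinear g \<Longrightarrow> clinear (\<lambda>x. left_mult f (g x))"
  by (rule clinear_compose[OF clinear_left_mult])

lemma clinear_left_mult_arg [clinear_intros]:
  assumes "clinear g"
  shows "clinear (\<lambda>x. left_mult (g x) \<eta>)"
  unfolding left_mult_def tmap_def using assms
  by (intro clinear_tlift_fun cbilinearI clinear_intros; assumption)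

lemma left_mult_mult: "left_mult f (left_mult g \<eta>) = left_mult (f * g) \<eta>"
proof -
  have "(\<lambda>\<eta>. left_mult f (left_mult g \<eta>)) = left_mult (f * g)"
    by (rule tensor_map_eqI) (auto intro!: clinear_left_mult clinear_left_mult' simp: left_mult_elem mult.assoc)
  then show ?thesis by metis
qed

lemma left_mult_one: "left_mult 1 \<eta> = \<eta>"
proof -
  have "left_mult 1 = (\<lambda>\<eta>. \<eta>)"
    by (rule tensor_map_eqI) (auto intro!: clinear_left_mult clinear_id simp: left_mult_elem)
  then show ?thesis by metis
qed

text \<open>The explicit map satisfies the description by \<open>clH_alpha\<close>; it is the only
  one because every invariant form is the class of some v in G^+.\<close>

lemma ver_eq: "ver G clG clH \<alpha> = tmap (\<lambda>g. g) (\<lambda>x. lam x *\<^sub>C f0)" (is "_ = ?f")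
  unfolding ver_def
proof (rule the_equality)
  have lin: "clinear ?f" by (intro clinear_tmap clinear_intros)
  have f: "?f (g \<otimes> x) = g \<otimes> (lam x *\<^sub>C f0)" for g x
    by (intro tmap_elem clinear_intros)
  show "clinear ?f \<and> (\<forall>g. \<forall>v\<in>aug G. ?f (g \<otimes> clG v) = g \<otimes> clH (\<alpha> v))"
    using lin by (simp add: f clH_alpha lam_clG)
  fix f :: "('a, 'l) tensor \<Rightarrow> ('a, 'k) tensor"
  assume *: "clinear f \<and> (\<forall>g. \<forall>v\<in>aug G. f (g \<otimes> clG v) = g \<otimes> clH (\<alpha> v))"
  show "f = ?f"
  proof (rule tensor_map_eqI)
    fix g x
    obtain v where "v \<in> aug G" "x = clG v" by (rule clG_surj)
    then show "f (g \<otimes> x) = ?f (g \<otimes> x)" using * by (simp add: f clH_alpha lam_clG)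
  qed (use * lin in auto)
qed

lemma Pi_omega_eq:
  assumes "clinear i" "i f0 = e0"
  shows "Pi_omega G clG clH \<alpha> i = proj"
proof (rule tensor_map_eqI)
  note [clinear_intros] = clinear_compose[OF assms(1)]
  have bil: "cbilinear (\<lambda>g x. left_mult g (1 \<otimes> i x))"
    by (intro cbilinearI clinear_intros)
  show "clinear (Pi_omega G clG clH \<alpha> i)"
    unfolding Pi_omega_def Let_def ver_eq
    by (intro clinear_tlift_arg[OF bil] clinear_tmap clinear_intros)
  fix g x
  have "Pi_omega G clG clH \<alpha> i (g \<otimes> x) = left_mult g (1 \<otimes> i (lam x *\<^sub>C f0))"
    unfolding Pi_omega_def Let_def ver_eq
    by (subst tmap_elem) (intro clinear_intros tlift_elem[OF bil])+
  then show "Pi_omega G clG clH \<alpha> i (g \<otimes> x) = proj (g \<otimes> x)"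
    by (simp add: proj_elem left_mult_elem clinearD[OF assms(1)] assms(2) tensor_scale_right
        clinearD[OF clinear_left_mult])
qed (rule clinear_proj)

lemma proj_left_mult: "proj (left_mult p \<eta>) = left_mult p (proj \<eta>)"
proof -
  have "(\<lambda>\<eta>. proj (left_mult p \<eta>)) = (\<lambda>\<eta>. left_mult p (proj \<eta>))"
    by (rule tensor_map_eqI)
      (auto intro!: clinear_compose[OF clinear_proj] clinear_left_mult clinear_compose[OF clinear_left_mult] clinear_proj
        simp: proj_elem left_mult_elem clinearD[OF clinear_left_mult])
  then show ?thesis by metis
qed

lemma proj_idem: "proj (proj \<eta>) = proj \<eta>"
proof -
  have eq: "(inverse weight * weight) *\<^sub>C (g \<otimes> e0) = g \<otimes> e0" for g :: 'a
    by (simp only: tensor_scale_right[symmetric] e0_fix)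
  have "(\<lambda>\<eta>. proj (proj \<eta>)) = proj"
  proof (rule tensor_map_eqI)
    fix g x
    show "proj (proj (g \<otimes> x)) = proj (g \<otimes> x)"
      by (simp only: proj_elem clinearD(4)[OF clinear_proj] lam_e(1) eq)
  qed (rule clinear_compose[OF clinear_proj clinear_proj] clinear_proj)+
  then show ?thesis by metis
qed

lemma proj_e: "proj (1 \<otimes> e0) = 1 \<otimes> e0"
  "m \<in> {2..N} \<Longrightarrow> proj (1 \<otimes> ep m) = 0" "m \<in> {2..N} \<Longrightarrow> proj (1 \<otimes> em m) = 0"
  by (simp_all add: proj_elem lam_e e0_fix flip: tensor_scale_right)

subsection \<open>Adjoint coaction\<close>

definition Ad :: "'a \<Rightarrow> ('a, 'a) tensor" where
  "Ad v = sweedler3 G (\<lambda>a b c. b \<otimes> (S a * c)) v"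

definition ad_bar :: "'a \<Rightarrow> ('l, 'b) tensor" where
  "ad_bar v = sweedler3 G (\<lambda>a b c. bar G clG b \<otimes> \<alpha> (S a * c)) v"

text \<open>The H-valued coefficient of the adjoint coaction along the basis form whose coordinate
  function is \<phi>.\<close>

definition ad_part :: "('a \<Rightarrow> complex) \<Rightarrow> 'a \<Rightarrow> 'b" where
  "ad_part \<phi> v = \<alpha> (sweedler3 G (\<lambda>a b c. \<phi> b *\<^sub>C (S a * c)) v)"

text \<open>Both sides are linear maps applied to the single tensor \<open>Ad v\<close>, so they
  need only be compared on elementary tensors, where the claim is the coordinate expansion of the
  middle leg.\<close>

lemma ad_bar_expand:
  "ad_bar v = e0 \<otimes> ad_part coord_zero v + (\<Sum>m\<in>{2..N}. ep m \<otimes> ad_part (coord_plus m) v)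
    + (\<Sum>m\<in>{2..N}. em m \<otimes> ad_part (coord_minus m) v)"
proof -
  have Ad: "clinear f \<Longrightarrow> f (Ad v) = sweedler3 G (\<lambda>a b c. f (b \<otimes> (S a * c))) v"
    for f :: "('a, 'a) tensor \<Rightarrow> 'x::complex_vector"
    unfolding Ad_def by (intro sweedler3_compose clinear_intros; assumption)
  define f where "f = tmap (bar G clG) \<alpha>"
  have f: "clinear f" "\<And>b y. f (b \<otimes> y) = bar G clG b \<otimes> \<alpha> y"
    using clinear_bar[OF clinear_id] clinear_alpha by (simp_all add: f_def clinear_tmap tmap_elem)
  define k where "k \<phi> = tlift (\<lambda>b y. \<phi> b *\<^sub>C \<alpha> y)" for \<phi> :: "'a \<Rightarrow> complex"
  have k: "clinear (k \<phi>)" "k \<phi> (b \<otimes> y) = \<phi> b *\<^sub>C \<alpha> y" if "clinear \<phi>" for \<phi> b y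
  proof -
    note [clinear_intros] = clinear_compose[OF that]
    have "cbilinear (\<lambda>b y. \<phi> b *\<^sub>C \<alpha> y)" by (intro cbilinearI clinear_intros)
    then show "clinear (k \<phi>)" "k \<phi> (b \<otimes> y) = \<phi> b *\<^sub>C \<alpha> y" by (simp_all add: k_def clinear_tlift tlift_elem)
  qed
  have part: "ad_part \<phi> v = k \<phi> (Ad v)" if \<phi>: "clinear \<phi>" for \<phi>
  proof -
    note [clinear_intros] = clinear_compose[OF \<phi>]
    have "k \<phi> (Ad v) = sweedler3 G (\<lambda>a b c. \<alpha> (\<phi> b *\<^sub>C (S a * c))) v"
      by (subst Ad[OF k(1)[OF \<phi>]]) (simp only: k(2)[OF \<phi>] alpha_simps)
    also have "\<dots> = ad_part \<phi> v"
      unfolding ad_part_def by (rule sweedler3_compose[symmetric]) (intro clinear_alpha clinear_intros)+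
    finally show ?thesis by simp
  qed
  note lin = clinear_coord[OF clinear_id]
  define g where "g t = e0 \<otimes> k coord_zero t + (\<Sum>m\<in>{2..N}. ep m \<otimes> k (coord_plus m) t)
    + (\<Sum>m\<in>{2..N}. em m \<otimes> k (coord_minus m) t)" for t
  have "f = g"
  proof (rule tensor_map_eqI)
    show "clinear g" unfolding g_def by (intro clinear_intros k(1) lin)
    fix b y
    show "f (b \<otimes> y) = g (b \<otimes> y)"
      by (simp add: f(2) g_def k(2) lin bar_expand tensor_add_left tensor_sum_left
          tensor_scale_left tensor_scale_right)
  qed (rule f)
  then have "f (Ad v) = g (Ad v)" by simp
  moreover have "f (Ad v) = ad_bar v" unfolding ad_bar_def Ad[OF f(1)] f(2) ..
  ultimately show ?thesis by (simp add: g_def part lin)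
qed

lemma ad_part_Q:
  assumes "k \<in> {1..N}" "l \<in> {1..N}"
  shows "ad_part (Q k l) v = (\<Sum>p\<in>{1..N}. \<Sum>s\<in>{1..N}. Q s p v *\<^sub>C (\<alpha> (u k s) * \<alpha> (S (u p l))))"
  unfolding ad_part_def Q_adjoint[OF assms]
  by (simp add: clinear_map_sum[OF clinear_alpha] alpha_simps)

text \<open>\<alpha>(u) is block diagonal with first entry \<open>detinv\<close>, so conjugation by
  it leaves the entry (1,1) unchanged: the two remaining factors are inverse to each other.\<close>

lemma ad_part_Q11: "ad_part (Q 1 1) v = Q 1 1 v *\<^sub>C 1"
proof -
  have "ad_part (Q 1 1) v = (\<Sum>s\<in>{1..N}. Q s 1 v *\<^sub>C (\<alpha> (u 1 s) * \<alpha> (S (u 1 1))))"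
    unfolding ad_part_Q[OF one_in one_in]
    by (rule sum_at_one) (use in_2N in \<open>simp add: alpha_S_i1\<close>)
  also have "\<dots> = Q 1 1 v *\<^sub>C (\<alpha> (u 1 1) * \<alpha> (S (u 1 1)))"
    by (rule sum_at_one) (use in_2N in \<open>simp add: alpha_1i\<close>)
  finally show ?thesis by (simp add: alpha_11 detinv_inverse)
qed

lemma ad_part_scale:
  assumes "clinear \<phi>"
  shows "ad_part (\<lambda>b. c * \<phi> b) v = c *\<^sub>C ad_part \<phi> v"
proof -
  note [clinear_intros] = clinear_compose[OF assms]
  have "c *\<^sub>C sweedler3 G (\<lambda>a b c. \<phi> b *\<^sub>C (S a * c)) v = sweedler3 G (\<lambda>a b d. c *\<^sub>C \<phi> b *\<^sub>C (S a * d)) v"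
    by (rule sweedler3_compose) (intro clinear_intros)+
  then show ?thesis by (simp add: ad_part_def scaleC_scaleC flip: alpha_simps(6))
qed

lemma ad_part_coord_zero: "ad_part coord_zero v = coord_zero v *\<^sub>C 1"
proof -
  have "ad_part coord_zero v = inverse weight *\<^sub>C ad_part (\<lambda>b. Q 1 1 b - counit G b) v"
    unfolding coord_zero_def[abs_def] by (intro ad_part_scale clinear_minus clinear_Q clinear_counit)
  also have "ad_part (\<lambda>b. Q 1 1 b - counit G b) v = ad_part (Q 1 1) v - ad_part (counit G) v"
    by (simp add: ad_part_def sweedler3_minus[OF clinear_Q clinear_counit] alpha_simps)
  also have "\<dots> = (Q 1 1 v - counit G v) *\<^sub>C 1"
    by (simp only: ad_part_Q11) (simp add: ad_part_def sweedler3_counit alpha_simps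
      complex_vector.scale_left_diff_distrib)
  finally show ?thesis by (simp only: coord_zero_def[of v] scaleC_scaleC)
qed

text \<open>In the conjugation formula for entry (1,m) block diagonality leaves only s = 1 and p >=
  2. The coefficient therefore involves row 1 of Q(v) alone, which is 0 off the diagonal by
  assumption.\<close>

lemma ad_part_coord_plus:
  assumes "m \<in> {2..N}" "\<And>s. s \<in> {2..N} \<Longrightarrow> Q 1 s v = 0"
  shows "ad_part (coord_plus m) v = 0"
proof -
  have m: "m \<in> {1..N}" using assms by auto
  have "Q s p v *\<^sub>C (\<alpha> (u 1 s) * \<alpha> (S (u p m))) = 0" if "s \<in> {1..N}" "p \<in> {1..N}" for s p
    using that in_2N[of s] in_2N[of p] assms by (cases "s = 1"; cases "p = 1") (auto simp: alpha_1i alpha_S_1i)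
  then have "ad_part (Q 1 m) v = 0" unfolding ad_part_Q[OF one_in m] by (simp add: sum.neutral)
  then show ?thesis unfolding coord_plus_def[abs_def] by (simp add: ad_part_scale[OF clinear_Q])
qed

lemma ad_part_coord_minus:
  assumes "m \<in> {2..N}" "\<And>s. s \<in> {2..N} \<Longrightarrow> Q s 1 v = 0"
  shows "ad_part (coord_minus m) v = 0"
proof -
  have m: "m \<in> {1..N}" using assms by auto
  have "Q s p v *\<^sub>C (\<alpha> (u m s) * \<alpha> (S (u p 1))) = 0" if "s \<in> {1..N}" "p \<in> {1..N}" for s p
    using that in_2N[of s] in_2N[of p] assms by (cases "s = 1"; cases "p = 1") (auto simp: alpha_i1 alpha_S_i1)
  then have "ad_part (Q m 1) v = 0" unfolding ad_part_Q[OF m one_in] by (simp add: sum.neutral)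
  then show ?thesis unfolding coord_minus_def[abs_def] by (simp add: ad_part_scale[OF clinear_Q])
qed

text \<open>This makes the adjoint coaction well defined on the quotient by I, and so resolves the
  definite description in \<open>ad_coaction\<close>.\<close>

lemma ad_bar_I:
  assumes "v \<in> I_SU N G r"
  shows "ad_bar v = 0"
proof -
  have Q: "Q 1 s v = 0" "Q s 1 v = 0" if "s \<in> {2..N}" for s
    using assms that by (auto simp: I_SU_eq)
  have "ad_part (coord_plus m) v = 0" "ad_part (coord_minus m) v = 0" if "m \<in> {2..N}" for m
    using ad_part_coord_plus[OF that Q(1)] ad_part_coord_minus[OF that Q(2)] by auto
  then show ?thesis
    unfolding ad_bar_expand by (simp add: ad_part_coord_zero coord_zero_I assms)
qed

lemma ad_bar_e0: "ad_bar (u 1 1 - 1) = e0 \<otimes> 1"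
proof -
  have Q: "Q 1 s (u 1 1 - 1) = 0" "Q s 1 (u 1 1 - 1) = 0" if "s \<in> {2..N}" for s
    using that one_in by (auto simp: clinearD[OF clinear_Q] Q_u Q_one)
  have "ad_part (coord_plus m) (u 1 1 - 1) = 0" "ad_part (coord_minus m) (u 1 1 - 1) = 0"
    if "m \<in> {2..N}" for m
    using ad_part_coord_plus[OF that Q(1)] ad_part_coord_minus[OF that Q(2)] by auto
  then show ?thesis unfolding ad_bar_expand
    by (simp add: ad_part_coord_zero coord_linear coord_one coord_zero_u11 tensor_scale_right
        e0_fix flip: tensor_scale_left)
qed

lemma clinear_ad_bar: "clinear ad_bar"
  unfolding ad_bar_def[abs_def] by (intro clinear_intros clinear_sweedler3[where g = "\<lambda>x. x", simplified])

abbreviation ad where "ad \<equiv> ad_coaction G clG \<alpha>"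

lemma clinear_ad: "clinear ad" and ad_clG: "v \<in> aug G \<Longrightarrow> ad (clG v) = ad_bar v"
proof -
  obtain g where g: "clinear g" "\<And>v. v \<in> aug G \<Longrightarrow> g (clG v) = ad_bar v"
    using quotient_map_factor[OF clG clinear_ad_bar ad_bar_I subspace_aug] by blast
  have "ad = g"
    unfolding ad_coaction_def ad_bar_def[symmetric]
  proof (rule the_equality)
    fix \<delta> assume *: "clinear \<delta> \<and> (\<forall>v\<in>aug G. \<delta> (clG v) = ad_bar v)"
    show "\<delta> = g"
    proof
      fix x
      obtain v where "v \<in> aug G" "x = clG v" by (rule clG_surj)
      then show "\<delta> x = g x" using * g by simp
    qed
  qed (use g in auto)
  with g show "clinear ad" "v \<in> aug G \<Longrightarrow> ad (clG v) = ad_bar v" by auto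
qed

lemma ad_bar_one: "ad_bar 1 = 0"
  by (simp add: ad_bar_def sweedler3_word[of "[]" 0 "[]", simplified] clinear_intros bar_one)

lemma ad_bar_bar: "ad (bar G clG v) = ad_bar v"
  using ad_clG[OF aug_minus_counit]
  by (simp add: bar_def clinearD[OF clinear_ad_bar] ad_bar_one)

text \<open>H lies outside the calculus of words, so its Sweedler sums are pulled back to G along
  the coalgebra map \<alpha>.\<close>

lemma sweedler3_alpha:
  assumes "\<And>a b. clinear (\<lambda>x. F x a b)" "\<And>a b. clinear (\<lambda>x. F a x b)" "\<And>a b. clinear (\<lambda>x. F a b x)"
  shows "sweedler3 H F (\<alpha> v) = sweedler3 G (\<lambda>a b c. F (\<alpha> a) (\<alpha> b) (\<alpha> c)) v"
proof -
  have s2: "sweedler2 H F' (\<alpha> v) = sweedler2 G (\<lambda>a b. F' (\<alpha> a) (\<alpha> b)) v"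
    if "\<And>a. clinear (\<lambda>x. F' x a)" "\<And>a. clinear (\<lambda>x. F' a x)"
    for F' :: "'b \<Rightarrow> 'b \<Rightarrow> 'x::complex_vector" and v
  proof -
    have bil: "cbilinear F'" by (intro cbilinearI that)
    have "sweedler2 H F' (\<alpha> v) = tlift F' (tlift (\<lambda>a b. \<alpha> a \<otimes> \<alpha> b) (comult G v))"
      by (simp add: sweedler2_def comult_alpha tmap_def)
    also have "\<dots> = tlift (\<lambda>a b. tlift F' (\<alpha> a \<otimes> \<alpha> b)) (comult G v)"
      by (intro tlift_compose clinear_tlift bil tmap_cbilinear clinear_alpha)
    finally show ?thesis by (simp add: sweedler2_def tlift_elem[OF bil])
  qed
  have lin: "clinear (comult H)" using hopf_H by (simp add: hopf_algebra_def)
  have "sweedler3 H F (\<alpha> v) = sweedler2 G (\<lambda>a b. sweedler2 H (F (\<alpha> a)) (\<alpha> b)) v"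
    unfolding sweedler3_def
  proof (rule s2)
    show "clinear (\<lambda>x. sweedler2 H (F x) b)" for b
      unfolding sweedler2_def by (intro clinear_tlift_fun cbilinearI assms)
    show "clinear (sweedler2 H (F a))" for a
      unfolding sweedler2_def[abs_def] by (intro clinear_tlift_arg[OF _ lin] cbilinearI assms)
  qed
  then show ?thesis by (simp add: s2 assms sweedler3_def)
qed

text \<open>Fibre classes are multiples of the single form \<open>f0\<close>, with coefficient the
  invariant coordinate \<open>coord_zero\<close>; hence the adjoint coaction on the fibre is
  trivial.\<close>

lemma ad_H: "ad_coaction H clH (\<lambda>h. h) = (\<lambda>x. x \<otimes> 1)"
proof -
  have lin_bar: "clinear f \<Longrightarrow> clinear (\<lambda>x. bar H clH (f x))" for f :: "'x::complex_vector \<Rightarrow> 'b"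
    unfolding bar_def by (intro clinear_intros clinear_compose[OF clinear_counit_H]; assumption)
  have lin_S: "clinear f \<Longrightarrow> clinear (\<lambda>x. antipode H (f x))" for f :: "'x::complex_vector \<Rightarrow> 'b"
    using hopf_H by (auto simp: hopf_algebra_def intro: clinear_compose)
  have eq: "sweedler3 H (\<lambda>a b c. bar H clH b \<otimes> (antipode H a * c)) (\<alpha> v) = clH (\<alpha> v) \<otimes> 1"
    if "v \<in> aug G" for v
  proof -
    have "sweedler3 H (\<lambda>a b c. bar H clH b \<otimes> (antipode H a * c)) (\<alpha> v)
        = sweedler3 G (\<lambda>a b c. bar H clH (\<alpha> b) \<otimes> (antipode H (\<alpha> a) * \<alpha> c)) v"
      by (rule sweedler3_alpha) (intro clinear_intros lin_bar lin_S)+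
    also have "\<dots> = sweedler3 G (\<lambda>a b c. f0 \<otimes> \<alpha> (coord_zero b *\<^sub>C (S a * c))) v"
      by (simp add: bar_H_alpha antipode_alpha alpha_simps tensor_scale_left tensor_scale_right)
    also have "\<dots> = f0 \<otimes> \<alpha> (sweedler3 G (\<lambda>a b c. coord_zero b *\<^sub>C (S a * c)) v)"
      by (rule sweedler3_compose[symmetric]) (intro clinear_intros)+
    also have "\<dots> = clH (\<alpha> v) \<otimes> 1"
      using ad_part_coord_zero[of v]
      by (simp add: ad_part_def clH_alpha that tensor_scale_left tensor_scale_right)
    finally show ?thesis .
  qed
  show ?thesis
    unfolding ad_coaction_def
  proof (rule the_equality)
    show "clinear (\<lambda>x. x \<otimes> 1) \<and> (\<forall>w\<in>aug H. clH w \<otimes> 1 =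
        sweedler3 H (\<lambda>a b c. bar H clH b \<otimes> (antipode H a * c)) w)"
    proof (intro conjI ballI clinear_intros)
      fix w assume "w \<in> aug H"
      moreover obtain v where "w = \<alpha> v" by (rule alpha_surj)
      ultimately show "clH w \<otimes> 1 = sweedler3 H (\<lambda>a b c. bar H clH b \<otimes> (antipode H a * c)) w"
        using eq[of v] by (simp add: aug_def counit_alpha)
    qed
    fix \<delta> assume *: "clinear \<delta> \<and> (\<forall>w\<in>aug H. \<delta> (clH w) =
        sweedler3 H (\<lambda>a b c. bar H clH b \<otimes> (antipode H a * c)) w)"
    show "\<delta> = (\<lambda>x. x \<otimes> 1)"
    proof
      fix x
      obtain v where "v \<in> aug G" "x = clH (\<alpha> v)" by (rule clH_surj)
      then show "\<delta> x = x \<otimes> 1" using * eq[of v] by (simp add: aug_def counit_alpha)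
    qed
  qed
qed

lemma bicovariant:
  assumes i: "clinear i" "i f0 = e0"
  shows "bicovariant_splitting_map G H clG clH \<alpha> i"
  unfolding bicovariant_splitting_map_def
proof (intro conjI allI ballI impI)
  fix x v assume v: "v \<in> aug G" "clG v = i x"
  obtain y where y: "y \<in> aug G" "x = clH (\<alpha> y)" by (rule clH_surj)
  have "coord_zero v = lam (i x)" using lam_clG v by metis
  also have "\<dots> = coord_zero y * (inverse weight * weight)"
    by (simp add: y splitting_clH[OF i] clinearD[OF clinear_lam] lam_e scaleC_complex_def)
  \<comment> \<open>\<open>coord_zero\<close> already contains the factor
    \<open>inverse weight\<close>, so both sides are 0 when the weight is 0.\<close>
  also have "\<dots> = coord_zero y" by (cases "weight = 0") (simp_all add: coord_zero_def)
  finally show "clH (\<alpha> v) = x" using v(1) y by (simp add: clH_alpha)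
next
  fix x
  obtain v where v: "v \<in> aug G" "x = clH (\<alpha> v)" by (rule clH_surj)
  have "ad (i x) = coord_zero v *\<^sub>C ad e0" by (simp add: v splitting_clH[OF i] clinearD[OF clinear_ad])
  also have "ad e0 = e0 \<otimes> 1" using ad_clG[OF u11_aug] by (simp add: e_zero_def ad_bar_e0)
  also have "coord_zero v *\<^sub>C (e0 \<otimes> 1) = i x \<otimes> 1"
    by (simp add: v splitting_clH[OF i] tensor_scale_left)
  also have "\<dots> = tmap i (\<lambda>h. h) (x \<otimes> 1)"
    by (rule tmap_elem[OF i(1) clinear_id, symmetric])
  finally show "ad (i x) = tmap i (\<lambda>h. h) (ad_coaction H clH (\<lambda>h. h) x)" by (simp add: ad_H)
qed (rule i)

subsection \<open>Coaction on one-forms\<close>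

text \<open>The diagonal coaction, with h_1 and the form part x_0 on the left and \<alpha>(h_2) x_1
  on the right, where x_0 and x_1 come from the adjoint coaction. It is the explicit candidate for
  \<open>form_coaction\<close>.\<close>

definition coact :: "('a, 'l) tensor \<Rightarrow> (('a, 'l) tensor, 'b) tensor" where
  "coact = tlift (\<lambda>h x. sweedler2 G (\<lambda>h1 h2. tlift (\<lambda>y b. (h1 \<otimes> y) \<otimes> (\<alpha> h2 * b)) (ad x)) h)"

lemma coact_inner: "cbilinear (\<lambda>y b. ((h1 :: 'a) \<otimes> (y :: 'l)) \<otimes> (\<alpha> h2 * b))"
  by (intro cbilinearI clinear_intros)

lemma coact_inner_linear:
  fixes h1 :: 'a
  shows "clinear (\<lambda>h1 :: 'a. tlift (\<lambda>y b. (h1 \<otimes> y) \<otimes> (\<alpha> h2 * b)) (ad x))"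
  "clinear (\<lambda>h2. tlift (\<lambda>y b. (h1 \<otimes> y) \<otimes> (\<alpha> h2 * b)) (ad x))"
  "clinear (\<lambda>x. tlift (\<lambda>y b. (h1 \<otimes> y) \<otimes> (\<alpha> h2 * b)) (ad x))"
proof -
  show "clinear (\<lambda>h1 :: 'a. tlift (\<lambda>y b. (h1 \<otimes> y) \<otimes> (\<alpha> h2 * b)) (ad x))"
    by (rule clinear_tlift_fun, rule coact_inner, intro clinear_intros)
  show "clinear (\<lambda>h2. tlift (\<lambda>y b. (h1 \<otimes> y) \<otimes> (\<alpha> h2 * b)) (ad x))"
    by (rule clinear_tlift_fun, rule coact_inner, intro clinear_intros)
  show "clinear (\<lambda>x. tlift (\<lambda>y b. (h1 \<otimes> y) \<otimes> (\<alpha> h2 * b)) (ad x))"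
    by (rule clinear_tlift_arg[OF coact_inner clinear_ad])
qed

lemma coact_outer:
  "cbilinear (\<lambda>h x. sweedler2 G (\<lambda>h1 h2. tlift (\<lambda>y b. (h1 \<otimes> y) \<otimes> (\<alpha> h2 * b)) (ad x)) h)"
  by (intro cbilinearI clinear_sweedler2 clinear_sweedler2_fun coact_inner_linear clinear_id)

lemma clinear_coact: "clinear coact"
  unfolding coact_def by (rule clinear_tlift[OF coact_outer])

lemma coact_elem:
  "coact (h \<otimes> x) = sweedler2 G (\<lambda>h1 h2. tlift (\<lambda>y b. (h1 \<otimes> y) \<otimes> (\<alpha> h2 * b)) (ad x)) h"
  unfolding coact_def by (rule tlift_elem[OF coact_outer])

lemma clinear_dd: "clinear (dd G clG)"
  unfolding dd_def[abs_def] by (intro clinear_sweedler2[where g = "\<lambda>x. x", simplified] clinear_intros)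

lemma clinear_dd' [clinear_intros]: "clinear f \<Longrightarrow> clinear (\<lambda>x. dd G clG (f x))"
  by (rule clinear_compose[OF clinear_dd])

lemma dd_word:
  assumes "I \<in> idx m" "J \<in> idx m"
  shows "dd G clG (w I J) = (\<Sum>K\<in>idx m. w I K \<otimes> bar G clG (w K J))"
  unfolding dd_def by (rule sweedler2_word) (intro assms clinear_intros)+

lemma ad_bar_word:
  assumes "I \<in> idx m" "J \<in> idx m"
  shows "ad_bar (w I J) = (\<Sum>K\<in>idx m. \<Sum>L\<in>idx m. bar G clG (w K L) \<otimes> \<alpha> (S (w I K) * w L J))"
  unfolding ad_bar_def by (rule sweedler3_word) (intro assms clinear_intros)+

text \<open>Applied to f g_1 tensored with the class of g_2, the coaction yields f_1 g_1, the class
  of g_4, and \<alpha>(f_2 g_2 S(g_3) g_5). The antipode cancels g_2 S(g_3), which is the fact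
  \<open>inner\<close>, and what remains is the covariance of d.\<close>

lemma coact_left_mult_dd:
  "coact (left_mult f (dd G clG g)) =
    sweedler2 G (\<lambda>f1 f2. sweedler2 G (\<lambda>g1 g2. left_mult f1 (dd G clG g1) \<otimes> \<alpha> (f2 * g2)) g) f"
proof (rule words_eqI[where h = f])
  fix m I J assume IJ: "I \<in> idx m" "J \<in> idx m"
  show "coact (left_mult (w I J) (dd G clG g)) = sweedler2 G (\<lambda>f1 f2. sweedler2 G
      (\<lambda>g1 g2. left_mult f1 (dd G clG g1) \<otimes> \<alpha> (f2 * g2)) g) (w I J)"
  proof (rule words_eqI[where h = g])
    fix m' I' J' assume IJ': "I' \<in> idx m'" "J' \<in> idx m'"
    have inner: "(\<Sum>K\<in>idx m'. \<alpha> (w P J * w R K) * \<alpha> (S (w K L) * w M J'))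
        = (if R = L then \<alpha> (w P J * w M J') else 0)" if "R \<in> idx m'" "L \<in> idx m'" for P R L M
    proof -
      have "(\<Sum>K\<in>idx m'. \<alpha> (w P J * w R K) * \<alpha> (S (w K L) * w M J'))
          = \<alpha> (w P J * (\<Sum>K\<in>idx m'. w R K * S (w K L)) * w M J')"
        by (simp add: alpha_simps clinear_map_sum[OF clinear_alpha] sum_distrib_left sum_distrib_right mult.assoc)
      then show ?thesis by (simp add: antipode_word(2)[OF that] alpha_simps)
    qed
    have "coact (left_mult (w I J) (dd G clG (w I' J')))
        = (\<Sum>K\<in>idx m'. coact ((w I J * w I' K) \<otimes> bar G clG (w K J')))"
      by (simp add: dd_word[OF IJ'] clinear_map_sum[OF clinear_left_mult] clinear_map_sum[OF clinear_coact]
          left_mult_elem)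
    also have "\<dots> = (\<Sum>K\<in>idx m'. \<Sum>P\<in>idx m. \<Sum>R\<in>idx m'. \<Sum>L\<in>idx m'. \<Sum>M\<in>idx m'.
        ((w I P * w I' R) \<otimes> bar G clG (w L M)) \<otimes> (\<alpha> (w P J * w R K) * \<alpha> (S (w K L) * w M J')))"
    proof (rule sum.cong[OF refl])
      fix K assume K: "K \<in> idx m'"
      have "coact ((w I J * w I' K) \<otimes> bar G clG (w K J')) = (\<Sum>P\<in>idx m. \<Sum>R\<in>idx m'.
          tlift (\<lambda>y b. ((w I P * w I' R) \<otimes> y) \<otimes> (\<alpha> (w P J * w R K) * b)) (ad (bar G clG (w K J'))))"
        unfolding coact_elem
        by (rule sweedler2_word_mult[OF IJ IJ'(1) K]) (rule coact_inner_linear)+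
      also have "\<dots> = (\<Sum>P\<in>idx m. \<Sum>R\<in>idx m'. \<Sum>L\<in>idx m'. \<Sum>M\<in>idx m'.
        ((w I P * w I' R) \<otimes> bar G clG (w L M)) \<otimes> (\<alpha> (w P J * w R K) * \<alpha> (S (w K L) * w M J')))"
        by (simp add: ad_bar_bar ad_bar_word[OF K IJ'(2)] clinear_map_sum[OF clinear_tlift[OF coact_inner]]
            tlift_elem[OF coact_inner])
      finally show "coact ((w I J * w I' K) \<otimes> bar G clG (w K J')) = \<dots>" .
    qed
    also have "\<dots> = (\<Sum>P\<in>idx m. \<Sum>R\<in>idx m'. \<Sum>L\<in>idx m'. \<Sum>M\<in>idx m'. \<Sum>K\<in>idx m'.
        ((w I P * w I' R) \<otimes> bar G clG (w L M)) \<otimes> (\<alpha> (w P J * w R K) * \<alpha> (S (w K L) * w M J')))"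
      \<comment> \<open>The sum over \<open>K\<close>, the index shared by g_2 and S(g_3), has to be
        innermost for \<open>inner\<close> to apply.\<close>
      by (subst sum.swap, rule sum.cong[OF refl], subst sum.swap, rule sum.cong[OF refl],
          subst sum.swap, rule sum.cong[OF refl], rule sum.swap)
    also have "\<dots> = (\<Sum>P\<in>idx m. \<Sum>R\<in>idx m'. \<Sum>L\<in>idx m'. if R = L then \<Sum>M\<in>idx m'.
        ((w I P * w I' R) \<otimes> bar G clG (w R M)) \<otimes> \<alpha> (w P J * w M J') else 0)"
      by (rule sum.cong[OF refl], rule sum.cong[OF refl], rule sum.cong[OF refl])
        (simp add: inner flip: tensor_sum_right)
    also have "\<dots> = (\<Sum>P\<in>idx m. \<Sum>R\<in>idx m'. \<Sum>M\<in>idx m'.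
        ((w I P * w I' R) \<otimes> bar G clG (w R M)) \<otimes> \<alpha> (w P J * w M J'))"
      by (rule sum.cong[OF refl], rule sum.cong[OF refl]) simp
    also have "\<dots> = (\<Sum>P\<in>idx m. \<Sum>M\<in>idx m'. left_mult (w I P) (dd G clG (w I' M)) \<otimes> \<alpha> (w P J * w M J'))"
      by (rule sum.cong[OF refl], subst sum.swap, intro sum.cong refl)
        (simp add: dd_word[OF IJ'(1)] clinear_map_sum[OF clinear_left_mult] left_mult_elem tensor_sum_left)
    also have "\<dots> = (\<Sum>P\<in>idx m. sweedler2 G
      (\<lambda>g1 g2. left_mult (w I P) (dd G clG g1) \<otimes> \<alpha> (w P J * g2)) (w I' J'))"
      by (intro sum.cong refl sweedler2_word[symmetric] IJ' clinear_intros)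
    also have "\<dots> = sweedler2 G (\<lambda>f1 f2. sweedler2 G
      (\<lambda>g1 g2. left_mult f1 (dd G clG g1) \<otimes> \<alpha> (f2 * g2)) (w I' J')) (w I J)"
      by (rule sweedler2_word[symmetric]) (intro IJ clinear_intros)+
    finally show "coact (left_mult (w I J) (dd G clG (w I' J'))) = \<dots>" .
  qed (intro clinear_compose[OF clinear_coact] clinear_intros)+
qed (intro clinear_compose[OF clinear_coact] clinear_intros)+

text \<open>The forms \<open>f dg\<close> span: \<open>g \<otimes> v\<close> is the sum of the \<open>g S(v\<^sub>1) dv\<^sub>2\<close>.\<close>

lemma tensor_bar: "g \<otimes> bar G clG h = sweedler2 G (\<lambda>a b. left_mult (g * S a) (dd G clG b)) h"
proof (rule words_eqI[where h = h])
  fix m I J assume IJ: "I \<in> idx m" "J \<in> idx m"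
  have "sweedler2 G (\<lambda>a b. left_mult (g * S a) (dd G clG b)) (w I J)
      = (\<Sum>K\<in>idx m. left_mult (g * S (w I K)) (dd G clG (w K J)))"
    by (rule sweedler2_word) (intro IJ clinear_intros)+
  also have "\<dots> = (\<Sum>K\<in>idx m. \<Sum>L\<in>idx m. (g * (S (w I K) * w K L)) \<otimes> bar G clG (w L J))"
    using IJ by (simp add: dd_word clinear_map_sum[OF clinear_left_mult] left_mult_elem mult.assoc)
  also have "\<dots> = (\<Sum>L\<in>idx m. (g * (\<Sum>K\<in>idx m. S (w I K) * w K L)) \<otimes> bar G clG (w L J))"
    by (subst sum.swap) (simp add: sum_distrib_left tensor_sum_left)
  also have "\<dots> = (\<Sum>L\<in>idx m. if L = I then g \<otimes> bar G clG (w I J) else 0)"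
    using IJ by (intro sum.cong refl) (auto simp: antipode_word)
  finally show "g \<otimes> bar G clG (w I J) = sweedler2 G (\<lambda>a b. left_mult (g * S a) (dd G clG b)) (w I J)"
    using IJ by simp
qed (intro clinear_intros)+

text \<open>By \<open>tensor_bar\<close> the forms f dg span all one-forms. This gives the
  uniqueness half of the description in \<open>form_coaction\<close>.\<close>

lemma forms_eqI:
  assumes "clinear \<delta>" "clinear \<delta>'"
    and "\<And>f g. \<delta> (left_mult f (dd G clG g)) = \<delta>' (left_mult f (dd G clG g))"
  shows "\<delta> = \<delta>'"
proof (rule tensor_map_eqI[OF assms(1,2)])
  fix g x
  obtain v where v: "v \<in> aug G" "x = clG v" by (rule clG_surj)
  have "\<delta> (g \<otimes> bar G clG v) = sweedler2 G (\<lambda>a b. \<delta> (left_mult (g * S a) (dd G clG b))) v"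
    unfolding tensor_bar by (rule sweedler2_compose[OF assms(1)]) (intro clinear_intros)+
  moreover have "\<delta>' (g \<otimes> bar G clG v) = sweedler2 G (\<lambda>a b. \<delta>' (left_mult (g * S a) (dd G clG b))) v"
    unfolding tensor_bar by (rule sweedler2_compose[OF assms(2)]) (intro clinear_intros)+
  ultimately show "\<delta> (g \<otimes> x) = \<delta>' (g \<otimes> x)" using v assms(3) by (simp add: bar_aug)
qed

lemma form_coaction_eq: "form_coaction G clG \<alpha> = coact"
  unfolding form_coaction_def
proof (rule the_equality)
  show "clinear coact \<and> (\<forall>f g. coact (left_mult f (dd G clG g)) =
        sweedler2 G (\<lambda>f1 f2. sweedler2 G (\<lambda>g1 g2.
          left_mult f1 (dd G clG g1) \<otimes> \<alpha> (f2 * g2)) g) f)"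
    using clinear_coact coact_left_mult_dd by blast
  fix \<delta> :: "('a, 'l) tensor \<Rightarrow> (('a, 'l) tensor, 'b) tensor"
  assume "clinear \<delta> \<and> (\<forall>f g. \<delta> (left_mult f (dd G clG g)) =
        sweedler2 G (\<lambda>f1 f2. sweedler2 G (\<lambda>g1 g2.
          left_mult f1 (dd G clG g1) \<otimes> \<alpha> (f2 * g2)) g) f)"
  then show "\<delta> = coact"
    by (intro forms_eqI clinear_coact) (simp_all add: coact_left_mult_dd)
qed

text \<open>Along e^0 the adjoint coaction of a class has the coefficient
  \<open>coord_zero v\<close> times 1, and e^0 itself is coinvariant, so it makes no difference
  whether the projection comes before or after the coaction.\<close>

lemma coact_proj: "coact (proj \<eta>) = tmap proj (\<lambda>h. h) (coact \<eta>)"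
proof -
  have tm: "clinear (tmap proj (\<lambda>h :: 'b. h))" by (intro clinear_tmap clinear_proj clinear_id)
  have "(\<lambda>\<eta>. coact (proj \<eta>)) = (\<lambda>\<eta>. tmap proj (\<lambda>h. h) (coact \<eta>))"
  proof (rule tensor_map_eqI)
    fix h x
    obtain v where v: "v \<in> aug G" "x = clG v" by (rule clG_surj)
    show "coact (proj (h \<otimes> x)) = tmap proj (\<lambda>h. h) (coact (h \<otimes> x))"
    proof (rule words_eqI[where h = h])
      fix m I J assume IJ: "I \<in> idx m" "J \<in> idx m"
      have word: "coact (w I J \<otimes> x) = (\<Sum>K\<in>idx m. tlift (\<lambda>y b. (w I K \<otimes> y) \<otimes> (\<alpha> (w K J) * b)) (ad x))" for x
        unfolding coact_elem by (rule sweedler2_word) (intro IJ coact_inner_linear)+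
      have ad_e0: "ad e0 = e0 \<otimes> 1" using ad_clG[OF u11_aug] by (simp add: e_zero_def ad_bar_e0)
      \<comment> \<open>At weight 0 the value \<open>lam e0\<close> is 0 instead of 1, but then
        \<open>coord_zero v\<close> is 0 as well.\<close>
      have lam0: "lam e0 * coord_zero v = coord_zero v"
        by (cases "weight = 0") (simp_all add: lam_e coord_zero_def)
      have "coact (proj (w I J \<otimes> x)) = coord_zero v *\<^sub>C (\<Sum>K\<in>idx m. (w I K \<otimes> e0) \<otimes> \<alpha> (w K J))"
        by (simp add: proj_elem clinearD[OF clinear_coact] word ad_e0 tlift_elem[OF coact_inner] v lam_clG)
      moreover have "tmap proj (\<lambda>h. h) (coact (w I J \<otimes> x))
          = coord_zero v *\<^sub>C (\<Sum>K\<in>idx m. (w I K \<otimes> e0) \<otimes> \<alpha> (w K J))"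
      proof -
        have bil: "cbilinear (\<lambda>y b. proj (w I K \<otimes> y) \<otimes> (\<alpha> (w K J) * b))" for K
          by (intro cbilinearI clinear_compose[OF clinear_proj] clinear_intros)
        have "tmap proj (\<lambda>h. h) (coact (w I J \<otimes> x))
          = (\<Sum>K\<in>idx m. tmap proj (\<lambda>h. h) (tlift (\<lambda>y b. (w I K \<otimes> y) \<otimes> (\<alpha> (w K J) * b)) (ad x)))"
          by (simp add: word clinear_map_sum[OF tm])
        also have "\<dots> = (\<Sum>K\<in>idx m. tlift (\<lambda>y b. proj (w I K \<otimes> y) \<otimes> (\<alpha> (w K J) * b)) (ad_bar v))"
          by (intro sum.cong refl)
            (simp add: tlift_compose[OF tm coact_inner] tmap_elem[OF clinear_proj clinear_id] v ad_clG)
        also have "\<dots> = (\<Sum>K\<in>idx m. (lam e0 * coord_zero v) *\<^sub>C ((w I K \<otimes> e0) \<otimes> \<alpha> (w K J)))"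
          by (intro sum.cong refl)
            (simp only: ad_bar_expand clinearD(2)[OF clinear_tlift[OF bil]] clinear_map_sum[OF clinear_tlift[OF bil]]
              tlift_elem[OF bil], simp add: proj_elem lam_e ad_part_coord_zero tensor_scale_left tensor_scale_right
              mult_scaleC_right scaleC_scaleC mult.commute)
        finally show ?thesis by (simp add: lam0 complex_vector.scale_sum_right)
      qed
      ultimately show "coact (proj (w I J \<otimes> x)) = tmap proj (\<lambda>h. h) (coact (w I J \<otimes> x))" by simp
    qed (intro clinear_compose[OF clinear_coact] clinear_compose[OF clinear_proj] clinear_compose[OF tm] clinear_intros)+
  qed (intro clinear_compose[OF clinear_coact] clinear_proj clinear_compose[OF tm] clinear_coact)+
  then show ?thesis by metis
qed

subsection \<open>Horizontal forms\<close>

text \<open>The coefficient of e^0 as an element of G. Its values lie in an algebra, so its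
  behaviour under both multiplications and under d can be stated directly, and it has the same
  kernel as \<open>proj\<close>.\<close>

definition vert :: "('a, 'l) tensor \<Rightarrow> 'a" where
  "vert = tlift (\<lambda>g x. lam x *\<^sub>C g)"

lemma vert_bilinear: "cbilinear (\<lambda>(g :: 'a) x. lam x *\<^sub>C g)"
  by (intro cbilinearI clinear_intros)

lemma clinear_vert: "clinear vert" and vert_elem: "vert (g \<otimes> x) = lam x *\<^sub>C g"
  unfolding atomize_conj vert_def using clinear_tlift[OF vert_bilinear] tlift_elem[OF vert_bilinear] by blast

lemma proj_vert: "proj \<eta> = vert \<eta> \<otimes> e0"
proof -
  have "proj = (\<lambda>\<eta>. vert \<eta> \<otimes> e0)"
  proof (rule tensor_map_eqI)
    show "proj (g \<otimes> x) = vert (g \<otimes> x) \<otimes> e0" for g x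
      by (simp add: proj_elem vert_elem tensor_scale_left)
  qed (intro clinear_proj clinear_tensor_left clinear_vert)+
  then show ?thesis by metis
qed

lemma proj_eq_0_iff: "proj \<eta> = 0 \<longleftrightarrow> vert \<eta> = 0"
proof
  assume "proj \<eta> = 0"
  show "vert \<eta> = 0"
  proof (cases "weight = 0")
    case True
    \<comment> \<open>Here e^0 = 0 and \<open>proj\<close> is identically 0, so \<open>vert\<close>
      has to vanish identically too; it does because \<open>coord_zero\<close> carries the factor
      \<open>inverse weight\<close>.\<close>
    have "lam x = 0" for x
    proof -
      obtain v where "v \<in> aug G" "x = clG v" by (rule clG_surj)
      then show ?thesis using True by (simp add: lam_clG coord_zero_def)
    qed
    then have "vert = (\<lambda>\<eta>. 0)"
      by (intro tensor_map_eqI clinear_vert clinear_zero) (simp add: vert_elem)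
    then show ?thesis by metis
  next
    case False
    have "vert (proj \<eta>) = vert \<eta>" using False by (simp add: proj_vert vert_elem lam_e)
    then show ?thesis using \<open>proj \<eta> = 0\<close> by (simp add: clinearD[OF clinear_vert])
  qed
qed (simp add: proj_vert)

lemma vert_left_mult: "vert (left_mult p \<eta>) = p * vert \<eta>"
proof -
  have "(\<lambda>\<eta>. vert (left_mult p \<eta>)) = (\<lambda>\<eta>. p * vert \<eta>)"
  proof (rule tensor_map_eqI)
    show "vert (left_mult p (g \<otimes> x)) = p * vert (g \<otimes> x)" for g x
      by (simp add: left_mult_elem vert_elem mult_scaleC_right)
  qed (intro clinear_compose[OF clinear_vert] clinear_left_mult clinear_mult_right clinear_vert)+
  then show ?thesis by metis
qed

section \<open>Right multiplication of forms\<close>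

lemma I_SU_right_ideal:
  assumes "v \<in> I_SU N G r"
  shows "v * h \<in> I_SU N G r"
proof -
  have Q: "Q 1 j v = 0" "Q j 1 v = 0" if "j \<in> {1..N}" for j
    using assms that by (auto simp: I_SU_eq)
  have "Q 1 j (v * h) = 0" "Q j 1 (v * h) = 0" if "j \<in> {1..N}" for j
    using that by (simp_all add: Q_row_one Q_column_one Q sweedler2_zero)
  then show ?thesis using assms by (simp add: I_SU_eq aug_def counit_simps)
qed

text \<open>An arbitrary section of the class map on G^+. It need not be linear, but the class of
  \<open>rep x * h\<close> is linear in x because I is a right ideal.\<close>

definition rep :: "'l \<Rightarrow> 'a" where
  "rep x = (SOME v. v \<in> aug G \<and> clG v = x)"

lemma rep: "rep x \<in> aug G" "clG (rep x) = x"
proof -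
  obtain v where "v \<in> aug G" "x = clG v" by (rule clG_surj)
  then have "rep x \<in> aug G \<and> clG (rep x) = x"
    unfolding rep_def by (intro someI[where P = "\<lambda>v. v \<in> aug G \<and> clG v = x" and x = v] conjI) simp_all
  then show "rep x \<in> aug G" "clG (rep x) = x" by simp_all
qed

lemma clG_rep_mult:
  assumes "v \<in> aug G"
  shows "clG (rep (clG v) * h) = clG (v * h)"
proof -
  have "rep (clG v) - v \<in> aug G" using assms rep(1) by (simp add: complex_vector.subspace_diff[OF subspace_aug])
  moreover have "clG (rep (clG v) - v) = 0" by (simp add: clinearD[OF clinear_clG] rep)
  ultimately have "rep (clG v) - v \<in> I_SU N G r" using clG by (auto simp: quotient_map_def)
  from clG_eq_0[OF I_SU_right_ideal[OF this]] show ?thesis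
    by (simp add: left_diff_distrib clinearD[OF clinear_clG])
qed

lemma clinear_rep_mult: "clinear (\<lambda>x. clG (rep x * h))"
proof (rule clinearI)
  fix x y c
  have "rep x + rep y \<in> aug G" "c *\<^sub>C rep x \<in> aug G"
    using rep by (simp_all add: complex_vector.subspace_add[OF subspace_aug] complex_vector.subspace_scale[OF subspace_aug])
  from this[THEN clG_rep_mult, of h] show "clG (rep (x + y) * h) = clG (rep x * h) + clG (rep y * h)"
    "clG (rep (c *\<^sub>C x) * h) = c *\<^sub>C clG (rep x * h)"
    by (simp_all add: clinearD[OF clinear_clG] rep distrib_right mult_scaleC_left)
qed

lemma clinear_rep_mult' [clinear_intros]: "clinear f \<Longrightarrow> clinear (\<lambda>x. clG (rep (f x) * h))"
  by (rule clinear_compose[OF clinear_rep_mult])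

lemma right_mult_bilinear:
  "cbilinear (\<lambda>g x. sweedler2 G (\<lambda>h1 h2. (g * h1) \<otimes> clG (rep x * h2)) h)"
  by (intro cbilinearI clinear_intros)

lemma right_mult_eq:
  "right_mult G clG \<eta> h = tlift (\<lambda>g x. sweedler2 G (\<lambda>h1 h2. (g * h1) \<otimes> clG (rep x * h2)) h) \<eta>"
proof -
  let ?f = "tlift (\<lambda>g x. sweedler2 G (\<lambda>h1 h2. (g * h1) \<otimes> clG (rep x * h2)) h)"
  have "(THE f. clinear f \<and> (\<forall>g. \<forall>v\<in>aug G. f (g \<otimes> clG v)
      = sweedler2 G (\<lambda>h1 h2. (g * h1) \<otimes> clG (v * h2)) h)) = ?f"
  proof (rule the_equality)
    show "clinear ?f \<and> (\<forall>g. \<forall>v\<in>aug G. ?f (g \<otimes> clG v)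
      = sweedler2 G (\<lambda>h1 h2. (g * h1) \<otimes> clG (v * h2)) h)"
      by (simp add: clinear_tlift[OF right_mult_bilinear] tlift_elem[OF right_mult_bilinear] clG_rep_mult)
    fix f assume *: "clinear f \<and> (\<forall>g. \<forall>v\<in>aug G. f (g \<otimes> clG v)
      = sweedler2 G (\<lambda>h1 h2. (g * h1) \<otimes> clG (v * h2)) h)"
    show "f = ?f"
    proof (rule tensor_map_eqI)
      fix g x
      have "f (g \<otimes> clG (rep x)) = sweedler2 G (\<lambda>h1 h2. (g * h1) \<otimes> clG (rep x * h2)) h"
        using * rep(1)[of x] by blast
      then show "f (g \<otimes> x) = ?f (g \<otimes> x)"
        by (simp only: tlift_elem[OF right_mult_bilinear] rep)
    qed (use * clinear_tlift[OF right_mult_bilinear] in auto)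
  qed
  then show ?thesis by (simp add: right_mult_def)
qed

lemma right_mult_one: "right_mult G clG \<eta> 1 = \<eta>"
proof -
  have "tlift (\<lambda>g x. sweedler2 G (\<lambda>h1 h2. (g * h1) \<otimes> clG (rep x * h2)) 1) = (\<lambda>\<eta>. \<eta>)"
  proof (rule tensor_map_eqI)
    fix g x
    have "sweedler2 G (\<lambda>h1 h2. (g * h1) \<otimes> clG (rep x * h2)) (w [] []) = g \<otimes> x"
      by (subst sweedler2_word[of _ 0]) (simp_all add: clinear_intros rep)
    then show "tlift (\<lambda>g x. sweedler2 G (\<lambda>h1 h2. (g * h1) \<otimes> clG (rep x * h2)) 1) (g \<otimes> x) = g \<otimes> x"
      by (simp add: tlift_elem[OF right_mult_bilinear])
  qed (intro clinear_tlift right_mult_bilinear clinear_id)+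
  then show ?thesis unfolding right_mult_eq by metis
qed

text \<open>As Q_11 is a character, the coordinate of v b is Q_11(b) times that of v for v in G^+.
  So \<open>vert\<close> respects right multiplication up to the twist h_1 Q_11(h_2), and its kernel
  is a sub-bimodule.\<close>

lemma vert_right_mult:
  "vert (right_mult G clG \<eta> h) = sweedler2 G (\<lambda>h1 h2. Q 1 1 h2 *\<^sub>C (vert \<eta> * h1)) h"
proof -
  have "(\<lambda>\<eta>. vert (tlift (\<lambda>g x. sweedler2 G (\<lambda>h1 h2. (g * h1) \<otimes> clG (rep x * h2)) h) \<eta>))
      = (\<lambda>\<eta>. sweedler2 G (\<lambda>h1 h2. Q 1 1 h2 *\<^sub>C (vert \<eta> * h1)) h)"
  proof (rule tensor_map_eqI)
    fix g x
    have coord: "coord_zero (rep x * b) = Q 1 1 b * coord_zero (rep x)" "rep x * b \<in> aug G" for b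
      using rep(1)[of x] by (simp_all add: coord_zero_def aug_def counit_simps calgebra_homD(3)[OF chi_hom])
    have "vert (sweedler2 G (\<lambda>h1 h2. (g * h1) \<otimes> clG (rep x * h2)) h)
        = sweedler2 G (\<lambda>h1 h2. vert ((g * h1) \<otimes> clG (rep x * h2))) h"
      by (rule sweedler2_compose[OF clinear_vert]) (intro clinear_intros)+
    also have "\<dots> = sweedler2 G (\<lambda>h1 h2. Q 1 1 h2 *\<^sub>C (vert (g \<otimes> x) * h1)) h"
      using rep[of x] lam_clG[of "rep x"]
      by (simp add: vert_elem lam_clG coord mult_scaleC_left scaleC_scaleC)
    finally show "vert (tlift (\<lambda>g x. sweedler2 G (\<lambda>h1 h2. (g * h1) \<otimes> clG (rep x * h2)) h) (g \<otimes> x)) = \<dots>"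
      by (simp add: tlift_elem[OF right_mult_bilinear])
  qed (intro clinear_compose[OF clinear_vert] clinear_tlift right_mult_bilinear clinear_intros)+
  then show ?thesis unfolding right_mult_eq by metis
qed

text \<open>The coordinate of e^0 factors through \<alpha>, so coinvariance of g replaces the second
  leg by 1, where the coordinate is 0.\<close>

lemma vert_dd:
  assumes "g \<in> coinvariants G \<alpha>"
  shows "vert (dd G clG g) = 0"
proof -
  obtain \<chi> where \<chi>: "calgebra_hom \<chi>" "\<And>h. \<chi> (\<alpha> h) = Q 1 1 h" using chi_factors by blast
  define \<mu> where "\<mu> w = inverse weight * (\<chi> w - counit H w)" for w
  have \<mu>_alpha: "\<mu> (\<alpha> v) = coord_zero v" for v
    by (simp add: \<mu>_def \<chi> counit_alpha coord_zero_def)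
  have lin: "clinear \<mu>" unfolding \<mu>_def
    by (intro clinear_mult_right clinear_minus calgebra_homD(1)[OF \<chi>(1)] clinear_counit_H)
  note [clinear_intros] = clinear_compose[OF lin]
  have bil: "cbilinear (\<lambda>(a :: 'a) y. \<mu> y *\<^sub>C a)" by (intro cbilinearI clinear_intros)
  have "vert (dd G clG g) = sweedler2 G (\<lambda>a b. vert (a \<otimes> bar G clG b)) g"
    unfolding dd_def by (rule sweedler2_compose[OF clinear_vert]) (intro clinear_intros)+
  also have "\<dots> = sweedler2 G (\<lambda>a b. tlift (\<lambda>a y. \<mu> y *\<^sub>C a) (a \<otimes> \<alpha> b)) g"
    by (simp add: vert_elem lam_bar tlift_elem[OF bil] \<mu>_alpha)
  also have "\<dots> = tlift (\<lambda>a y. \<mu> y *\<^sub>C a) (sweedler2 G (\<lambda>a b. a \<otimes> \<alpha> b) g)"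
    by (rule sweedler2_compose[OF clinear_tlift[OF bil], symmetric]) (intro clinear_intros)+
  also have "\<dots> = \<mu> (\<alpha> 1) *\<^sub>C g"
    using assms by (simp add: coinvariants_def tlift_elem[OF bil] alpha_simps)
  also have "\<dots> = 0" by (simp add: \<mu>_alpha coord_one)
  finally show ?thesis .
qed

lemma subspace_vert: "complex_vector.subspace {\<eta>. vert \<eta> = 0}"
  by (simp add: complex_vector.subspace_def clinearD[OF clinear_vert])

lemma horizontal_vert: "horizontal G clG \<alpha> \<subseteq> {\<eta>. vert \<eta> = 0}"
proof -
  have "base_forms G clG \<alpha> \<subseteq> {\<eta>. vert \<eta> = 0}"
    unfolding base_forms_def
    by (rule complex_vector.span_minimal[OF _ subspace_vert]) (auto simp: vert_left_mult vert_dd)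
  then show ?thesis
    unfolding horizontal_def
    by (intro complex_vector.span_minimal[OF _ subspace_vert])
      (auto simp: vert_right_mult vert_left_mult sweedler2_zero)
qed

section \<open>Forms generated from the left by differentials of coinvariants\<close>

lemma left_horizontal_subset: "left_horizontal G clG \<alpha> \<subseteq> horizontal G clG \<alpha>"
  unfolding left_horizontal_def horizontal_def
proof (rule complex_vector.span_mono, safe)
  fix p \<eta> assume "\<eta> \<in> base_forms G clG \<alpha>"
  then show "\<exists>p' \<eta>' h. left_mult p \<eta> = right_mult G clG (left_mult p' \<eta>') h \<and> \<eta>' \<in> base_forms G clG \<alpha>"
    by (intro exI[of _ p] exI[of _ \<eta>] exI[of _ 1]) (simp add: right_mult_one)
qed

lemma left_horizontal_left_mult:
  assumes "\<eta> \<in> left_horizontal G clG \<alpha>"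
  shows "left_mult g \<eta> \<in> left_horizontal G clG \<alpha>"
  using assms unfolding left_horizontal_def
proof (induction rule: complex_vector.span_induct_alt)
  case base
  show ?case by (simp add: clinearD[OF clinear_left_mult] complex_vector.span_zero)
next
  case (step c x y)
  then obtain p \<eta> where "x = left_mult p \<eta>" "\<eta> \<in> base_forms G clG \<alpha>" by blast
  then have "left_mult g x \<in> cspan {left_mult p \<eta> | p \<eta>. \<eta> \<in> base_forms G clG \<alpha>}"
    by (intro complex_vector.span_base) (auto simp: left_mult_mult)
  with step show ?case
    by (simp add: clinearD[OF clinear_left_mult] complex_vector.span_add complex_vector.span_scale)
qed

lemma sweedler2_uS:
  assumes "i \<in> {1..N}" "j \<in> {1..N}" "\<And>y. clinear (\<lambda>x. F x y)" "\<And>x. clinear (\<lambda>y. F x y)"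
  shows "sweedler2 G F (u i 1 * S (u 1 j))
    = (\<Sum>k\<in>{1..N}. \<Sum>l\<in>{1..N}. F (u i k * S (u l j)) (u k 1 * S (u 1 l)))"
proof -
  have "comult G (u i 1 * S (u 1 j)) = (\<Sum>x\<in>{1..N} \<times> {1..N}.
      (u i (fst x) * S (u (snd x) j)) \<otimes> (u (fst x) 1 * S (u 1 (snd x))))"
    unfolding comult_mult comult_u[OF assms(1) one_in] comult_antipode_u[OF one_in assms(2)] sum_product
    by (simp add: times_tensor_elem sum.cartesian_product case_prod_beta)
  from sweedler2_sum[OF this assms(3,4)] show ?thesis by (simp add: sum.cartesian_product case_prod_beta)
qed

text \<open>\<alpha> kills u^k_1 and S(u^1_l) unless k = 1 and l = 1, and the remaining product of
  \<open>detinv\<close> with its inverse is 1.\<close>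

lemma uS_coinvariant:
  assumes "i \<in> {1..N}" "j \<in> {1..N}"
  shows "u i 1 * S (u 1 j) \<in> coinvariants G \<alpha>"
proof -
  have "sweedler2 G (\<lambda>a b. a \<otimes> \<alpha> b) (u i 1 * S (u 1 j))
      = (\<Sum>k\<in>{1..N}. \<Sum>l\<in>{1..N}. (u i k * S (u l j)) \<otimes> \<alpha> (u k 1 * S (u 1 l)))"
    by (rule sweedler2_uS) (intro assms clinear_intros)+
  also have "\<dots> = (\<Sum>l\<in>{1..N}. (u i 1 * S (u l j)) \<otimes> \<alpha> (u 1 1 * S (u 1 l)))"
    by (rule sum_at_one) (use in_2N in \<open>simp add: alpha_simps alpha_i1\<close>)
  also have "\<dots> = (u i 1 * S (u 1 j)) \<otimes> \<alpha> (u 1 1 * S (u 1 1))"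
    by (rule sum_at_one) (use in_2N in \<open>simp add: alpha_simps alpha_S_1i\<close>)
  finally show ?thesis by (simp add: coinvariants_def alpha_simps alpha_11 detinv_inverse)
qed

text \<open>Contracting \<open>d(u\<^sup>i\<^sub>1 S(u\<^sup>1\<^sub>j))\<close> with \<open>S(S(u\<^sup>j\<^sub>a)) S(u\<^sup>m\<^sub>i)\<close> isolates a single left-invariant form.\<close>

lemma bar_uS_left_horizontal:
  assumes "m \<in> {1..N}" "a \<in> {1..N}"
  shows "1 \<otimes> bar G clG (u m 1 * S (u 1 a)) \<in> left_horizontal G clG \<alpha>"
proof -
  define X where "X = (\<Sum>j\<in>{1..N}. \<Sum>i\<in>{1..N}.
    left_mult (S (S (u j a)) * S (u m i)) (dd G clG (u i 1 * S (u 1 j))))"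
  \<comment> \<open>A base form is f dg with both f and g coinvariant; here f = 1.\<close>
  have "left_mult 1 (dd G clG (u i 1 * S (u 1 j))) \<in> base_forms G clG \<alpha>"
    if "i \<in> {1..N}" "j \<in> {1..N}" for i j
  proof -
    have "1 \<in> coinvariants G \<alpha>"
      using sweedler2_word[of "[]" 0 "[]" "\<lambda>a b. a \<otimes> \<alpha> b"]
      by (simp add: coinvariants_def clinear_intros alpha_simps)
    then show ?thesis unfolding base_forms_def
      using uS_coinvariant[OF that] by (intro complex_vector.span_base) blast
  qed
  then have "X \<in> left_horizontal G clG \<alpha>"
    unfolding X_def left_horizontal_def left_mult_one
    by (intro complex_vector.span_sum complex_vector.span_base) blast
  moreover have "X = 1 \<otimes> bar G clG (u m 1 * S (u 1 a))"
  proof -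
    have "X = (\<Sum>j\<in>{1..N}. \<Sum>i\<in>{1..N}. \<Sum>k\<in>{1..N}. \<Sum>l\<in>{1..N}.
        (S (S (u j a)) * (S (u m i) * u i k) * S (u l j)) \<otimes> bar G clG (u k 1 * S (u 1 l)))"
      unfolding X_def
    proof (intro sum.cong refl)
      fix j i assume ji: "j \<in> {1..N}" "i \<in> {1..N}"
      have "dd G clG (u i 1 * S (u 1 j)) = (\<Sum>k\<in>{1..N}. \<Sum>l\<in>{1..N}.
          (u i k * S (u l j)) \<otimes> bar G clG (u k 1 * S (u 1 l)))"
        unfolding dd_def by (rule sweedler2_uS) (intro ji clinear_intros)+
      then show "left_mult (S (S (u j a)) * S (u m i)) (dd G clG (u i 1 * S (u 1 j)))
        = (\<Sum>k\<in>{1..N}. \<Sum>l\<in>{1..N}.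
          (S (S (u j a)) * (S (u m i) * u i k) * S (u l j)) \<otimes> bar G clG (u k 1 * S (u 1 l)))"
        by (simp add: clinear_map_sum[OF clinear_left_mult] left_mult_elem mult.assoc)
    qed
    also have "\<dots> = (\<Sum>k\<in>{1..N}. \<Sum>l\<in>{1..N}. \<Sum>j\<in>{1..N}. \<Sum>i\<in>{1..N}.
        (S (S (u j a)) * (S (u m i) * u i k) * S (u l j)) \<otimes> bar G clG (u k 1 * S (u 1 l)))"
      by (rule sum_swap_pairs)
    also have "\<dots> = (\<Sum>k\<in>{1..N}. \<Sum>l\<in>{1..N}. (\<Sum>j\<in>{1..N}.
        S (S (u j a)) * (\<Sum>i\<in>{1..N}. S (u m i) * u i k) * S (u l j)) \<otimes> bar G clG (u k 1 * S (u 1 l)))"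
      by (simp add: sum_distrib_left sum_distrib_right tensor_sum_left)
    also have "\<dots> = (\<Sum>k\<in>{1..N}. \<Sum>l\<in>{1..N}. if l = a then
        if k = m then 1 \<otimes> bar G clG (u k 1 * S (u 1 a)) else 0 else 0)"
      using assms by (intro sum.cong refl) (auto simp: antipode_u antipode_antipode_u)
    also have "\<dots> = 1 \<otimes> bar G clG (u m 1 * S (u 1 a))"
      using assms by simp
    finally show ?thesis .
  qed
  ultimately show ?thesis by simp
qed

text \<open>The scalar is q'^2 / nu from \<open>coord_plus\<close> times kappa 1 q'^(-1) nu from
  \<open>Q_uS_plus\<close>; the leftover nu / nu is absorbed by \<open>ep_fix\<close>. It is nonzero
  for every q.\<close>

lemma bar_uS_plus:
  assumes "k \<in> {2..N}"
  shows "bar G clG (u k 1 * S (u 1 1)) = (q' * kappa 1) *\<^sub>C ep k"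
proof -
  have k: "k \<in> {1..N}" "k \<noteq> 1" using assms by auto
  have "coord_zero (u k 1 * S (u 1 1)) = 0"
    using k one_in by (simp add: coord_zero_def counit_simps counit_u Q_uS_plus)
  moreover have "coord_plus m (u k 1 * S (u 1 1))
      = (if m = k then q' * kappa 1 * (inverse (nu q) * nu q) else 0)" if "m \<in> {2..N}" for m
    using that k one_in q'_nz by (auto simp: coord_plus_def Q_uS_plus power2_eq_square field_simps)
  moreover have "coord_minus m (u k 1 * S (u 1 1)) = 0" if "m \<in> {2..N}" for m
    using that k one_in by (simp add: coord_minus_def Q_uS_plus)
  ultimately have "bar G clG (u k 1 * S (u 1 1)) = (q' * kappa 1 * (inverse (nu q) * nu q)) *\<^sub>C ep k"
    using assms by (simp add: bar_expand if_distrib[of "\<lambda>c. c *\<^sub>C _"] cong: if_cong)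
  then show ?thesis using ep_fix[OF assms] by (metis scaleC_scaleC)
qed

lemma bar_uS_minus:
  assumes "l \<in> {2..N}"
  shows "bar G clG (u 1 1 * S (u 1 l)) = (q' * complex_of_real q * kappa l * inverse (nu q)) *\<^sub>C em l"
proof -
  have l: "l \<in> {1..N}" "l \<noteq> 1" using assms by auto
  have "coord_zero (u 1 1 * S (u 1 l)) = 0"
    using l one_in by (simp add: coord_zero_def counit_simps counit_u counit_antipode_u Q_uS_minus)
  moreover have "coord_plus m (u 1 1 * S (u 1 l)) = 0" if "m \<in> {2..N}" for m
    using that l one_in by (simp add: coord_plus_def Q_uS_minus_row)
  moreover have "coord_minus m (u 1 1 * S (u 1 l))
      = (if m = l then q' * complex_of_real q * kappa l * inverse (nu q) else 0)" if "m \<in> {2..N}" for m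
    using that l q'_nz by (auto simp: coord_minus_def Q_uS_minus power2_eq_square field_simps)
  ultimately show ?thesis
    using assms by (simp add: bar_expand if_distrib[of "\<lambda>c. c *\<^sub>C _"] cong: if_cong)
qed

lemma left_horizontal_of_multiple:
  assumes "1 \<otimes> (c *\<^sub>C y) \<in> left_horizontal G clG \<alpha>" "c \<noteq> 0"
  shows "g \<otimes> y \<in> left_horizontal G clG \<alpha>"
proof -
  have "inverse c *\<^sub>C left_mult g (1 \<otimes> (c *\<^sub>C y)) \<in> left_horizontal G clG \<alpha>"
    using left_horizontal_left_mult[OF assms(1), of g] unfolding left_horizontal_def
    by (rule complex_vector.span_scale)
  then show ?thesis
    using assms(2) by (simp add: left_mult_elem tensor_scale_right scaleC_scaleC
        clinearD[OF clinear_left_mult])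
qed

lemma ep_left_horizontal:
  assumes "k \<in> {2..N}"
  shows "g \<otimes> ep k \<in> left_horizontal G clG \<alpha>"
proof (rule left_horizontal_of_multiple)
  show "1 \<otimes> ((q' * kappa 1) *\<^sub>C ep k) \<in> left_horizontal G clG \<alpha>"
    using bar_uS_left_horizontal[OF _ one_in, of k] assms by (simp add: bar_uS_plus)
  show "q' * kappa 1 \<noteq> 0" using q'_nz kappa_nonzero[OF one_in] by simp
qed

text \<open>Unlike for e^+, the scalar of \<open>bar_uS_minus\<close> contains
  \<open>inverse (nu q)\<close> and so is 0 at q = 1. In that case \<open>em_fix\<close> shows that
  the form itself is 0.\<close>

lemma em_left_horizontal:
  assumes "l \<in> {2..N}"
  shows "g \<otimes> em l \<in> left_horizontal G clG \<alpha>"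
proof (cases "nu q = 0")
  case True
  then have "em l = 0" using em_fix[OF assms] by simp
  then show ?thesis by (simp add: left_horizontal_def complex_vector.span_zero)
next
  case False
  have l: "l \<in> {1..N}" using assms by auto
  show ?thesis
  proof (rule left_horizontal_of_multiple)
    show "1 \<otimes> ((q' * complex_of_real q * kappa l * inverse (nu q)) *\<^sub>C em l) \<in> left_horizontal G clG \<alpha>"
      using bar_uS_left_horizontal[OF one_in l] assms by (simp add: bar_uS_minus)
    show "q' * complex_of_real q * kappa l * inverse (nu q) \<noteq> 0"
      using q'_nz kappa_nonzero[OF l] q False by simp
  qed
qed

text \<open>What \<open>proj\<close> discards is the e^+ and e^- part of the coordinate expansion,
  and each of its terms is left horizontal with arbitrary coefficient in G.\<close>

lemma strong: "\<eta> - proj \<eta> \<in> left_horizontal G clG \<alpha>"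
proof (induction \<eta> rule: tensor_induct)
  case (elem g x)
  obtain v where v: "v \<in> aug G" "x = clG v" by (rule clG_surj)
  have "g \<otimes> x - proj (g \<otimes> x) = (\<Sum>m\<in>{2..N}. coord_plus m v *\<^sub>C (g \<otimes> ep m))
      + (\<Sum>m\<in>{2..N}. coord_minus m v *\<^sub>C (g \<otimes> em m))"
    unfolding proj_elem v(2) lam_clG[OF v(1)]
    by (subst clG_expand[OF v(1)]) (simp add: tensor_add_right tensor_scale_right tensor_sum_right)
  also have "\<dots> \<in> left_horizontal G clG \<alpha>"
    using ep_left_horizontal em_left_horizontal unfolding left_horizontal_def
    by (intro complex_vector.span_add complex_vector.span_sum complex_vector.span_scale) blast+
  finally show ?case .
next
  case (add s t)
  have "s + t - proj (s + t) = (s - proj s) + (t - proj t)"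
    by (simp add: clinearD[OF clinear_proj])
  then show ?case using complex_vector.span_add[OF add[unfolded left_horizontal_def]]
    by (simp only: left_horizontal_def)
qed

text \<open>For the kernel, strongness gives one inclusion: a form killed by \<open>proj\<close>
  equals its own difference with its projection, hence is left horizontal. The other inclusion is
  that horizontal forms have \<open>vert\<close> equal to 0.\<close>

lemma connection: "is_connection G clG \<alpha> proj"
  unfolding is_connection_def form_coaction_eq
proof (intro conjI allI)
  show "{\<eta>. proj \<eta> = 0} = horizontal G clG \<alpha>"
  proof (intro equalityI subsetI)
    fix \<eta> assume "\<eta> \<in> {\<eta>. proj \<eta> = 0}"
    then show "\<eta> \<in> horizontal G clG \<alpha>"
      using strong[of \<eta>] left_horizontal_subset by auto
  next
    fix \<eta> assume "\<eta> \<in> horizontal G clG \<alpha>"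
    then show "\<eta> \<in> {\<eta>. proj \<eta> = 0}" using horizontal_vert by (auto simp: proj_eq_0_iff)
  qed
qed (rule clinear_proj proj_left_mult proj_idem coact_proj)+

end

theorem lemma8p1:
  fixes N :: nat and q :: real and q' :: complex
    and G :: "'g::complex_algebra_1 qgroup"
    and H :: "'h::complex_algebra_1 qgroup" and detinv :: 'h
    and \<alpha> :: "'g \<Rightarrow> 'h"
    and r :: "('g, 'g) tensor \<Rightarrow> complex"
    and clG :: "'g \<Rightarrow> 'l::complex_vector" and clH :: "'h \<Rightarrow> 'k::complex_vector"
  assumes "N \<ge> 2" "0 < q" "q \<le> 1" "q' ^ N = complex_of_real q"
    and "quantum_SU N q G"
    and "quantum_U (N - 1) q H detinv"
    and "quantum_alpha N G H detinv \<alpha>"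
    and "SU_coquasi_triangular N q q' G r"
    and "quotient_map clG (aug G) (I_SU N G r)"
    and "quotient_map clH (aug H) (\<alpha> ` I_SU N G r)"
  shows "(\<exists>!i. clinear i \<and> i (clH (detinv - 1)) = e_zero G clG) \<and>
    (\<forall>i. clinear i \<and> i (clH (detinv - 1)) = e_zero G clG \<longrightarrow>
       bicovariant_splitting_map G H clG clH \<alpha> i \<and>
       is_connection G clG \<alpha> (Pi_omega G clG clH \<alpha> i) \<and>
       is_strong G clG \<alpha> (Pi_omega G clG clH \<alpha> i) \<and>
       Pi_omega G clG clH \<alpha> i (1 \<otimes> e_zero G clG) = 1 \<otimes> e_zero G clG \<and>
       (\<forall>j\<in>{1..N - 1}.
          Pi_omega G clG clH \<alpha> i (1 \<otimes> e_plus G clG j) = 0 \<and>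
          Pi_omega G clG clH \<alpha> i (1 \<otimes> e_minus G clG j) = 0))"
proof -
  interpret projective_bundle N G q q' r H detinv \<alpha> clG clH
    using assms quantum_SU_matrix_hopf[OF assms(5)]
    by (simp add: projective_bundle_def projective_bundle_axioms_def coquasi_triangular_SU_def
        coquasi_triangular_SU_axioms_def)
  have "\<exists>!i. clinear i \<and> i (clH (detinv - 1)) = e_zero G clG"
    using splitting_exists splitting_unique by blast
  moreover have "bicovariant_splitting_map G H clG clH \<alpha> i \<and>
       is_connection G clG \<alpha> (Pi_omega G clG clH \<alpha> i) \<and>
       is_strong G clG \<alpha> (Pi_omega G clG clH \<alpha> i) \<and>
       Pi_omega G clG clH \<alpha> i (1 \<otimes> e_zero G clG) = 1 \<otimes> e_zero G clG \<and>
       (\<forall>j\<in>{1..N - 1}.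
          Pi_omega G clG clH \<alpha> i (1 \<otimes> e_plus G clG j) = 0 \<and>
          Pi_omega G clG clH \<alpha> i (1 \<otimes> e_minus G clG j) = 0)"
    if "clinear i" "i (clH (detinv - 1)) = e_zero G clG" for i
  proof (intro conjI ballI)
    note eq = Pi_omega_eq[OF that]
    show "bicovariant_splitting_map G H clG clH \<alpha> i" by (rule bicovariant[OF that])
    show "is_connection G clG \<alpha> (Pi_omega G clG clH \<alpha> i)" unfolding eq by (rule connection)
    show "is_strong G clG \<alpha> (Pi_omega G clG clH \<alpha> i)"
      unfolding eq is_strong_def using strong by blast
    show "Pi_omega G clG clH \<alpha> i (1 \<otimes> e_zero G clG) = 1 \<otimes> e_zero G clG"
      unfolding eq by (rule proj_e)
    fix j assume "j \<in> {1..N - 1}"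
    \<comment> \<open>The form e^+_j or e^-_j comes from a matrix entry with index j + 1.\<close>
    then have "j + 1 \<in> {2..N}" by auto
    then show "Pi_omega G clG clH \<alpha> i (1 \<otimes> e_plus G clG j) = 0"
      "Pi_omega G clG clH \<alpha> i (1 \<otimes> e_minus G clG j) = 0"
      unfolding eq e_plus_def e_minus_def by (rule proj_e)+
  qed
  ultimately show ?thesis by blast
qed

end
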